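(* Let $k\geq 3$ be an odd integer, $\beta>0$ an integer, and $D=\{\beta j^k: j\geq 1 \text{ an integer}\}$. For a positive integer $n$ let $\gamma^+(n)$ be the infimum of $b_0$ over all cosine polynomials $T(x)=b_0+\sum_{m\in D,\, m\leq n} b_m\cos(2\pi m x)$ with all coefficients $b_0,b_m\geq 0$, $T(x)\geq 0$ for all real $x$, and $T(0)=1$. Then $$\gamma^+(n)\geq \left(\frac{1}{\varphi(k)}+o(1)\right)(\log n)^{-1}\quad\text{as } n\to\infty,$$ where $\varphi$ is Euler's totient function. *)

theory Defs
  imports
    Complex_Main
    "HOL-Library.Landau_Symbols"
    "HOL-Number_Theory.Totient"
begin

definition power_multiples :: "nat \<Rightarrow> nat \<Rightarrow> nat set" where
  "power_multiples \<beta> k = {\<beta> * j ^ k | j. 1 \<le> j}"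

definition cos_poly :: "nat set \<Rightarrow> nat \<Rightarrow> real \<Rightarrow> (nat \<Rightarrow> real) \<Rightarrow> real \<Rightarrow> real" where
  "cos_poly D n b0 b x = b0 + (\<Sum>m | m \<in> D \<and> m \<le> n. b m * cos (2 * pi * real m * x))"

text \<open>
  The set below contains 1 (the constant polynomial 1) and is bounded below by 0, so the real
  infimum is the genuine one.
\<close>

definition gamma_plus :: "nat set \<Rightarrow> nat \<Rightarrow> real" where
  "gamma_plus D n = Inf {b0. \<exists>b :: nat \<Rightarrow> real.
     0 \<le> b0 \<and> (\<forall>m. m \<in> D \<and> m \<le> n \<longrightarrow> 0 \<le> b m) \<and>
     (\<forall>x. 0 \<le> cos_poly D n b0 b x) \<and> cos_poly D n b0 b 0 = 1}"

end

theory Submission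
  imports
    Defs
    "HOL-Complex_Analysis.Complex_Analysis"
    "HOL-Number_Theory.Number_Theory"
    "HOL-Probability.Sinc_Integral"
    "HOL-Real_Asymp.Real_Asymp"
begin

text \<open>
  Let \<open>d\<close> be a prime divisor of \<open>k\<close>. If \<open>p \<equiv> 1 (mod d)\<close> is prime, the \<open>k\<close>-th powers form a proper
  subgroup of the units modulo \<open>p\<close>; computing the first two moments of the sums
  \<open>C(a) = \<Sum>\<^sub>u cos (2 \<pi> a u\<^sup>k / p)\<close> shows that \<open>C(a) \<le> -\<surd>p\<close> for some \<open>a\<close>. Averaging \<open>T \<ge> 0\<close> over
  the points \<open>a u\<^sup>k / (\<beta> p)\<close>, and then over \<open>p \<le> X\<close> with weights close to \<open>ln p\<close>, bounds \<open>b\<^sub>0\<close> from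
  below by \<open>1 / (\<surd>X + 1)\<close>, as soon as
  \<open>\<Sum>\<^bsub>p \<le> X\<^esub> ln p (1/\<surd>p - 1/\<surd>X) \<ge> (ln n)/k\<close>. By the prime number theorem in arithmetic
  progressions the left-hand side is \<open>\<surd>X/(d - 1)\<close> asymptotically, but a lower bound by any multiple
  larger than a third of it is enough, since \<open>k \<ge> 3\<close>. Such a bound follows from the nonvanishing of
  Dirichlet's \<open>L\<close>-functions on the line \<open>Re s = 1\<close> by comparing the weight with a band-limited
  minorant, and no estimate for the \<open>L\<close>-functions on that line is needed.
\<close>

subsection \<open>Dirichlet series\<close>

text \<open>The threshold one third comes from comparing two scales. A frequency
  \<open>\<beta> * j ^ k <= n\<close> has \<open>ln j <= (ln n) / k <= (ln n) / 3\<close>, and this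
  bounds the damage done by the prime divisors of \<open>j\<close>. The target only asks that
  \<open>sqrt X + 1\<close> be at most \<open>totient k * ln n\<close>, and \<open>d - 1\<close>
  divides \<open>totient k\<close>. So if primes are counted with a constant \<open>c > 1/3\<close>,
  then \<open>sqrt X = (d - 1) * ln n / (c * k)\<close> stays below \<open>(d - 1) * ln n\<close> by
  a fixed factor, which swallows the \<open>+ 1\<close> as well. In the weight
  \<open>1 / sqrt p - 1 / sqrt X\<close> the first part is the gain of the test measure at
  \<open>p\<close>; the second is the share of the total mass that has to remain negative on every
  frequency. All characters modulo \<open>d\<close> are multiplied together because the logarithmic
  derivative of the product has nonnegative coefficients, carried by \<open>n = 1 (mod d)\<close>. A
  minorant with frequencies in \<open>[-pi, pi]\<close> sees this derivative only on a compact
  segment of the line \<open>Re s = 1\<close>, where continuity replaces growth bounds. The price is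
  the constant \<open>7/20\<close> in place of 1.\<close>

text \<open>Since \<open>0 powr z = 0\<close>, the term \<open>n = 0\<close> vanishes and the sum
  may run over all naturals.\<close>

definition dseries :: "(nat \<Rightarrow> complex) \<Rightarrow> complex \<Rightarrow> complex" where
  "dseries a s = (\<Sum>n. a n * of_nat n powr (-s))"

definition abs_conv_right :: "(nat \<Rightarrow> complex) \<Rightarrow> bool" where
  "abs_conv_right a \<longleftrightarrow> (\<forall>\<sigma>>1. summable (\<lambda>n. norm (a n) * real n powr (-\<sigma>)))"

lemma norm_of_nat_powr: "norm (of_nat n powr s :: complex) = real n powr Re s"
  by (simp add: norm_powr_real_powr)

lemma abs_conv_right_summable:
  assumes "abs_conv_right a" "Re s > 1"
  shows "summable (\<lambda>n. norm (a n * of_nat n powr (-s)))"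
  using assms by (simp add: abs_conv_right_def norm_mult norm_of_nat_powr)

lemma dseries_sums:
  assumes "abs_conv_right a" "Re s > 1"
  shows "(\<lambda>n. a n * of_nat n powr (-s)) sums dseries a s"
  using summable_norm_cancel[OF abs_conv_right_summable[OF assms]]
  by (simp add: dseries_def summable_sums)

text \<open>Half of the excess \<open>\<sigma> - 1\<close> pays for the logarithm through
  \<open>ln n <= n powr e / e\<close>. With \<open>ln 0 = 0\<close> the hypothesis also makes sense
  at \<open>n = 0\<close>.\<close>

lemma abs_conv_right_ln:
  assumes "\<And>n. norm (a n) \<le> C * (1 + ln (real n))"
  shows "abs_conv_right a"
  unfolding abs_conv_right_def
proof (intro allI impI)
  fix \<sigma> :: real assume \<sigma>: "\<sigma> > 1"
  define e where "e = (\<sigma> - 1) / 2"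
  have "e > 0" using \<sigma> by (simp add: e_def)
  have C: "0 \<le> C" using order_trans[OF norm_ge_zero assms[of 1]] by simp
  show "summable (\<lambda>n. norm (a n) * real n powr (-\<sigma>))"
  proof (rule summable_comparison_test'[where N = 1])
    show "summable (\<lambda>n. C * (1 + 1 / e) * real n powr (- (1 + e)))"
      using \<open>e > 0\<close> by (intro summable_mult) (simp add: summable_real_powr_iff)
    fix n :: nat assume n: "n \<ge> 1"
    have "ln (real n) \<le> real n powr e / e" using n \<open>e > 0\<close> by (intro ln_powr_bound) auto
    moreover have "1 \<le> real n powr e" using n \<open>e > 0\<close> by (simp add: ge_one_powr_ge_zero)
    ultimately have "1 + ln (real n) \<le> (1 + 1 / e) * real n powr e"
      by (simp add: algebra_simps)
    then have "norm (a n) \<le> C * ((1 + 1 / e) * real n powr e)"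
      using assms[of n] C mult_left_mono order_trans by blast
    then have "norm (a n) * real n powr (-\<sigma>) \<le> C * ((1 + 1 / e) * real n powr e) * real n powr (-\<sigma>)"
      by (intro mult_right_mono) auto
    also have "\<dots> = C * (1 + 1 / e) * real n powr (e + -\<sigma>)"
      by (simp only: powr_add mult.assoc)
    also have "e + -\<sigma> = - (1 + e)" by (simp add: e_def field_simps)
    finally show "norm (norm (a n) * real n powr (-\<sigma>)) \<le> C * (1 + 1 / e) * real n powr (- (1 + e))"
      by simp
  qed
qed

lemma abs_conv_right_bounded:
  assumes "\<And>n. norm (a n) \<le> C"
  shows "abs_conv_right a"
proof (rule abs_conv_right_ln)
  have C: "0 \<le> C" using order_trans[OF norm_ge_zero assms] .
  show "norm (a n) \<le> C * (1 + ln (real n))" for n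
    using assms[of n] C mult_left_mono[of 1 "1 + ln (real n)" C]
    by (cases "n = 0") auto
qed

lemma has_field_derivative_dseries:
  assumes "abs_conv_right a" "Re s > 1"
  shows "(dseries a has_field_derivative dseries (\<lambda>n. - (of_real (ln (real n)) * a n)) s) (at s)"
proof -
  \<comment> \<open>Any abscissa strictly between 1 and \<open>Re s\<close>: to its right all terms
    are dominated by those at \<open>c\<close>, which allows termwise differentiation.\<close>
  define c where "c = (1 + Re s) / 2"
  have c: "1 < c" "c < Re s" using assms(2) by (auto simp: c_def)
  define S where "S = {z. Re z > c}"
  have "s \<in> S" "open S" using c by (auto simp: S_def open_halfspace_Re_gt)
  obtain g g' where g: "\<forall>x \<in> S. ((\<lambda>n. a n * of_nat n powr (-x)) sums g x) \<and>
      ((\<lambda>n. - (of_real (ln (real n)) * a n) * of_nat n powr (-x)) sums g' x) \<and>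
      (g has_field_derivative g' x) (at x)"
  proof (rule series_and_derivative_comparison[OF \<open>open S\<close>])
    show "summable (\<lambda>n. norm (a n) * real n powr (-c))"
      using assms(1) c by (auto simp: abs_conv_right_def)
    show "((\<lambda>x. a n * of_nat n powr (-x)) has_field_derivative
        - (of_real (ln (real n)) * a n) * of_nat n powr (-x)) (at x)" if "x \<in> S" for n x
    proof (cases "n = 0")
      case False
      then have "((\<lambda>x. of_nat n powr (-x) :: complex) has_field_derivative
          Ln (of_nat n) * of_nat n powr (-x) * (-1)) (at x)"
        by (intro DERIV_chain2[OF has_field_derivative_powr_right]) (auto intro!: derivative_eq_intros)
      from DERIV_cmult[OF this, of "a n"] show ?thesis using False by (simp add: mult_ac)
    qed auto
    show "\<forall>\<^sub>F n in sequentially. \<forall>x\<in>S. norm (a n * of_nat n powr (-x)) \<le> norm (a n) * real n powr (-c)"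
      using eventually_ge_at_top[of 1]
      by eventually_elim
         (auto simp: S_def norm_mult norm_of_nat_powr intro!: mult_left_mono powr_mono)
  qed
  have "(g has_field_derivative g' s) (at s)" using g \<open>s \<in> S\<close> by blast
  then have "(dseries a has_field_derivative g' s) (at s)"
  proof (rule has_field_derivative_transform_within_open[OF _ \<open>open S\<close> \<open>s \<in> S\<close>])
    show "g x = dseries a x" if "x \<in> S" for x
      using g that by (auto simp: dseries_def sums_iff)
  qed
  moreover have "g' s = dseries (\<lambda>n. - (of_real (ln (real n)) * a n)) s"
    using g \<open>s \<in> S\<close> by (auto simp: dseries_def sums_iff)
  ultimately show ?thesis by simp
qed

section \<open>Dirichlet convolution\<close>

text \<open>The double sum is regrouped along the hyperbolas \<open>x * y = n\<close>. Starting at 1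
  keeps every set of divisors finite, as 0 is divisible by everything.\<close>

lemma infsum_divisors:
  fixes h :: "nat \<Rightarrow> nat \<Rightarrow> 'a :: banach"
  assumes "(\<lambda>(x, y). h x y) summable_on {1..} \<times> {1..}"
  shows "(\<Sum>\<^sub>\<infinity>x\<in>{1..}. \<Sum>\<^sub>\<infinity>y\<in>{1..}. h x y) = (\<Sum>\<^sub>\<infinity>n\<in>{1..}. \<Sum>d | d dvd n. h d (n div d))"
    and "(\<lambda>n. \<Sum>d | d dvd n. h d (n div d)) summable_on {1..}"
proof -
  let ?S = "Sigma {1::nat..} (\<lambda>n. {d. d dvd n})"
  have bij: "bij_betw (\<lambda>(n, d). (d, n div d)) ?S ({1..} \<times> {1..})"
    by (rule bij_betwI[where g = "\<lambda>(x, y). (x * y, x)"])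
       (auto elim!: dvdE simp: Suc_le_eq)
  have eq: "(\<lambda>p. case case p of (n, d) \<Rightarrow> (d, n div d) of (x, y) \<Rightarrow> h x y) = (\<lambda>(n, d). h d (n div d))"
    by auto
  have summ: "(\<lambda>(n, d). h d (n div d)) summable_on ?S"
    using assms summable_on_reindex_bij_betw[OF bij, of "\<lambda>(x, y). h x y"] by (simp add: eq)
  have fin: "(\<Sum>\<^sub>\<infinity>d\<in>{d. d dvd n}. h d (n div d)) = (\<Sum>d | d dvd n. h d (n div d))" if "n \<in> {1..}" for n
    using that by (intro infsum_finite finite_divisors_nat) auto
  have "(\<Sum>\<^sub>\<infinity>x\<in>{1..}. \<Sum>\<^sub>\<infinity>y\<in>{1..}. h x y) = (\<Sum>\<^sub>\<infinity>(x, y)\<in>{1..} \<times> {1..}. h x y)"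
    by (rule infsum_Sigma'_banach[OF assms])
  also have "\<dots> = (\<Sum>\<^sub>\<infinity>(n, d)\<in>?S. h d (n div d))"
    using infsum_reindex_bij_betw[OF bij, of "\<lambda>(x, y). h x y"] by (simp add: eq)
  also have "\<dots> = (\<Sum>\<^sub>\<infinity>n\<in>{1..}. \<Sum>\<^sub>\<infinity>d\<in>{d. d dvd n}. h d (n div d))"
    by (rule infsum_Sigma'_banach[OF summ, symmetric])
  also have "\<dots> = (\<Sum>\<^sub>\<infinity>n\<in>{1..}. \<Sum>d | d dvd n. h d (n div d))"
    by (rule infsum_cong[OF fin])
  finally show "(\<Sum>\<^sub>\<infinity>x\<in>{1..}. \<Sum>\<^sub>\<infinity>y\<in>{1..}. h x y) = (\<Sum>\<^sub>\<infinity>n\<in>{1..}. \<Sum>d | d dvd n. h d (n div d))" .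
  show "(\<lambda>n. \<Sum>d | d dvd n. h d (n div d)) summable_on {1..}"
    by (rule summable_on_cong[THEN iffD1, OF fin summable_on_Sigma_banach[OF summ]])
qed

lemma summable_on_times:
  fixes f :: "'a \<Rightarrow> 'c :: {real_normed_algebra, banach}" and g :: "'b \<Rightarrow> 'c"
  assumes "(\<lambda>x. norm (f x)) summable_on A" "(\<lambda>y. norm (g y)) summable_on B"
  shows "(\<lambda>(x, y). f x * g y) summable_on A \<times> B"
proof (rule abs_summable_summable, rule Infinite_Sum.abs_summable_on_comparison_test)
  show "(\<lambda>p. norm (case p of (x, y) \<Rightarrow> norm (f x) * norm (g y))) summable_on A \<times> B"
    using assms unfolding Infinite_Sum.abs_summable_on_Sigma_iff
    by (auto simp: summable_on_cmult_right abs_mult infsum_cmult_right' summable_on_cmult_left infsum_nonneg)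
  show "norm (case p of (x, y) \<Rightarrow> f x * g y) \<le> norm (case p of (x, y) \<Rightarrow> norm (f x) * norm (g y))" for p
    by (auto simp: norm_mult_ineq split: prod.splits)
qed

lemma dseries_infsum:
  assumes "abs_conv_right a" "Re s > 1"
  shows "dseries a s = (\<Sum>\<^sub>\<infinity>n\<in>{1..}. a n * of_nat n powr (-s))"
    and "(\<lambda>n. norm (a n * of_nat n powr (-s))) summable_on {1..}"
proof -
  let ?f = "\<lambda>n. a n * of_nat n powr (-s)"
  have "(?f has_sum dseries a s) UNIV"
    by (rule norm_summable_imp_has_sum[OF abs_conv_right_summable[OF assms] dseries_sums[OF assms]])
  moreover have "(?f has_sum dseries a s) UNIV \<longleftrightarrow> (?f has_sum dseries a s) {1..}"
    by (rule has_sum_cong_neutral) (auto simp: not_less_eq_eq)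
  ultimately show "dseries a s = (\<Sum>\<^sub>\<infinity>n\<in>{1..}. ?f n)" by (simp add: infsumI)
  show "(\<lambda>n. norm (?f n)) summable_on {1..}"
    by (rule summable_on_subset_banach[OF summable_nonneg_imp_summable_on])
       (use abs_conv_right_summable[OF assms] in auto)
qed

lemma dseries_mult:
  assumes "abs_conv_right a" "abs_conv_right b" "Re s > 1"
    and "abs_conv_right (\<lambda>n. \<Sum>d | d dvd n. a d * b (n div d))"
  shows "dseries a s * dseries b s = dseries (\<lambda>n. \<Sum>d | d dvd n. a d * b (n div d)) s"
proof -
  let ?f = "\<lambda>n. a n * of_nat n powr (-s)" and ?g = "\<lambda>n. b n * of_nat n powr (-s)"
  have "dseries a s * dseries b s = (\<Sum>\<^sub>\<infinity>x\<in>{1..}. \<Sum>\<^sub>\<infinity>y\<in>{1..}. ?f x * ?g y)"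
    by (simp add: dseries_infsum(1) assms infsum_cmult_left' infsum_cmult_right')
  also have "\<dots> = (\<Sum>\<^sub>\<infinity>n\<in>{1..}. \<Sum>d | d dvd n. ?f d * ?g (n div d))"
    by (intro infsum_divisors(1) summable_on_times dseries_infsum(2) assms)
  also have "\<dots> = (\<Sum>\<^sub>\<infinity>n\<in>{1..}. (\<Sum>d | d dvd n. a d * b (n div d)) * of_nat n powr (-s))"
  proof (intro infsum_cong)
    fix n :: nat
    have "?f d * ?g (n div d) = (a d * b (n div d)) * of_nat n powr (-s)" if "d dvd n" for d
    proof -
      have "of_nat d powr (-s) * of_nat (n div d) powr (-s) = (of_nat d * of_nat (n div d)) powr (-s :: complex)"
        by (rule powr_times_real[symmetric]) auto
      then show ?thesis using that by (simp flip: of_nat_mult add: mult_ac)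
    qed
    then show "(\<Sum>d | d dvd n. ?f d * ?g (n div d)) = (\<Sum>d | d dvd n. a d * b (n div d)) * of_nat n powr (-s)"
      unfolding sum_distrib_right by (intro sum.cong) auto
  qed
  also have "\<dots> = dseries (\<lambda>n. \<Sum>d | d dvd n. a d * b (n div d)) s"
    by (simp add: dseries_infsum(1) assms)
  finally show ?thesis .
qed

section \<open>Continuation to Re s > 0 by partial summation\<close>

text \<open>Mean value inequality on the real segment from \<open>a\<close> to \<open>x\<close>,
  which is convex and avoids the branch cut. The gain of one power of \<open>a\<close> is what makes
  the series after partial summation converge for \<open>Re s > 0\<close>.\<close>

lemma powr_minus_Lipschitz:
  fixes a x :: real and s :: complex
  assumes "0 < a" "a \<le> x" "x \<le> a + 1" "0 \<le> Re s"
  shows "norm (of_real x powr (-s) - of_real a powr (-s)) \<le> norm s * a powr (- Re s - 1)"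
proof -
  have "norm (of_real x powr (-s) - of_real a powr (-s)) \<le> norm s * a powr (- Re s - 1) * norm (complex_of_real x - of_real a)"
  proof (rule field_differentiable_bound[of "complex_of_real ` {a..x}" "\<lambda>z. z powr (-s)" "\<lambda>z. -s * z powr (-s - 1)"])
    show "convex (complex_of_real ` {a..x})"
      by (intro convex_linear_image linear_of_real) auto
    fix z assume "z \<in> complex_of_real ` {a..x}"
    then obtain t where t: "z = of_real t" "a \<le> t" by auto
    have "z \<notin> \<real>\<^sub>\<le>\<^sub>0" using t(2) assms(1) by (simp add: t(1) complex_nonpos_Reals_iff)
    then show "((\<lambda>z. z powr (-s)) has_field_derivative -s * z powr (-s - 1)) (at z within complex_of_real ` {a..x})"
      by (rule has_field_derivative_at_within[OF has_field_derivative_powr])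
    have "norm (z powr (-s - 1)) = t powr (- Re s - 1)"
      using t assms by (simp add: norm_powr_real_powr)
    also have "\<dots> \<le> a powr (- Re s - 1)"
      using t assms by (intro powr_mono2') auto
    finally show "norm (-s * z powr (-s - 1)) \<le> norm s * a powr (- Re s - 1)"
      by (simp add: norm_mult mult_left_mono)
  qed (use assms in auto)
  also have "\<dots> \<le> norm s * a powr (- Re s - 1) * 1"
    using assms by (intro mult_left_mono) (auto simp flip: of_real_diff)
  finally show ?thesis by simp
qed

lemma sum_dseries_by_parts:
  "(\<Sum>n\<le>N. a n * of_nat n powr (-s)) =
     (\<Sum>m\<le>N. a m) * of_nat (Suc N) powr (-s)
     + (\<Sum>n\<le>N. (\<Sum>m\<le>n. a m) * (of_nat n powr (-s) - of_nat (Suc n) powr (-s :: complex)))"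
  by (induction N) (auto simp: algebra_simps)

text \<open>On the disc of radius \<open>Re x / 2\<close> around \<open>x\<close> the abscissa stays
  at least \<open>Re x / 2\<close> and the factor in \<open>norm s\<close> is bounded. The square
  covers both uses, series after partial summation and the series of
  \<open>zeta_term\<close>.\<close>

lemma holomorphic_series_right:
  fixes f :: "nat \<Rightarrow> complex \<Rightarrow> complex"
  assumes hol: "\<And>n. f n holomorphic_on UNIV"
    and bound: "\<And>n s. n \<ge> 1 \<Longrightarrow> Re s > 0 \<Longrightarrow> norm (f n s) \<le> C * (norm s + 1) ^ 2 * real n powr (- Re s - 1)"
    and "C \<ge> 0"
  shows "(\<lambda>s. \<Sum>n. f n s) holomorphic_on {s. Re s > 0}"
    and "Re s > 0 \<Longrightarrow> summable (\<lambda>n. f n s)"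
proof -
  have "\<exists>g g'. \<forall>x \<in> {s. Re s > 0}. ((\<lambda>n. f n x) sums g x) \<and> ((\<lambda>n. deriv (f n) x) sums g' x) \<and>
      (g has_field_derivative g' x) (at x)"
  proof (rule series_and_derivative_comparison_local)
    show "open {s. Re s > 0}" by (rule open_halfspace_Re_gt)
    show "(f n has_field_derivative deriv (f n) x) (at x)" for n x
      by (rule holomorphic_derivI[OF hol]) auto
    fix x :: complex assume x: "x \<in> {s. Re s > 0}"
    define c where "c = Re x / 2"
    have c: "c > 0" using x by (simp add: c_def)
    show "\<exists>d h. 0 < d \<and> summable h \<and>
        (\<forall>\<^sub>F n in sequentially. \<forall>y\<in>ball x d \<inter> {s. Re s > 0}. norm (f n y) \<le> h n)"
    proof (intro exI conjI)
      show "0 < c" by fact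
      show "summable (\<lambda>n. C * (norm x + c + 1) ^ 2 * real n powr (- c - 1))"
        using c by (intro summable_mult) (simp add: summable_real_powr_iff)
      show "\<forall>\<^sub>F n in sequentially. \<forall>y\<in>ball x c \<inter> {s. Re s > 0}.
          norm (f n y) \<le> C * (norm x + c + 1) ^ 2 * real n powr (- c - 1)"
        using eventually_ge_at_top[of 1]
      proof eventually_elim
        case (elim n)
        show ?case
        proof
          fix y assume y: "y \<in> ball x c \<inter> {s. Re s > 0}"
          have "norm (y - x) < c" using y by (simp add: dist_norm norm_minus_commute)
          then have ny: "norm y \<le> norm x + c" and "\<bar>Re y - Re x\<bar> < c"
            using norm_triangle_ineq2[of y x] abs_Re_le_cmod[of "y - x"] by auto
          then have "c \<le> Re y" unfolding c_def by linarith
          have "norm (f n y) \<le> C * (norm y + 1) ^ 2 * real n powr (- Re y - 1)"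
            using bound[OF elim] y by auto
          also have "\<dots> \<le> C * (norm x + c + 1) ^ 2 * real n powr (- c - 1)"
            using ny \<open>c \<le> Re y\<close> elim \<open>C \<ge> 0\<close>
            by (intro mult_mono mult_left_mono power_mono powr_mono) auto
          finally show "norm (f n y) \<le> C * (norm x + c + 1) ^ 2 * real n powr (- c - 1)" .
        qed
      qed
    qed
  qed
  then obtain g g' where g: "\<And>x. Re x > 0 \<Longrightarrow> (\<lambda>n. f n x) sums g x"
    "\<And>x. Re x > 0 \<Longrightarrow> (g has_field_derivative g' x) (at x)" by auto
  show "summable (\<lambda>n. f n s)" if "Re s > 0" using g(1)[OF that] by (auto simp: sums_iff)
  have "g holomorphic_on {s. Re s > 0}"
    by (rule holomorphic_onI) (use g(2) in \<open>auto simp: field_differentiable_def intro: has_field_derivative_at_within\<close>)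
  then show "(\<lambda>s. \<Sum>n. f n s) holomorphic_on {s. Re s > 0}"
    by (rule holomorphic_transform) (use g(1) in \<open>auto simp: sums_iff\<close>)
qed

lemma of_nat_powr_tendsto_0:
  assumes "Re s < 0"
  shows "(\<lambda>n. of_nat n powr s :: complex) \<longlonglongrightarrow> 0"
  by (rule tendsto_norm_zero_cancel)
     (use assms in \<open>auto simp: norm_of_nat_powr intro!: tendsto_neg_powr filterlim_real_sequentially\<close>)

text \<open>After summation by parts the boundary term is at most \<open>C\<close> times a null
  sequence, and the remaining terms decay like \<open>n powr (- Re s - 1)\<close>.\<close>

lemma dseries_bounded_partial_sums:
  assumes B: "\<And>N. norm (\<Sum>m\<le>N. a m) \<le> C"
  shows "dseries a holomorphic_on {s. Re s > 0}"
    and "Re s > 0 \<Longrightarrow> (\<lambda>n. a n * of_nat n powr (-s)) sums dseries a s"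
proof -
  define S where "S n = (\<Sum>m\<le>n. a m)" for n
  define f where "f n s = S n * (of_nat n powr (-s) - of_nat (Suc n) powr (-s))" for n s
  have C: "0 \<le> C" using order_trans[OF norm_ge_zero B] .
  have hol: "f n holomorphic_on UNIV" for n
    unfolding f_def by (intro holomorphic_intros)
  have bound: "norm (f n s) \<le> C * (norm s + 1) ^ 2 * real n powr (- Re s - 1)" if "n \<ge> 1" "Re s > 0" for n s
  proof -
    have "norm (of_nat n powr (-s) - of_nat (Suc n) powr (-s)) \<le> norm s * real n powr (- Re s - 1)"
      using powr_minus_Lipschitz[of "real n" "real (Suc n)" s] that by (simp add: norm_minus_commute)
    also have "\<dots> \<le> (norm s + 1) ^ 2 * real n powr (- Re s - 1)"
      by (intro mult_right_mono) (auto simp: power2_eq_square algebra_simps)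
    finally show ?thesis
      using B[of n] C unfolding f_def S_def norm_mult mult.assoc by (intro mult_mono) auto
  qed
  note series = holomorphic_series_right[of f, OF hol bound C]
  have sums: "(\<lambda>n. a n * of_nat n powr (-s)) sums (\<Sum>n. f n s)" if s: "Re s > 0" for s
    unfolding sums_def_le sum_dseries_by_parts S_def[symmetric] f_def[symmetric]
  proof (rule tendsto_eq_intros)
    show "(\<lambda>N. S N * of_nat (Suc N) powr (-s)) \<longlonglongrightarrow> 0"
    proof (rule Lim_null_comparison)
      show "\<forall>\<^sub>F N in sequentially. norm (S N * of_nat (Suc N) powr (-s)) \<le> C * norm (of_nat (Suc N) powr (-s) :: complex)"
        unfolding norm_mult S_def by (intro always_eventually allI mult_right_mono B norm_ge_zero)
      show "(\<lambda>N. C * norm (of_nat (Suc N) powr (-s) :: complex)) \<longlonglongrightarrow> 0"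
        using LIMSEQ_Suc[OF of_nat_powr_tendsto_0[of "-s"]] s
        by (intro tendsto_mult_right_zero tendsto_norm_zero) auto
    qed
    show "(\<lambda>N. \<Sum>n\<le>N. f n s) \<longlonglongrightarrow> (\<Sum>n. f n s)"
      using summable_sums[OF series(2)[OF _ _ s]] by (simp add: sums_def_le)
  qed auto
  show "(\<lambda>n. a n * of_nat n powr (-s)) sums dseries a s" if "Re s > 0"
    using sums[OF that] by (simp add: dseries_def sums_iff)
  have "dseries a s = (\<Sum>n. f n s)" if "Re s > 0" for s
    using sums[OF that] by (simp add: dseries_def sums_iff)
  then show "dseries a holomorphic_on {s. Re s > 0}"
    using holomorphic_transform[OF series(1), of "dseries a"] by auto
qed

section \<open>The zeta function with its pole at 1 removed\<close>

text \<open>The junk value \<open>0 powr s = 0\<close> makes the term \<open>n = 0\<close> equal to \<open>1\<close>.\<close>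

definition zeta_term :: "nat \<Rightarrow> complex \<Rightarrow> complex" where
  "zeta_term n s = (s - 1) * of_nat n powr (-s) + (of_nat (Suc n) powr (1 - s) - of_nat n powr (1 - s))"

text \<open>This is \<open>(s - 1) * zeta(s)\<close>: for \<open>n >= 1\<close>,
  \<open>zeta_term n s\<close> is \<open>s - 1\<close> times the difference between
  \<open>n powr (-s)\<close> and the integral of \<open>x powr (-s)\<close> over
  \<open>{n..n + 1}\<close>.\<close>

definition reg_zeta :: "complex \<Rightarrow> complex" where
  "reg_zeta s = (\<Sum>n. zeta_term n s)"

lemma reg_zeta_1: "reg_zeta 1 = 1"
proof -
  have "zeta_term n 1 = (if n = 0 then 1 else 0)" for n
    using of_nat_eq_0_iff[of "Suc n", where 'a = complex] by (auto simp: zeta_term_def simp del: of_nat_Suc)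
  then show ?thesis using sums_unique[OF sums_single[of 0 "\<lambda>_. 1::complex"]] by (simp add: reg_zeta_def)
qed

lemma reg_zeta_holomorphic: "reg_zeta holomorphic_on {s. Re s > 0}"
  unfolding reg_zeta_def
proof (rule holomorphic_series_right(1)[where C = 1])
  show "zeta_term n holomorphic_on UNIV" for n
    unfolding zeta_term_def by (intro holomorphic_intros)
  fix n :: nat and s :: complex assume n: "n \<ge> 1" and s: "Re s > 0"
  \<comment> \<open>The linear part is subtracted so that the derivative of \<open>h\<close> is a
    difference of powers, to which the Lipschitz bound applies; this yields the extra factor
    \<open>n powr (-1)\<close>.\<close>
  define h where "h z = z powr (1 - s) - (1 - s) * of_nat n powr (-s) * z" for z
  have eq: "zeta_term n s = h (of_real (real (Suc n))) - h (of_real (real n))"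
    by (simp add: h_def zeta_term_def algebra_simps)
  have "norm (h (of_real (real (Suc n))) - h (of_real (real n)))
      \<le> (norm (1 - s) * (norm s * real n powr (- Re s - 1))) * norm (complex_of_real (real (Suc n)) - of_real (real n))"
  proof (rule field_differentiable_bound[of "complex_of_real ` {real n..real (Suc n)}" h
        "\<lambda>z. (1 - s) * (z powr (-s) - of_nat n powr (-s))"])
    show "convex (complex_of_real ` {real n..real (Suc n)})"
      by (intro convex_linear_image linear_of_real) auto
    fix z assume "z \<in> complex_of_real ` {real n..real (Suc n)}"
    then obtain t where t: "z = of_real t" "real n \<le> t" "t \<le> real n + 1" by auto
    have "z \<notin> \<real>\<^sub>\<le>\<^sub>0" using t n by (auto simp: complex_nonpos_Reals_iff)
    then have "(h has_field_derivative (1 - s) * z powr (1 - s - 1) - (1 - s) * of_nat n powr (-s)) (at z)"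
      unfolding h_def by (auto intro!: derivative_eq_intros has_field_derivative_powr)
    then show "(h has_field_derivative (1 - s) * (z powr (-s) - of_nat n powr (-s)))
        (at z within complex_of_real ` {real n..real (Suc n)})"
      by (simp add: algebra_simps has_field_derivative_at_within)
    show "norm ((1 - s) * (z powr (-s) - of_nat n powr (-s))) \<le> norm (1 - s) * (norm s * real n powr (- Re s - 1))"
      unfolding norm_mult
      using powr_minus_Lipschitz[of "real n" t s] t n s by (intro mult_left_mono) auto
  qed (rule imageI, simp, rule imageI, simp)
  also have "\<dots> = norm (1 - s) * norm s * real n powr (- Re s - 1)"
    by (simp flip: of_real_diff)
  also have "\<dots> \<le> (norm s + 1) * (norm s + 1) * real n powr (- Re s - 1)"
    using norm_triangle_ineq4[of 1 s] by (intro mult_right_mono mult_mono) auto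
  finally show "norm (zeta_term n s) \<le> 1 * (norm s + 1) ^ 2 * real n powr (- Re s - 1)"
    by (simp add: eq power2_eq_square)
qed auto

lemma reg_zeta_eq:
  assumes "Re s > 1"
  shows "reg_zeta s = (s - 1) * dseries (\<lambda>_. 1) s"
proof -
  show ?thesis
    unfolding reg_zeta_def
  proof (rule sums_unique[symmetric])
    \<comment> \<open>The second part telescopes from \<open>0 powr (1 - s) = 0\<close> to the limit
      0 and contributes nothing.\<close>
    have "(\<lambda>n. (s - 1) * (1 * of_nat n powr (-s)) + (of_nat (Suc n) powr (1 - s) - of_nat n powr (1 - s)))
        sums ((s - 1) * dseries (\<lambda>_. 1) s + (0 - of_nat 0 powr (1 - s)))"
      using assms
      by (intro sums_add sums_mult telescope_sums of_nat_powr_tendsto_0 dseries_sums abs_conv_right_bounded[of _ 1]) auto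
    then show "(\<lambda>n. zeta_term n s) sums ((s - 1) * dseries (\<lambda>_. 1) s)"
      by (simp add: zeta_term_def)
  qed
qed

subsection \<open>Nonvanishing at 1 for quadratic characters\<close>

locale real_character =
  fixes \<psi> :: "nat \<Rightarrow> real"
  assumes mult: "\<And>m n. \<psi> (m * n) = \<psi> m * \<psi> n"
    and one: "\<psi> (Suc 0) = 1" and zero: "\<psi> 0 = 0"
    and vals: "\<And>n. \<psi> n \<in> {0, 1, -1}"
begin

lemma power: "\<psi> (p ^ i) = \<psi> p ^ i"
  by (induction i) (auto simp: one mult)

text \<open>Coefficients of the product of the zeta function and the \<open>L\<close>-series of
  \<open>\<psi>\<close>. At \<open>n = 0\<close> the sum runs over an infinite set and is 0.\<close>

definition r :: "nat \<Rightarrow> real" where "r n = (\<Sum>e | e dvd n. \<psi> e)"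

text \<open>Divisors of \<open>p ^ a * M\<close> factor uniquely as \<open>p ^ i * e\<close>. This
  is multiplicativity in the form needed for an induction that splits off one prime power at a
  time.\<close>

lemma r_prime_power_mult:
  assumes p: "prime p" and M: "\<not> p dvd M" and "M > 0"
  shows "r (p ^ a * M) = (\<Sum>i\<le>a. \<psi> p ^ i) * r M"
proof -
  have not_dvd: "\<not> p dvd e" if "e dvd M" for e
    using M that dvd_trans by blast
  have "bij_betw (\<lambda>(i, e). p ^ i * e) ({..a} \<times> {e. e dvd M}) {e. e dvd p ^ a * M}"
    unfolding bij_betw_def
  proof
    show "inj_on (\<lambda>(i, e). p ^ i * e) ({..a} \<times> {e. e dvd M})"
    proof (rule inj_onI, clarsimp)
      fix i e i' e' assume *: "p ^ i * e = p ^ i' * e'" "e dvd M" "e' dvd M"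
      then have "i = i'"
        using prime_power_cancel2[of p e i e' i'] p not_dvd by (simp add: mult.commute)
      then show "i = i' \<and> e = e'" using * p by (simp add: prime_gt_0_nat)
    qed
    show "(\<lambda>(i, e). p ^ i * e) ` ({..a} \<times> {e. e dvd M}) = {e. e dvd p ^ a * M}"
    proof (intro equalityI subsetI)
      fix x assume "x \<in> {e. e dvd p ^ a * M}"
      then obtain u v where "x = u * v" "u dvd p ^ a" "v dvd M"
        by (auto elim: dvd_productE)
      moreover obtain i where "i \<le> a" "u = p ^ i"
        using divides_primepow_nat[OF p] \<open>u dvd p ^ a\<close> by auto
      ultimately show "x \<in> (\<lambda>(i, e). p ^ i * e) ` ({..a} \<times> {e. e dvd M})" by auto
    qed (auto intro!: mult_dvd_mono le_imp_power_dvd)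
  qed
  from sum.reindex_bij_betw[OF this, of \<psi>]
  have "r (p ^ a * M) = (\<Sum>(i, e)\<in>{..a} \<times> {e. e dvd M}. \<psi> p ^ i * \<psi> e)"
    by (simp add: r_def case_prod_unfold mult power)
  also have "\<dots> = (\<Sum>i\<le>a. \<Sum>e | e dvd M. \<psi> p ^ i * \<psi> e)"
    by (rule sum.cartesian_product[symmetric])
  also have "\<dots> = (\<Sum>i\<le>a. \<psi> p ^ i) * r M"
    by (simp add: r_def sum_product)
  finally show ?thesis .
qed

lemma r_1: "r (Suc 0) = 1" by (simp add: r_def one)

lemma geometric_nonneg: "0 \<le> (\<Sum>i\<le>a. \<psi> p ^ i)"
proof -
  have "(\<Sum>i\<le>a. (-1::real) ^ i) = (if even a then 1 else 0)" by (induction a) auto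
  moreover have "(\<Sum>i\<le>a. (0::real) ^ i) = 1" by (induction a) auto
  ultimately show ?thesis using vals[of p] by (auto simp: sum_nonneg)
qed

text \<open>The number of terms is odd, so alternating signs leave 1 over.\<close>

lemma geometric_even_ge_1: "1 \<le> (\<Sum>i\<le>2 * a. \<psi> p ^ i)"
proof -
  have "(\<Sum>i\<le>2 * a. (-1::real) ^ i) = 1" by (induction a) auto
  moreover have "(\<Sum>i\<le>2 * a. (0::real) ^ i) = 1" by (induction a) auto
  ultimately show ?thesis using vals[of p] by auto
qed

lemma prime_power_splitE:
  assumes "n > (1::nat)"
  obtains p a M where "prime p" "n = p ^ a * M" "\<not> p dvd M" "M > 0" "M < n"
proof -
  obtain p where p: "prime p" "p dvd n" using prime_factor_nat[of n] assms by auto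
  obtain M where M: "n = p ^ multiplicity p n * M" "\<not> p dvd M"
    using multiplicity_decompose'[of n p] p assms by (metis not_less0 not_prime_unit gr0I less_irrefl)
  have "multiplicity p n > 0" using p assms by (simp add: prime_multiplicity_gt_zero_iff)
  then have "p ^ multiplicity p n > 1" using prime_gt_1_nat[OF p(1)] by (intro one_less_power)
  moreover have "M > 0" using M assms by (cases "M = 0") auto
  ultimately have "1 * M < p ^ multiplicity p n * M" by (intro mult_strict_right_mono) auto
  then have "M < n" using M(1) by simp
  with that p M \<open>M > 0\<close> show ?thesis by blast
qed

lemma r_nonneg: "0 \<le> r n"
proof (induction n rule: less_induct)
  case (less n)
  consider "n = 0" | "n = 1" | "n > 1" by linarith
  then show ?case
  proof cases
    case 3
    then obtain p a M where *: "prime p" "n = p ^ a * M" "\<not> p dvd M" "M > 0" "M < n"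
      by (rule prime_power_splitE)
    show ?thesis unfolding *(2) r_prime_power_mult[OF *(1,3,4)]
      using less.IH[OF *(5)] geometric_nonneg by simp
  qed (auto simp: r_def one)
qed

text \<open>A square has even exponents at all primes, so each local factor is at least 1. These
  values force the divergence as \<open>y\<close> tends to 1.\<close>

lemma r_square_ge_1: "n > 0 \<Longrightarrow> 1 \<le> r (n\<^sup>2)"
proof (induction n rule: less_induct)
  case (less n)
  show ?case
  proof (cases "n > 1")
    case True
    then obtain p a M where *: "prime p" "n = p ^ a * M" "\<not> p dvd M" "M > 0" "M < n"
      by (rule prime_power_splitE)
    have n2: "n\<^sup>2 = p ^ (2 * a) * M\<^sup>2" using *(2) by (simp add: power_mult_distrib mult.commute flip: power_mult)
    have "\<not> p dvd M\<^sup>2" using *(1,3) prime_dvd_power by blast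
    moreover have "1 * 1 \<le> (\<Sum>i\<le>2 * a. \<psi> p ^ i) * r (M\<^sup>2)"
      using less.IH[OF *(5,4)] geometric_even_ge_1[of p a] by (intro mult_mono) auto
    ultimately show ?thesis unfolding n2 using r_prime_power_mult[OF *(1), of "M\<^sup>2" "2 * a"] *(4) by simp
  qed (use less.prems r_1 in \<open>auto simp: not_less le_Suc_eq\<close>)
qed

end

section \<open>Monsky's weights and Abel's inequality\<close>

text \<open>AM-GM on the terms \<open>i\<close> and \<open>n - 1 - i\<close>; the square root \<open>y\<close> of the ratio avoids half-integer exponents.\<close>

lemma geometric_sum_ge_midterm:
  fixes y :: real assumes "0 \<le> y"
  shows "real n * y ^ (n - 1) \<le> (\<Sum>i<n. (y\<^sup>2) ^ i)"
proof -
  have "2 * (\<Sum>i<n. (y\<^sup>2) ^ i) = (\<Sum>i<n. (y\<^sup>2) ^ i) + (\<Sum>i<n. (y\<^sup>2) ^ (n - Suc i))"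
    by (simp add: sum.nat_diff_reindex)
  also have "\<dots> = (\<Sum>i<n. (y\<^sup>2) ^ i + (y\<^sup>2) ^ (n - Suc i))" by (simp add: sum.distrib)
  also have "\<dots> \<ge> (\<Sum>i<n. 2 * y ^ (n - 1))"
  proof (rule sum_mono)
    fix i assume "i \<in> {..<n}"
    then have "y ^ (n - 1) = y ^ i * y ^ (n - Suc i)" by (simp flip: power_add)
    moreover have "0 \<le> (y ^ i - y ^ (n - Suc i))\<^sup>2" by simp
    ultimately show "2 * y ^ (n - 1) \<le> (y\<^sup>2) ^ i + (y\<^sup>2) ^ (n - Suc i)"
      by (simp add: power2_diff power_mult[symmetric] mult_ac)
  qed
  finally show ?thesis by simp
qed

text \<open>Up to the factor \<open>1 - y\<^sup>2\<close>, the weights of Monsky's proof that \<open>L(1, \<psi>) \<noteq> 0\<close>.\<close>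

definition monsky_weight :: "real \<Rightarrow> nat \<Rightarrow> real" where
  "monsky_weight y n = 1 / real n - (y\<^sup>2) ^ n / (\<Sum>i<n. (y\<^sup>2) ^ i)"

lemma geometric_sum_pos: "0 \<le> y \<Longrightarrow> n > 0 \<Longrightarrow> 0 < (\<Sum>i<n. (y\<^sup>2::real) ^ i)"
proof -
  assume "n > 0"
  have "(\<Sum>i<n. (y\<^sup>2) ^ i) \<ge> (\<Sum>i\<in>{0}. (y\<^sup>2) ^ i)"
    using \<open>n > 0\<close> by (intro sum_mono2) auto
  then show ?thesis by simp
qed

lemma monsky_weight_nonneg:
  assumes "0 \<le> y" "y < 1" "n > 0"
  shows "0 \<le> monsky_weight y n"
proof -
  have "(\<Sum>i<n. (y\<^sup>2) ^ n) \<le> (\<Sum>i<n. (y\<^sup>2) ^ i)"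
    using assms by (intro sum_mono power_decreasing) (auto simp: power_le_one)
  then have "real n * (y\<^sup>2) ^ n \<le> (\<Sum>i<n. (y\<^sup>2) ^ i)" by simp
  then show ?thesis unfolding monsky_weight_def
    using geometric_sum_pos[OF assms(1,3)] assms(3) by (simp add: field_simps)
qed

text \<open>Consecutive quotients differ by \<open>(y^2)^n / (S n * S (Suc n))\<close>, and the
  midterm bound for both sums gives \<open>S n * S (Suc n) >= n (n + 1) y^(2 n - 1)\<close>, which
  is more than enough.\<close>

lemma monsky_weight_decreasing:
  assumes "0 \<le> y" "y < 1" "n > 0"
  shows "monsky_weight y (Suc n) \<le> monsky_weight y n"
proof -
  define S where "S n = (\<Sum>i<n. (y\<^sup>2) ^ i)" for n
  have pos: "S n > 0" "S (Suc n) > 0" using geometric_sum_pos[OF assms(1)] assms(3) by (auto simp: S_def simp del: sum.lessThan_Suc)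
  have S_Suc: "S (Suc n) = 1 + y\<^sup>2 * S n"
    unfolding S_def by (subst sum.lessThan_Suc_shift) (simp add: sum_distrib_left)
  have "real n * real (Suc n) * (y\<^sup>2) ^ n \<le> real n * real (Suc n) * (y ^ (n - 1) * y ^ n)"
  proof -
    have "(y\<^sup>2) ^ n = y ^ (n + n)" by (simp flip: power_mult add: mult_2)
    also have "\<dots> \<le> y ^ (n - 1 + n)" using assms by (intro power_decreasing) auto
    finally show ?thesis by (intro mult_left_mono) (auto simp: power_add)
  qed
  also have "\<dots> = (real n * y ^ (n - 1)) * (real (Suc n) * y ^ (Suc n - 1))" by simp
  also have "\<dots> \<le> S n * S (Suc n)"
    unfolding S_def using assms pos
    by (intro mult_mono geometric_sum_ge_midterm) (auto simp: sum_nonneg)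
  finally have key: "real n * real (Suc n) * (y\<^sup>2) ^ n \<le> S n * S (Suc n)" .
  have "(y\<^sup>2) ^ n / S n - (y\<^sup>2) ^ Suc n / S (Suc n) = (y\<^sup>2) ^ n * (S (Suc n) - y\<^sup>2 * S n) / (S n * S (Suc n))"
    using pos by (simp add: field_simps)
  also have "\<dots> = (y\<^sup>2) ^ n / (S n * S (Suc n))" by (simp add: S_Suc)
  also have "\<dots> \<le> 1 / (real n * real (Suc n))"
  proof -
    have "q / T \<le> 1 / P" if "P * q \<le> T" "0 < T" "0 < P" for q T P :: real
      using that by (simp add: field_simps)
    from this[OF key] show ?thesis using pos assms(3) by simp
  qed
  also have "\<dots> = 1 / real n - 1 / real (Suc n)" using assms(3) by (simp add: field_simps)
  finally show ?thesis unfolding monsky_weight_def S_def by linarith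
qed

text \<open>Abel's inequality: after partial summation the differences
  \<open>b n - b (Suc n)\<close> are nonnegative and telescope to the first weight.\<close>

lemma abs_sum_decreasing_weights_le:
  fixes a b :: "nat \<Rightarrow> real"
  assumes A: "\<And>N. \<bar>\<Sum>n<N. a n\<bar> \<le> C" and b: "\<And>n. 0 \<le> b n" "\<And>n. b (Suc n) \<le> b n"
  shows "\<bar>\<Sum>n<N. a n * b n\<bar> \<le> C * b 0"
proof -
  define S where "S n = (\<Sum>i<n. a i)" for n
  have parts: "(\<Sum>n<N. a n * b n) = S N * b N + (\<Sum>n<N. S (Suc n) * (b n - b (Suc n)))"
    by (induction N) (auto simp: S_def algebra_simps)
  have "0 \<le> C" using A[of 0] by simp
  then have "\<bar>\<Sum>n<N. S (Suc n) * (b n - b (Suc n))\<bar> \<le> (\<Sum>n<N. C * (b n - b (Suc n)))"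
    using A b by (intro order_trans[OF sum_abs] sum_mono) (auto simp: abs_mult S_def simp del: sum.lessThan_Suc intro!: mult_mono)
  also have "\<dots> = C * (b 0 - b N)"
    by (induction N) (auto simp: algebra_simps)
  finally have "\<bar>\<Sum>n<N. S (Suc n) * (b n - b (Suc n))\<bar> \<le> C * (b 0 - b N)" .
  moreover have "\<bar>S N * b N\<bar> \<le> C * b N"
    using A[of N] b(1)[of N] by (auto simp: abs_mult S_def intro!: mult_right_mono)
  ultimately show ?thesis unfolding parts by (simp add: algebra_simps)
qed

section \<open>Lambert series and the value at 1\<close>

context real_character
begin

text \<open>Put \<open>x = y^2\<close>. If \<open>L(1, \<psi>) = 0\<close>, subtracting
  \<open>1 / (1 - x)\<close> times the vanishing series turns the Lambert series into minus the sum
  with the decreasing weights, divided by \<open>1 - x\<close>. The first weight equals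
  \<open>1 - x\<close>, so Abel's inequality gives a bound uniform in \<open>y\<close>.\<close>

lemma abs_Lambert_series_le:
  assumes C: "\<And>N. \<bar>\<Sum>n<N. \<psi> (Suc n)\<bar> \<le> C" and L: "(\<lambda>n. \<psi> (Suc n) / real (Suc n)) sums 0"
    and y: "0 < y" "y < 1"
  shows "\<bar>\<Sum>n. \<psi> (Suc n) * ((y\<^sup>2) ^ Suc n / (1 - (y\<^sup>2) ^ Suc n))\<bar> \<le> C"
proof -
  define x where "x = y\<^sup>2"
  have x: "0 < x" "x < 1" using y by (auto simp: x_def power_less_one_iff)
  have w: "\<psi> (Suc n) * (x ^ Suc n / (1 - x ^ Suc n))
      = (\<psi> (Suc n) / real (Suc n)) / (1 - x) - \<psi> (Suc n) * monsky_weight y (Suc n) / (1 - x)" for n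
  proof -
    have rearrange: "c * (q / (1 - q)) = c / m / (1 - x) - c * (1 / m - q / ((1 - q) / (1 - x))) / (1 - x)"
      if "q < 1" "m > 0" for c q m :: real
    proof -
      have "c * (q / ((1 - q) / (1 - x))) / (1 - x) = c * (q / (1 - q))" using that x by simp
      moreover have "c * (1 / m - Q) / (1 - x) = c / m / (1 - x) - c * Q / (1 - x)" for Q
        by (simp add: right_diff_distrib diff_divide_distrib)
      ultimately show ?thesis by (simp only: diff_diff_eq2 add_diff_cancel_left')
    qed
    have "x ^ Suc n < 1" using x by (intro power_Suc_less_one) auto
    moreover have "(\<Sum>i<Suc n. x ^ i) = (1 - x ^ Suc n) / (1 - x)"
      using x by (subst sum_gp_strict) auto
    ultimately show ?thesis
      unfolding monsky_weight_def x_def[symmetric] by (simp only: rearrange of_nat_0_less_iff zero_less_Suc)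
  qed
  have partial: "\<bar>\<Sum>n<N. \<psi> (Suc n) * monsky_weight y (Suc n)\<bar> \<le> C * monsky_weight y (Suc 0)" for N
    using y by (intro abs_sum_decreasing_weights_le C monsky_weight_nonneg monsky_weight_decreasing) auto
  have le: "\<bar>\<psi> (Suc n) * (x ^ Suc n / (1 - x ^ Suc n))\<bar> \<le> x ^ Suc n / (1 - x)" for n
  proof -
    have "x ^ Suc n \<le> x" using x by (simp add: mult_left_le power_le_one)
    then have "x ^ Suc n / (1 - x ^ Suc n) \<le> x ^ Suc n / (1 - x)"
      using x \<open>x ^ Suc n \<le> x\<close> by (intro divide_left_mono mult_pos_pos) (auto simp del: power_Suc)
    moreover have nonneg: "0 \<le> x ^ Suc n / (1 - x ^ Suc n)"
      using x \<open>x ^ Suc n \<le> x\<close> by (intro divide_nonneg_nonneg) (auto simp del: power_Suc)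
    moreover have "\<bar>\<psi> (Suc n)\<bar> \<le> 1" using vals[of "Suc n"] by auto
    ultimately have "\<bar>\<psi> (Suc n)\<bar> * (x ^ Suc n / (1 - x ^ Suc n)) \<le> 1 * (x ^ Suc n / (1 - x))"
      by (intro mult_mono) (auto intro: order_trans simp del: power_Suc)
    then show ?thesis using nonneg by (simp only: abs_mult abs_of_nonneg mult_1)
  qed
  have "summable (\<lambda>n. x ^ Suc n / (1 - x))"
    using x by (intro summable_divide) (simp add: summable_mult summable_geometric)
  then have "summable (\<lambda>n. \<psi> (Suc n) * (x ^ Suc n / (1 - x ^ Suc n)))"
    by (rule summable_comparison_test'[where N = 0]) (use le in simp)
  then have "(\<lambda>N. \<Sum>n<N. \<psi> (Suc n) * (x ^ Suc n / (1 - x ^ Suc n))) \<longlonglongrightarrow>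
      (\<Sum>n. \<psi> (Suc n) * (x ^ Suc n / (1 - x ^ Suc n)))"
    using summable_LIMSEQ by blast
  moreover have "(\<lambda>N. (\<Sum>n<N. \<psi> (Suc n) / real (Suc n)) / (1 - x)) \<longlonglongrightarrow> 0 / (1 - x)"
    using L x unfolding sums_def by (intro tendsto_divide tendsto_const) auto
  ultimately have "(\<lambda>N. (\<Sum>n<N. \<psi> (Suc n) / real (Suc n)) / (1 - x) -
        (\<Sum>n<N. \<psi> (Suc n) * (x ^ Suc n / (1 - x ^ Suc n)))) \<longlonglongrightarrow>
      0 / (1 - x) - (\<Sum>n. \<psi> (Suc n) * (x ^ Suc n / (1 - x ^ Suc n)))"
    by (intro tendsto_diff)
  moreover have "(\<Sum>n<N. \<psi> (Suc n) / real (Suc n)) / (1 - x) - (\<Sum>n<N. \<psi> (Suc n) * (x ^ Suc n / (1 - x ^ Suc n)))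
      = (\<Sum>n<N. \<psi> (Suc n) * monsky_weight y (Suc n)) / (1 - x)" for N
    unfolding w by (simp add: sum_subtractf sum_divide_distrib)
  ultimately have "(\<lambda>N. (\<Sum>n<N. \<psi> (Suc n) * monsky_weight y (Suc n)) / (1 - x)) \<longlonglongrightarrow>
      - (\<Sum>n. \<psi> (Suc n) * (x ^ Suc n / (1 - x ^ Suc n)))"
    by simp
  then have "(\<lambda>N. \<bar>(\<Sum>n<N. \<psi> (Suc n) * monsky_weight y (Suc n)) / (1 - x)\<bar>) \<longlonglongrightarrow>
      \<bar>\<Sum>n. \<psi> (Suc n) * (x ^ Suc n / (1 - x ^ Suc n))\<bar>"
    using tendsto_rabs by fastforce
  moreover have "\<bar>(\<Sum>n<N. \<psi> (Suc n) * monsky_weight y (Suc n)) / (1 - x)\<bar> \<le> C" for N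
    using partial[of N] x by (simp add: monsky_weight_def x_def[symmetric] field_simps)
  ultimately show ?thesis
    unfolding x_def[symmetric] by (intro LIMSEQ_le_const2) auto
qed

lemma range_Suc: "range Suc = {1..}"
  by (auto simp: image_iff Suc_le_eq gr0_conv_Suc)

text \<open>Expanding \<open>x^n / (1 - x^n)\<close> geometrically and collecting equal products
  \<open>n * m\<close> produces the divisor sum \<open>r\<close>. With \<open>x = y^2\<close> the
  double series is dominated by \<open>y^n * y^m\<close>, because
  \<open>2 n m >= n + m\<close>.\<close>

lemma Lambert_series_eq:
  assumes y: "0 < y" "y < 1"
  shows "(\<Sum>n. \<psi> (Suc n) * ((y\<^sup>2) ^ Suc n / (1 - (y\<^sup>2) ^ Suc n))) = (\<Sum>\<^sub>\<infinity>n\<in>{1..}. r n * (y\<^sup>2) ^ n)"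
    and "(\<lambda>n. r n * (y\<^sup>2) ^ n) summable_on {1..}"
proof -
  define h where "h n m = \<psi> n * (y\<^sup>2) ^ (n * m)" for n m
  have geo: "(\<lambda>n. norm (y ^ n)) summable_on {1..}"
    by (rule summable_on_subset_banach[OF summable_nonneg_imp_summable_on])
       (use y in \<open>auto simp: summable_geometric power_abs[symmetric]\<close>)
  have summ: "(\<lambda>(n, m). h n m) summable_on {1..} \<times> {1..}"
  proof (rule abs_summable_summable, rule Infinite_Sum.abs_summable_on_comparison_test)
    have "(\<lambda>(n, m). y ^ n * y ^ m) summable_on ({1..} \<times> {1..})"
      by (rule summable_on_times[OF geo geo])
    then show "(\<lambda>p. norm (case p of (n, m) \<Rightarrow> y ^ n * y ^ m)) summable_on ({1..} \<times> {1..})"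
      using y by (simp add: case_prod_unfold abs_mult)
    fix p :: "nat \<times> nat" assume "p \<in> {1..} \<times> {1..}"
    then obtain n m where p: "p = (n, m)" "n \<ge> 1" "m \<ge> 1" by auto
    have "n + m \<le> n * m + n * m" using p by (intro add_mono) auto
    then have "y ^ (2 * (n * m)) \<le> y ^ (n + m)" using y by (intro power_decreasing) auto
    moreover have "\<bar>\<psi> n\<bar> \<le> 1" using vals[of n] by auto
    ultimately have "\<bar>\<psi> n\<bar> * y ^ (2 * (n * m)) \<le> 1 * y ^ (n + m)"
      using y by (intro mult_mono) auto
    then show "norm (case p of (n, m) \<Rightarrow> h n m) \<le> norm (case p of (n, m) \<Rightarrow> y ^ n * y ^ m)"
      using y by (simp add: p h_def abs_mult power_add power_abs flip: power_mult)
  qed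
  have div: "(\<Sum>e | e dvd n. h e (n div e)) = r n * (y\<^sup>2) ^ n" for n
    unfolding r_def sum_distrib_right by (intro sum.cong) (auto simp: h_def)
  have x: "0 < y\<^sup>2" "y\<^sup>2 < 1" using y by (auto simp: power_less_one_iff)
  have inner: "(\<Sum>\<^sub>\<infinity>m\<in>{1..}. h n m) = \<psi> n * ((y\<^sup>2) ^ n / (1 - (y\<^sup>2) ^ n))" if "n \<in> {1..}" for n
  proof -
    have "(y\<^sup>2) ^ n < 1" using x that by (simp add: power_less_one_iff)
    then have "(\<lambda>m. ((y\<^sup>2) ^ n) ^ Suc m) sums ((y\<^sup>2) ^ n * (1 / (1 - (y\<^sup>2) ^ n)))"
      unfolding power_Suc using x by (intro sums_mult geometric_sums) auto
    then have "((\<lambda>m. ((y\<^sup>2) ^ n) ^ Suc m) has_sum ((y\<^sup>2) ^ n * (1 / (1 - (y\<^sup>2) ^ n)))) UNIV"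
      by (rule sums_nonneg_imp_has_sum) auto
    then have "((\<lambda>m. ((y\<^sup>2) ^ n) ^ m) has_sum ((y\<^sup>2) ^ n * (1 / (1 - (y\<^sup>2) ^ n)))) (Suc ` UNIV)"
      by (subst has_sum_reindex) (auto simp: o_def)
    also have "Suc ` UNIV = {1..}" by (rule range_Suc)
    finally have "((\<lambda>m. \<psi> n * ((y\<^sup>2) ^ n) ^ m) has_sum (\<psi> n * ((y\<^sup>2) ^ n * (1 / (1 - (y\<^sup>2) ^ n))))) {1..}"
      by (rule has_sum_cmult_right)
    then show ?thesis by (simp add: h_def power_mult infsumI)
  qed
  have "(\<lambda>n. \<Sum>\<^sub>\<infinity>m\<in>{1..}. h n m) summable_on {1..}" by (rule summable_on_Sigma_banach[OF summ])
  then have "(\<lambda>n. \<psi> n * ((y\<^sup>2) ^ n / (1 - (y\<^sup>2) ^ n))) summable_on {1..}"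
    by (rule summable_on_cong[THEN iffD1, rotated]) (rule inner)
  also have "{1..} = Suc ` UNIV" by (rule range_Suc[symmetric])
  finally have "((\<lambda>n. \<psi> (Suc n) * ((y\<^sup>2) ^ Suc n / (1 - (y\<^sup>2) ^ Suc n))) has_sum
      (\<Sum>\<^sub>\<infinity>n\<in>Suc ` UNIV. \<psi> n * ((y\<^sup>2) ^ n / (1 - (y\<^sup>2) ^ n)))) UNIV"
    by (subst (asm) summable_iff_has_sum_infsum) (simp add: has_sum_reindex o_def)
  then have "(\<Sum>n. \<psi> (Suc n) * ((y\<^sup>2) ^ Suc n / (1 - (y\<^sup>2) ^ Suc n)))
      = (\<Sum>\<^sub>\<infinity>n\<in>Suc ` UNIV. \<psi> n * ((y\<^sup>2) ^ n / (1 - (y\<^sup>2) ^ n)))"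
    by (rule sums_unique[OF has_sum_imp_sums, symmetric])
  also have "Suc ` UNIV = {1..}" by (rule range_Suc)
  also have "(\<Sum>\<^sub>\<infinity>n\<in>{1..}. \<psi> n * ((y\<^sup>2) ^ n / (1 - (y\<^sup>2) ^ n))) = (\<Sum>\<^sub>\<infinity>n\<in>{1..}. \<Sum>\<^sub>\<infinity>m\<in>{1..}. h n m)"
    by (rule infsum_cong) (rule inner[symmetric])
  also have "\<dots> = (\<Sum>\<^sub>\<infinity>n\<in>{1..}. r n * (y\<^sup>2) ^ n)"
    using infsum_divisors(1)[OF summ] by (simp add: div)
  finally show "(\<Sum>n. \<psi> (Suc n) * ((y\<^sup>2) ^ Suc n / (1 - (y\<^sup>2) ^ Suc n))) = (\<Sum>\<^sub>\<infinity>n\<in>{1..}. r n * (y\<^sup>2) ^ n)" .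
  show "(\<lambda>n. r n * (y\<^sup>2) ^ n) summable_on {1..}"
    using infsum_divisors(2)[OF summ] by (simp add: div)
qed

text \<open>The Lambert series stays below \<open>C\<close>, yet it dominates the sum of
  \<open>(y^2)^(m^2)\<close> over \<open>1 <= m <= M\<close>, which tends to \<open>M > C\<close> as
  \<open>y\<close> tends to 1.\<close>

theorem L_1_nonzero:
  assumes C: "\<And>N. \<bar>\<Sum>n<N. \<psi> (Suc n)\<bar> \<le> C"
  shows "\<not> (\<lambda>n. \<psi> (Suc n) / real (Suc n)) sums 0"
proof
  assume L: "(\<lambda>n. \<psi> (Suc n) / real (Suc n)) sums 0"
  obtain M :: nat where M: "real M > C" using reals_Archimedean2 by blast
  have le: "(\<Sum>m\<in>{1..M}. (y\<^sup>2) ^ (m\<^sup>2)) \<le> C" if y: "0 < y" "y < 1" for y :: real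
  proof -
    have "(\<Sum>m\<in>{1..M}. (y\<^sup>2) ^ (m\<^sup>2)) \<le> (\<Sum>m\<in>{1..M}. r (m\<^sup>2) * (y\<^sup>2) ^ (m\<^sup>2))"
      using r_square_ge_1 y by (intro sum_mono) (simp add: mult_le_cancel_right1)
    also have "\<dots> = (\<Sum>n\<in>(\<lambda>m. m\<^sup>2) ` {1..M}. r n * (y\<^sup>2) ^ n)"
      by (subst sum.reindex) (auto simp: inj_on_def)
    also have "\<dots> \<le> (\<Sum>\<^sub>\<infinity>n\<in>{1..}. r n * (y\<^sup>2) ^ n)"
      using r_nonneg by (intro finite_sum_le_infsum Lambert_series_eq(2) y) auto
    also have "\<dots> \<le> C"
      using abs_Lambert_series_le[OF C L y] unfolding Lambert_series_eq(1)[OF y] by simp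
    finally show ?thesis .
  qed
  have "((\<lambda>y::real. \<Sum>m\<in>{1..M}. (y\<^sup>2) ^ (m\<^sup>2)) \<longlongrightarrow> (\<Sum>m\<in>{1..M}. (1\<^sup>2) ^ (m\<^sup>2))) (at_left 1)"
    by (intro tendsto_intros)
  moreover have "\<forall>\<^sub>F y in at_left (1::real). (\<Sum>m\<in>{1..M}. (y\<^sup>2) ^ (m\<^sup>2)) \<le> C"
    using eventually_at_left_real[OF zero_less_one]
  proof eventually_elim
    case (elim y)
    then show ?case using le[of y] by simp
  qed
  ultimately have "(\<Sum>m\<in>{1..M}. (1\<^sup>2::real) ^ (m\<^sup>2)) \<le> C"
    by (rule tendsto_upperbound) auto
  with M show False by simp
qed

end

subsection \<open>Characters modulo a prime\<close>

lemma norm_periodic_partial_sum_le: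
  fixes f :: "nat \<Rightarrow> complex"
  assumes per: "\<And>n. f (n + d) = f n" and zero: "(\<Sum>n<d. f n) = 0"
    and "d > 0" and bound: "\<And>n. norm (f n) \<le> B"
  shows "norm (\<Sum>n<N. f n) \<le> real d * B"
proof (induction N rule: less_induct)
  case (less N)
  have B: "0 \<le> B" using order_trans[OF norm_ge_zero bound] .
  show ?case
  proof (cases "N < d")
    case True
    have "norm (\<Sum>n<N. f n) \<le> (\<Sum>n<N. B)" by (intro sum_norm_le bound)
    also have "\<dots> \<le> real d * B" using True B by (simp add: mult_right_mono)
    finally show ?thesis .
  next
    case False
    have "(\<Sum>n<d + M. f n) = (\<Sum>n<M. f n)" for M
      by (induction M) (use zero per in \<open>auto simp: add.commute\<close>)
    from this[of "N - d"] False have "(\<Sum>n<N. f n) = (\<Sum>n<N - d. f n)" by simp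
    with less.IH[of "N - d"] False \<open>d > 0\<close> show ?thesis by simp
  qed
qed

lemma has_field_derivative_prod_log:
  fixes f :: "'i \<Rightarrow> complex \<Rightarrow> complex"
  assumes "finite A" "\<And>i. i \<in> A \<Longrightarrow> (f i has_field_derivative f i s * q i) (at s)"
  shows "((\<lambda>s. \<Prod>i\<in>A. f i s) has_field_derivative (\<Prod>i\<in>A. f i s) * (\<Sum>i\<in>A. q i)) (at s)"
  using assms
proof (induction A rule: finite_induct)
  case (insert x A)
  from DERIV_mult[OF insert.prems[of x] insert.IH] insert.prems insert.hyps show ?case
    by (simp add: algebra_simps)
qed auto

lemma dseries_diff_cmult:
  assumes "abs_conv_right a" "abs_conv_right b" "Re s > 1"
  shows "dseries a s = c * dseries b s + dseries (\<lambda>n. a n - c * b n) s"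
proof -
  have "(\<lambda>n. a n * of_nat n powr (-s) - c * (b n * of_nat n powr (-s))) sums (dseries a s - c * dseries b s)"
    by (intro sums_diff sums_mult dseries_sums assms)
  then have "dseries (\<lambda>n. a n - c * b n) s = dseries a s - c * dseries b s"
    by (simp add: dseries_def sums_iff algebra_simps)
  then show ?thesis by simp
qed

lemma sum_powers_root_of_unity:
  fixes z :: complex
  assumes "z ^ n = 1" "z \<noteq> 1"
  shows "(\<Sum>i<n. z ^ i) = 0"
  using assms by (simp add: geometric_sum)

text \<open>A fixed primitive root turns the characters modulo \<open>d\<close> into powers of one
  root of unity, indexed by \<open>j < d - 1\<close>.\<close>

locale prime_modulus =
  fixes d g :: nat
  assumes prime_d: "prime d" and odd_d: "odd d" and primroot: "residue_primroot d g"
begin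

lemma d_ge_3: "d \<ge> 3"
  using prime_ge_2_nat[OF prime_d] odd_d by (cases "d = 2") auto

lemma ord_g: "ord d g = d - 1" "coprime d g"
  using primroot prime_d by (auto simp: residue_primroot_def totient_prime)

text \<open>Only the class modulo \<open>d - 1\<close> matters; the choice of representative drops
  out in \<open>chi_power_g\<close>.\<close>

definition dlog :: "nat \<Rightarrow> nat" where
  "dlog n = (SOME e. [g ^ e = n] (mod d))"

lemma dlog:
  assumes "\<not> d dvd n"
  shows "[g ^ dlog n = n] (mod d)"
proof -
  have "n mod d \<in> totatives d"
    using assms prime_d d_ge_3 by (auto simp: in_totatives_iff prime_imp_coprime coprime_commute
        prime_gt_0_nat less_imp_le intro!: Nat.gr0I)
  then have "n mod d \<in> (\<lambda>i. g ^ i mod d) ` {..<totient d}"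
    using residue_primroot_is_generator[OF _ primroot] d_ge_3 by (simp add: bij_betw_def)
  then have "\<exists>e. [g ^ e = n] (mod d)" by (auto simp: unique_euclidean_semiring_class.cong_def)
  then show ?thesis unfolding dlog_def by (rule someI_ex)
qed

definition omega :: complex where
  "omega = exp (2 * of_real pi * \<i> / of_nat (d - 1))"

lemma omega_power: "omega ^ m = exp (2 * of_real pi * \<i> * of_nat m / of_nat (d - 1))"
  unfolding omega_def by (simp add: exp_of_nat_mult[symmetric] field_simps)

lemma omega_power_eq_1_iff: "omega ^ m = 1 \<longleftrightarrow> d - 1 dvd m"
  unfolding omega_power using d_ge_3 by (subst complex_root_unity_eq_1) auto

lemma norm_omega: "norm omega = 1"
  by (simp add: omega_def norm_exp_eq_Re)

lemma omega_power_cong: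
  assumes "[a = b] (mod (d - 1))"
  shows "omega ^ a = omega ^ b"
proof -
  have "omega ^ n = omega ^ (n mod (d - 1))" for n
  proof -
    have "omega ^ n = (omega ^ (d - 1)) ^ (n div (d - 1)) * omega ^ (n mod (d - 1))"
      by (metis power_add power_mult mult_div_mod_eq)
    also have "omega ^ (d - 1) = 1" by (simp add: omega_power_eq_1_iff)
    finally show ?thesis by simp
  qed
  with assms show ?thesis by (metis unique_euclidean_semiring_class.cong_def)
qed

definition chi :: "nat \<Rightarrow> nat \<Rightarrow> complex" where
  "chi j n = (if d dvd n then 0 else omega ^ (j * dlog n))"

lemma chi_power_g: "[g ^ e = n] (mod d) \<Longrightarrow> chi j n = omega ^ (j * e)"
proof -
  assume e: "[g ^ e = n] (mod d)"
  have "coprime d (g ^ e)" using ord_g by simp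
  then have "coprime d n" using e cong_imp_coprime by (metis coprime_commute)
  then have n: "\<not> d dvd n" using d_ge_3 by (metis coprime_common_divisor_nat dvd_refl nat_dvd_1_iff_1 One_nat_def
      numeral_le_one_iff semiring_norm(70))
  have "[g ^ e = g ^ dlog n] (mod d)" using dlog[OF n] e by (metis cong_sym cong_trans)
  then have "[e = dlog n] (mod (d - 1))"
    using order_divides_expdiff[OF ord_g(2)] ord_g by simp
  then have "[j * e = j * dlog n] (mod (d - 1))" by (rule cong_scalar_left)
  then show "chi j n = omega ^ (j * e)" using n by (simp add: chi_def omega_power_cong)
qed

lemma chi_0 [simp]: "chi j 0 = 0" by (simp add: chi_def)

lemma chi_1: "chi j (Suc 0) = 1"
  using chi_power_g[of 0 1 j] by simp

lemma chi_mult: "chi j (m * n) = chi j m * chi j n"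
proof (cases "d dvd m \<or> d dvd n")
  case False
  then have "[g ^ (dlog m + dlog n) = m * n] (mod d)"
    by (auto simp: power_add intro!: cong_mult dlog)
  from chi_power_g[OF this, of j] False show ?thesis
    by (simp add: chi_def algebra_simps power_add)
qed (auto simp: chi_def)

lemma chi_periodic: "chi j (n + d) = chi j n"
proof (cases "d dvd n")
  case False
  then have "[g ^ dlog n = n + d] (mod d)" using dlog by (simp add: unique_euclidean_semiring_class.cong_def)
  from chi_power_g[OF this] show ?thesis using False by (simp add: chi_def)
qed (simp add: chi_def)

lemma norm_chi_le: "norm (chi j n) \<le> 1"
  by (simp add: chi_def norm_power norm_omega)

text \<open>For fixed \<open>n\<close> prime to \<open>d\<close> the values over all
  \<open>j\<close> are the powers of one root of unity, and their geometric sum vanishes unless that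
  root is 1.\<close>

lemma sum_chi_index: "(\<Sum>j<d - 1. chi j n) = (if [n = 1] (mod d) then of_nat (d - 1) else 0)"
proof (cases "d dvd n")
  case True
  then have "\<not> [n = 1] (mod d)" using d_ge_3 by (metis One_nat_def cong_dvd_iff nat_dvd_1_iff_1
      numeral_le_one_iff semiring_norm(70))
  with True show ?thesis by (simp add: chi_def)
next
  case False
  have eq: "chi j n = (omega ^ dlog n) ^ j" for j
    using False by (simp add: chi_def flip: power_mult) (simp add: mult.commute)
  have "[n = 1] (mod d) \<longleftrightarrow> [g ^ dlog n = g ^ 0] (mod d)"
    using dlog[OF False] by (metis cong_sym cong_trans power_0)
  also have "\<dots> \<longleftrightarrow> d - 1 dvd dlog n"
    unfolding order_divides_expdiff[OF ord_g(2)] ord_g(1) by (rule cong_0_iff)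
  finally have iff: "[n = 1] (mod d) \<longleftrightarrow> omega ^ dlog n = 1" by (simp add: omega_power_eq_1_iff)
  show ?thesis
  proof (cases "[n = 1] (mod d)")
    case True
    with iff show ?thesis by (simp add: eq)
  next
    case False
    have "(omega ^ dlog n) ^ (d - 1) = 1"
      by (simp add: omega_power_eq_1_iff flip: power_mult)
    with False iff show ?thesis by (simp add: eq sum_powers_root_of_unity)
  qed
qed

lemma sum_chi:
  assumes "j < d - 1"
  shows "(\<Sum>n<d. chi j n) = (if j = 0 then of_nat (d - 1) else 0)"
proof -
  have "(\<Sum>n<d. chi j n) = (\<Sum>n\<in>totatives d. chi j n)"
  proof (rule sum.mono_neutral_right)
    show "totatives d \<subseteq> {..<d}" using totatives_less[of _ d] d_ge_3 by auto
    show "\<forall>n\<in>{..<d} - totatives d. chi j n = 0"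
      using prime_d by (auto simp: totatives_prime chi_def)
  qed auto
  also have "\<dots> = (\<Sum>i<d - 1. chi j (g ^ i mod d))"
    using sum.reindex_bij_betw[OF residue_primroot_is_generator[OF _ primroot], of "chi j"] d_ge_3 prime_d
    by (simp add: totient_prime)
  also have "\<dots> = (\<Sum>i<d - 1. (omega ^ j) ^ i)"
    by (intro sum.cong refl) (subst chi_power_g, auto simp: unique_euclidean_semiring_class.cong_def power_mult)
  also have "\<dots> = (if j = 0 then of_nat (d - 1) else 0)"
  proof (cases "j = 0")
    case False
    then have "omega ^ j \<noteq> 1" "(omega ^ j) ^ (d - 1) = 1"
      using assms by (auto simp: omega_power_eq_1_iff dest: dvd_imp_le simp flip: power_mult)
    then show ?thesis using False by (simp add: sum_powers_root_of_unity)
  qed simp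
  finally show ?thesis .
qed

text \<open>Conjugation pairs \<open>j\<close> with \<open>d - 1 - j\<close>, so a zero at 1 of one
  \<open>L\<close>-function produces a zero of another unless
  \<open>j = (d - 1) div 2\<close>.\<close>

lemma cnj_chi:
  assumes "j \<le> d - 1"
  shows "cnj (chi j n) = chi (d - 1 - j) n"
proof -
  have "omega ^ (d - 1) = 1" by (simp add: omega_power_eq_1_iff)
  then have "omega ^ j * omega ^ (d - 1 - j) = 1"
    unfolding power_add[symmetric] using assms by (simp only: le_add_diff_inverse)
  moreover have "omega ^ j * cnj (omega ^ j) = 1"
    by (subst complex_norm_square[symmetric]) (simp add: norm_power norm_omega)
  ultimately have "cnj (omega ^ j) = omega ^ (d - 1 - j)"
    by (metis mult_cancel_left mult_zero_left zero_neq_one)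
  then show ?thesis by (simp add: chi_def power_mult)
qed

lemma chi_quadratic: "chi ((d - 1) div 2) n \<in> {0, 1, -1}"
proof -
  have "(omega ^ ((d - 1) div 2)) ^ 2 = 1"
    using odd_d by (simp add: omega_power_eq_1_iff flip: power_mult)
  then have "omega ^ ((d - 1) div 2) \<in> {1, -1}" by (simp add: power2_eq_1_iff)
  then have "(omega ^ ((d - 1) div 2)) ^ e \<in> {1, -1}" for e
    by (cases "even e") auto
  from this[of "dlog n"] show ?thesis by (simp add: chi_def power_mult)
qed

lemma chi_partial_sums:
  assumes "0 < j" "j < d - 1"
  shows "norm (\<Sum>n\<le>N. chi j n) \<le> d"
  using norm_periodic_partial_sum_le[of "chi j" d 1 "Suc N"] assms d_ge_3
  by (simp add: chi_periodic sum_chi norm_chi_le lessThan_Suc_atMost)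

text \<open>The mean value of the principal character, hence the residue of its
  \<open>L\<close>-function at 1.\<close>

definition rho :: complex where "rho = of_nat (d - 1) / of_nat d"

lemma chi_0_partial_sums: "norm (\<Sum>n\<le>N. chi 0 n - rho) \<le> d * 2"
proof -
  have "norm (chi 0 n - rho) \<le> 1 + 1" for n
  proof (rule norm_triangle_le_diff, rule add_mono[OF norm_chi_le])
    have "norm rho = real (d - 1) / real d" by (simp only: rho_def norm_divide norm_of_nat)
    then show "norm rho \<le> 1" using d_ge_3 by simp
  qed
  then show ?thesis
    using norm_periodic_partial_sum_le[of "\<lambda>n. chi 0 n - rho" d 2 "Suc N"] d_ge_3
    by (simp add: chi_periodic sum_subtractf sum_chi lessThan_Suc_atMost rho_def)
qed

definition L :: "nat \<Rightarrow> complex \<Rightarrow> complex" where "L j = dseries (chi j)"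

lemma abs_conv_right_chi: "abs_conv_right (chi j)"
  by (rule abs_conv_right_bounded[OF norm_chi_le])

lemma mangoldt_le_ln: "(mangoldt n :: real) \<le> 1 + ln (real n)"
  by (cases "n = 0") (use mangoldt_le[of n] in auto)

lemma abs_conv_right_chi_mangoldt: "abs_conv_right (\<lambda>n. chi j n * mangoldt n)"
proof (rule abs_conv_right_ln[where C = 1])
  show "norm (chi j n * mangoldt n) \<le> 1 * (1 + ln (real n))" for n
    using mult_mono[OF norm_chi_le[of j n] mangoldt_le_ln[of n]] mangoldt_nonneg[of n]
    by (simp add: norm_mult)
qed

text \<open>The convolution of \<open>chi j * mangoldt\<close> with \<open>chi j\<close> is
  \<open>chi j * ln\<close>. Writing the logarithmic derivative without a quotient makes it
  available before \<open>L\<close> is known not to vanish.\<close>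

lemma L_has_field_derivative:
  assumes "Re s > 1"
  shows "(L j has_field_derivative L j s * (- dseries (\<lambda>n. chi j n * mangoldt n) s)) (at s)"
proof -
  have conv: "(\<Sum>e | e dvd n. (chi j e * mangoldt e) * chi j (n div e)) = of_real (ln (real n)) * chi j n" for n
  proof (cases "n = 0")
    case False
    have "(chi j e * mangoldt e) * chi j (n div e) = chi j n * mangoldt e" if "e dvd n" for e
      using that chi_mult[of j e "n div e"] by (simp add: mult_ac)
    then have "(\<Sum>e | e dvd n. (chi j e * mangoldt e) * chi j (n div e)) = chi j n * (\<Sum>e | e dvd n. mangoldt e)"
      unfolding sum_distrib_left by (intro sum.cong) auto
    then show ?thesis using False by (simp add: mangoldt_sum mult.commute)
  qed simp
  have "abs_conv_right (\<lambda>n. of_real (ln (real n)) * chi j n)"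
  proof (rule abs_conv_right_ln[where C = 1])
    fix n show "norm (of_real (ln (real n)) * chi j n) \<le> 1 * (1 + ln (real n))"
    proof (cases "n = 0")
      case False
      then show ?thesis
        using mult_left_mono[OF norm_chi_le[of j n], of "ln (real n)"] by (simp add: norm_mult)
    qed simp
  qed
  with dseries_mult[OF abs_conv_right_chi_mangoldt abs_conv_right_chi assms, of j j]
  have "dseries (\<lambda>n. chi j n * mangoldt n) s * L j s = dseries (\<lambda>n. of_real (ln (real n)) * chi j n) s"
    by (simp add: conv L_def)
  moreover have "dseries (\<lambda>n. - (of_real (ln (real n)) * chi j n)) s = - dseries (\<lambda>n. of_real (ln (real n)) * chi j n) s"
    using \<open>abs_conv_right (\<lambda>n. of_real (ln (real n)) * chi j n)\<close> dseries_sums[OF _ assms]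
    by (simp add: dseries_def suminf_minus sums_iff)
  ultimately show ?thesis
    using has_field_derivative_dseries[OF abs_conv_right_chi assms, of j] by (simp add: L_def mult.commute)
qed

end

subsection \<open>Nonvanishing on the line of abscissa 1\<close>

text \<open>The order of a zero is read off along the ray to the right of \<open>s\<close>, where
  the Dirichlet series converge: with \<open>F w = (w - s)^n * g w\<close> the logarithmic
  derivative is \<open>n / (w - s)\<close> plus a bounded term. The point \<open>z\<close> rules out
  that \<open>F\<close> vanishes identically.\<close>

lemma log_derivative_order:
  assumes hol: "F holomorphic_on S" and S: "open S" "connected S" and s: "s \<in> S" and z: "z \<in> S" "F z \<noteq> 0"
  obtains m :: nat where "m = 0 \<longleftrightarrow> F s \<noteq> 0" "m = 1 \<Longrightarrow> deriv F s \<noteq> 0"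
    "\<forall>\<^sub>F x in at_right 0. F (s + of_real x) \<noteq> 0"
    "((\<lambda>x. of_real x * (deriv F (s + of_real x) / F (s + of_real x))) \<longlongrightarrow> of_nat m) (at_right 0)"
proof -
  have line: "((\<lambda>x. s + of_real x) \<longlongrightarrow> s) (at_right 0)"
    by (rule tendsto_eq_intros | simp)+
  have shift: "((\<lambda>x. f (s + of_real x)) \<longlongrightarrow> f s) (at_right 0)"
    if "f holomorphic_on B" "open B" "s \<in> B" for f :: "complex \<Rightarrow> complex" and B
    using holomorphic_on_imp_continuous_on[OF that(1)] that(2,3) line
    by (intro isCont_tendsto_compose[of s f]) (auto simp: continuous_on_eq_continuous_at)
  have zero: "((\<lambda>x. complex_of_real x) \<longlongrightarrow> 0) (at_right 0)"
    by (rule tendsto_eq_intros | simp)+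
  show ?thesis
  proof (cases "F s = 0")
    case False
    have "((\<lambda>x. of_real x * (deriv F (s + of_real x) / F (s + of_real x))) \<longlongrightarrow> 0 * (deriv F s / F s)) (at_right 0)"
      using False by (intro tendsto_mult zero tendsto_divide shift[of _ S] hol holomorphic_deriv S s)
    moreover have "\<forall>\<^sub>F x in at_right 0. F (s + of_real x) \<noteq> 0"
      by (rule tendsto_imp_eventually_ne[OF shift[OF hol S(1) s] False])
    ultimately show ?thesis using False by (intro that[of 0]) auto
  next
    case True
    have "\<not> F constant_on S" using True z s unfolding constant_on_def by metis
    from holomorphic_factor_zero_nonconstant[OF hol S s True this]
    obtain g r n where g: "0 < n" "0 < r" "ball s r \<subseteq> S" "g holomorphic_on ball s r"
      "\<And>w. w \<in> ball s r \<Longrightarrow> F w = (w - s) ^ n * g w" "\<And>w. w \<in> ball s r \<Longrightarrow> g w \<noteq> 0"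
      by metis
    have dF: "deriv F w = of_nat n * (w - s) ^ (n - 1) * g w + (w - s) ^ n * deriv g w" if w: "w \<in> ball s r" for w
    proof -
      have "(g has_field_derivative deriv g w) (at w)" by (rule holomorphic_derivI[OF g(4) _ w]) auto
      then have "((\<lambda>w. (w - s) ^ n * g w) has_field_derivative
          of_nat n * (w - s) ^ (n - 1) * g w + (w - s) ^ n * deriv g w) (at w)"
        by (auto intro!: derivative_eq_intros simp: mult_ac)
      then have "(F has_field_derivative of_nat n * (w - s) ^ (n - 1) * g w + (w - s) ^ n * deriv g w) (at w)"
        by (rule has_field_derivative_transform_within_open[OF _ open_ball w]) (use g(5) in auto)
      then show ?thesis by (rule DERIV_imp_deriv)
    qed
    have near: "\<forall>\<^sub>F x in at_right 0. x > 0 \<and> s + of_real x \<in> ball s r"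
      using eventually_at_right_real[OF g(2)] by eventually_elim (auto simp: dist_norm)
    have "((\<lambda>x. of_nat n + of_real x * (deriv g (s + of_real x) / g (s + of_real x)))
        \<longlongrightarrow> of_nat n + 0 * (deriv g s / g s)) (at_right 0)"
      using g(2,6) by (intro tendsto_add tendsto_const tendsto_mult zero tendsto_divide
          shift[of _ "ball s r"] g(4) holomorphic_deriv open_ball) auto
    moreover have "\<forall>\<^sub>F x in at_right 0. of_nat n + of_real x * (deriv g (s + of_real x) / g (s + of_real x))
        = of_real x * (deriv F (s + of_real x) / F (s + of_real x))"
      using near
    proof eventually_elim
      case (elim x)
      have "of_real x * (of_nat n * of_real x ^ (n - 1) * G + of_real x ^ n * G') / (of_real x ^ n * G)
          = of_nat n + of_real x * (G' / G)" if "G \<noteq> 0" for G G' :: complex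
      proof -
        have "complex_of_real x ^ n = of_real x * of_real x ^ (n - 1)"
          using g(1) by (simp flip: power_Suc)
        then show ?thesis using that elim by (simp add: field_simps)
      qed
      from this[OF g(6)] show ?case using elim by (simp add: dF g(5))
    qed
    ultimately have "((\<lambda>x. of_real x * (deriv F (s + of_real x) / F (s + of_real x))) \<longlongrightarrow> of_nat n) (at_right 0)"
      by (simp add: Lim_transform_eventually)
    moreover have "\<forall>\<^sub>F x in at_right 0. F (s + of_real x) \<noteq> 0"
      using near by eventually_elim (use g(5,6) in auto)
    moreover have "deriv F s \<noteq> 0" if "n = 1"
      using dF[of s] g(2,6) that by simp
    ultimately show ?thesis using g(1) True by (intro that[of n]) auto
  qed
qed

text \<open>Provides a point where no \<open>L\<close>-function vanishes: the terms with
  \<open>m >= 2\<close> are at most \<open>1 / (2 m (m - 1))\<close>, a telescoping series of sum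
  1/2, and cannot cancel the leading 1.\<close>

lemma dseries_3_nonzero:
  assumes a: "\<And>n. norm (a n) \<le> 1" and a1: "a (Suc 0) = 1"
  shows "dseries a 3 \<noteq> 0"
proof -
  let ?f = "\<lambda>n. a n * of_nat n powr (-3)"
  have conv: "abs_conv_right a" by (rule abs_conv_right_bounded[OF a])
  have sums: "?f sums dseries a 3" using dseries_sums[OF conv, of 3] by simp
  have eq: "dseries a 3 = (\<Sum>n. ?f (n + 2)) + 1"
    using suminf_split_initial_segment[of ?f 2] sums a1
    by (simp add: sums_iff numeral_2_eq_2)
  have half: "(\<lambda>n. (1 / real (Suc n) - 1 / real (Suc (Suc n))) / 2) sums ((1 - 0) / 2)"
  proof (intro sums_divide)
    have "(\<lambda>n. 1 / real (Suc n)) \<longlonglongrightarrow> 0" by real_asymp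
    from telescope_sums'[OF this] show "(\<lambda>n. 1 / real (Suc n) - 1 / real (Suc (Suc n))) sums (1 - 0)" by simp
  qed
  have le: "norm (?f (n + 2)) \<le> (1 / real (Suc n) - 1 / real (Suc (Suc n))) / 2" for n
  proof -
    have "norm (?f (n + 2)) \<le> 1 * real (n + 2) powr (-3)"
      unfolding norm_mult norm_of_nat_powr using a by (intro mult_mono) auto
    also have "\<dots> = 1 / (real n + 2) ^ 3"
      by (simp add: powr_minus_divide add.commute)
    also have "\<dots> \<le> 1 / (2 * ((real n + 1) * (real n + 2)))"
    proof (rule divide_left_mono)
      show "2 * ((real n + 1) * (real n + 2)) \<le> (real n + 2) ^ 3"
        by (simp add: power3_eq_cube algebra_simps)
    qed auto
    also have "\<dots> = (1 / real (Suc n) - 1 / real (Suc (Suc n))) / 2"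
      by (simp add: field_simps)
    finally show ?thesis .
  qed
  have "norm (\<Sum>n. ?f (n + 2)) \<le> (\<Sum>n. (1 / real (Suc n) - 1 / real (Suc (Suc n))) / 2)"
    using half le by (intro norm_suminf_le) (auto simp: sums_iff)
  also have "\<dots> = 1 / 2" using half by (simp add: sums_iff)
  finally have less: "norm (\<Sum>n. ?f (n + 2)) < 1" by simp
  show ?thesis unfolding eq
  proof
    assume "(\<Sum>n. ?f (n + 2)) + 1 = 0"
    then have "(\<Sum>n. ?f (n + 2)) = -1" by (simp only: eq_neg_iff_add_eq_0)
    with less show False by simp
  qed
qed

text \<open>Termwise \<open>3 + 4 cos x + cos (2 x) = 2 (1 + cos x)^2 >= 0\<close>.\<close>

lemma Re_dseries_3_4_1:
  fixes a :: "nat \<Rightarrow> real"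
  assumes "abs_conv_right (\<lambda>n. of_real (a n))" "\<And>n. 0 \<le> a n" "\<sigma> > 1"
  shows "0 \<le> 3 * Re (dseries (\<lambda>n. of_real (a n)) (of_real \<sigma>))
     + 4 * Re (dseries (\<lambda>n. of_real (a n)) (Complex \<sigma> t)) + Re (dseries (\<lambda>n. of_real (a n)) (Complex \<sigma> (2 * t)))"
proof -
  let ?D = "dseries (\<lambda>n. of_real (a n))"
  have summand: "Re (of_real (a n) * of_nat n powr (- Complex \<sigma> u)) = a n * real n powr (-\<sigma>) * cos (u * ln (real n))" for n u
  proof (cases "n = 0")
    case False
    then have "of_nat n powr (- Complex \<sigma> u) = exp (- Complex \<sigma> u * of_real (ln (real n)))"
      by (simp add: powr_def Ln_of_nat)
    then have "Re (of_nat n powr (- Complex \<sigma> u)) = real n powr (-\<sigma>) * cos (u * ln (real n))"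
      using False by (simp add: Re_exp powr_def)
    then show ?thesis by simp
  qed simp
  have sums: "(\<lambda>n. a n * real n powr (-\<sigma>) * cos (u * ln (real n))) sums Re (?D (Complex \<sigma> u))" for u
    using sums_Re[OF dseries_sums[OF assms(1), of "Complex \<sigma> u"]] assms(3) by (simp only: summand complex.sel)
  have total: "(\<lambda>n. 3 * (a n * real n powr (-\<sigma>) * cos (0 * ln (real n))) + 4 * (a n * real n powr (-\<sigma>) * cos (t * ln (real n)))
      + a n * real n powr (-\<sigma>) * cos (2 * t * ln (real n)))
      sums (3 * Re (?D (Complex \<sigma> 0)) + 4 * Re (?D (Complex \<sigma> t)) + Re (?D (Complex \<sigma> (2 * t))))"
    by (intro sums_add sums_mult sums)
  have nonneg: "0 \<le> 3 * (a n * real n powr (-\<sigma>) * cos (0 * ln (real n))) + 4 * (a n * real n powr (-\<sigma>) * cos (t * ln (real n)))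
      + a n * real n powr (-\<sigma>) * cos (2 * t * ln (real n))" for n
  proof -
    have "cos (2 * t * ln (real n)) = 2 * cos (t * ln (real n)) ^ 2 - 1"
      using cos_double_cos[of "t * ln (real n)"] by (simp add: mult_ac)
    then have "3 * (a n * real n powr (-\<sigma>) * cos (0 * ln (real n))) + 4 * (a n * real n powr (-\<sigma>) * cos (t * ln (real n)))
      + a n * real n powr (-\<sigma>) * cos (2 * t * ln (real n)) = a n * real n powr (-\<sigma>) * (2 * (1 + cos (t * ln (real n)))\<^sup>2)"
      by (simp only:) (simp add: algebra_simps power2_eq_square)
    then show ?thesis using assms(2) by simp
  qed
  have "Complex \<sigma> 0 = of_real \<sigma>" by (simp add: complex_eq_iff)
  with sums_le[OF nonneg sums_zero total] show ?thesis by simp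
qed

section \<open>The product of all L-functions modulo d\<close>

context prime_modulus
begin

text \<open>Continuation of \<open>(s - 1) * L 0 s\<close>: splitting off the mean
  \<open>rho\<close> of the principal character leaves coefficients with bounded partial
  sums.\<close>

definition f0 :: "complex \<Rightarrow> complex" where
  "f0 s = rho * reg_zeta s + (s - 1) * dseries (\<lambda>n. chi 0 n - rho) s"

text \<open>Up to the Euler factor at \<open>d\<close>, this is \<open>s - 1\<close> times the
  Dedekind zeta function of the \<open>d\<close>-th cyclotomic field.\<close>

definition F :: "complex \<Rightarrow> complex" where
  "F s = f0 s * (\<Prod>j\<in>{1..<d - 1}. L j s)"

definition acoef :: "nat \<Rightarrow> real" where
  "acoef n = (if [n = 1] (mod d) then real (d - 1) * mangoldt n else 0)"

abbreviation D :: "complex \<Rightarrow> complex" where "D \<equiv> dseries (\<lambda>n. of_real (acoef n))"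

lemma acoef_nonneg: "0 \<le> acoef n"
  by (simp add: acoef_def mangoldt_nonneg)

lemma abs_conv_right_acoef: "abs_conv_right (\<lambda>n. of_real (acoef n))"
proof (rule abs_conv_right_ln[where C = "real (d - 1)"])
  show "norm (complex_of_real (acoef n)) \<le> real (d - 1) * (1 + ln (real n))" for n
    using mult_left_mono[OF mangoldt_le_ln[of n], of "real (d - 1)"] mangoldt_nonneg[of n]
      order_trans[OF mangoldt_nonneg[of n] mangoldt_le_ln[of n]]
    by (auto simp: acoef_def abs_mult)
qed

lemma L_holomorphic: "0 < j \<Longrightarrow> j < d - 1 \<Longrightarrow> L j holomorphic_on {s. Re s > 0}"
  unfolding L_def by (rule dseries_bounded_partial_sums(1)[OF chi_partial_sums])

lemma f0_holomorphic: "f0 holomorphic_on {s. Re s > 0}"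
  unfolding f0_def
  by (intro holomorphic_intros reg_zeta_holomorphic dseries_bounded_partial_sums(1)[OF chi_0_partial_sums])

lemma F_holomorphic: "F holomorphic_on {s. Re s > 0}"
  unfolding F_def by (intro holomorphic_on_mult f0_holomorphic holomorphic_on_prod L_holomorphic) auto

lemma f0_eq: "Re s > 1 \<Longrightarrow> f0 s = (s - 1) * L 0 s"
  using dseries_diff_cmult[OF abs_conv_right_chi abs_conv_right_bounded[of "\<lambda>_. 1" 1], of s 0 rho]
  by (simp add: f0_def L_def reg_zeta_eq algebra_simps)

lemma f0_has_field_derivative:
  assumes "Re s > 1"
  shows "(f0 has_field_derivative f0 s * (1 / (s - 1) - dseries (\<lambda>n. chi 0 n * mangoldt n) s)) (at s)"
proof -
  have "s \<noteq> 1" using assms by auto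
  have "((\<lambda>s. (s - 1) * L 0 s) has_field_derivative
      f0 s * (1 / (s - 1) - dseries (\<lambda>n. chi 0 n * mangoldt n) s)) (at s)"
    using \<open>s \<noteq> 1\<close> unfolding f0_eq[OF assms]
    by (auto intro!: derivative_eq_intros L_has_field_derivative assms simp: field_simps)
  then show ?thesis
    by (rule has_field_derivative_transform_within_open[OF _ open_halfspace_Re_gt[of 1]])
       (use assms f0_eq in auto)
qed

text \<open>Logarithmic derivatives add up over the characters, and orthogonality keeps only the
  terms with \<open>n = 1 (mod d)\<close>.\<close>

lemma F_has_field_derivative:
  assumes "Re s > 1"
  shows "(F has_field_derivative F s * (1 / (s - 1) - D s)) (at s)"
proof -
  define q where "q j = dseries (\<lambda>n. chi j n * mangoldt n) s" for j
  have "(F has_field_derivative f0 s * (1 / (s - 1) - q 0) * (\<Prod>j\<in>{1..<d - 1}. L j s)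
      + ((\<Prod>j\<in>{1..<d - 1}. L j s) * (\<Sum>j\<in>{1..<d - 1}. - q j)) * f0 s) (at s)"
    unfolding F_def q_def
    by (intro DERIV_mult f0_has_field_derivative has_field_derivative_prod_log L_has_field_derivative assms) auto
  also have "f0 s * (1 / (s - 1) - q 0) * (\<Prod>j\<in>{1..<d - 1}. L j s)
      + ((\<Prod>j\<in>{1..<d - 1}. L j s) * (\<Sum>j\<in>{1..<d - 1}. - q j)) * f0 s
      = F s * (1 / (s - 1) - (q 0 + (\<Sum>j\<in>{1..<d - 1}. q j)))"
    by (simp add: F_def sum_negf algebra_simps)
  also have "q 0 + (\<Sum>j\<in>{1..<d - 1}. q j) = (\<Sum>j<d - 1. q j)"
    using d_ge_3 by (simp add: lessThan_atLeast0 sum.atLeast_Suc_lessThan)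
  also have "(\<Sum>j<d - 1. q j) = D s"
  proof -
    have "(\<lambda>n. \<Sum>j<d - 1. chi j n * mangoldt n * of_nat n powr (-s)) sums (\<Sum>j<d - 1. q j)"
      unfolding q_def by (intro sums_sum dseries_sums abs_conv_right_chi_mangoldt assms)
    moreover have "(\<Sum>j<d - 1. chi j n * mangoldt n * of_nat n powr (-s)) = of_real (acoef n) * of_nat n powr (-s)" for n
      unfolding sum_distrib_right[symmetric] sum_chi_index by (simp add: acoef_def)
    ultimately show ?thesis by (simp add: dseries_def sums_iff)
  qed
  finally show ?thesis .
qed

lemma F_3_nonzero: "F 3 \<noteq> 0"
proof -
  have "L j 3 \<noteq> 0" for j
    unfolding L_def by (rule dseries_3_nonzero) (rule norm_chi_le, rule chi_1)
  then show ?thesis by (simp add: F_def f0_eq)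
qed

lemma D_log_derivative:
  assumes "Re s > 1" "F s \<noteq> 0"
  shows "D s = 1 / (s - 1) - deriv F s / F s"
  using DERIV_imp_deriv[OF F_has_field_derivative[OF assms(1)]] assms(2) by (simp add: field_simps)

lemma F_order:
  assumes "Re s > 0"
  obtains m :: nat where "m = 0 \<longleftrightarrow> F s \<noteq> 0" "m = 1 \<Longrightarrow> deriv F s \<noteq> 0"
    "\<forall>\<^sub>F x in at_right 0. F (s + of_real x) \<noteq> 0"
    "((\<lambda>x. of_real x * (deriv F (s + of_real x) / F (s + of_real x))) \<longlongrightarrow> of_nat m) (at_right 0)"
proof (rule log_derivative_order[OF F_holomorphic, of s 3])
  show "connected {s. Re s > 0}" by (intro convex_connected convex_halfspace_Re_gt)
qed (use assms F_3_nonzero that in \<open>auto simp: open_halfspace_Re_gt\<close>)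

text \<open>In place of an Euler product: \<open>F' / F = 1 / (s - 1) - D\<close> stays bounded to
  the right of \<open>s\<close>, so the order of a zero there, being the limit of
  \<open>x * F' / F\<close>, is 0.\<close>

lemma F_nonzero_right:
  assumes "Re s > 1"
  shows "F s \<noteq> 0"
proof -
  have "Re s > 0" using assms by simp
  then obtain m :: nat where m: "m = 0 \<longleftrightarrow> F s \<noteq> 0" "\<forall>\<^sub>F x in at_right 0. F (s + of_real x) \<noteq> 0"
    "((\<lambda>x. of_real x * (deriv F (s + of_real x) / F (s + of_real x))) \<longlongrightarrow> of_nat m) (at_right 0)"
    by (rule F_order) (rule that)
  have "s \<noteq> 1" using assms by auto
  have line: "((\<lambda>x. s + of_real x) \<longlongrightarrow> s) (at_right 0)"
    by (rule tendsto_eq_intros | simp)+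
  have "isCont D s"
    using has_field_derivative_dseries[OF abs_conv_right_acoef assms] by (rule DERIV_isCont)
  then have "((\<lambda>x. of_real x * (1 / (s + of_real x - 1) - D (s + of_real x))) \<longlongrightarrow> 0 * (1 / (s - 1) - D s)) (at_right 0)"
    using \<open>s \<noteq> 1\<close> line
    by (intro tendsto_mult tendsto_diff tendsto_divide tendsto_const isCont_tendsto_compose[of s D])
       (auto intro!: tendsto_eq_intros)
  moreover have "\<forall>\<^sub>F x in at_right 0. of_real x * (1 / (s + of_real x - 1) - D (s + of_real x))
      = of_real x * (deriv F (s + of_real x) / F (s + of_real x))"
    using m(2) eventually_at_right_less[of "0::real"]
  proof eventually_elim
    case (elim x)
    then show ?case using D_log_derivative[of "s + of_real x"] assms by simp
  qed
  ultimately have "((\<lambda>x. of_real x * (deriv F (s + of_real x) / F (s + of_real x))) \<longlongrightarrow> 0) (at_right 0)"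
    by (simp add: Lim_transform_eventually)
  with m(3) have "of_nat m = (0::complex)" by (rule tendsto_unique[rotated]) simp
  with m(1) show ?thesis by simp
qed

text \<open>A zero of \<open>F\<close> of order \<open>m\<close> becomes a pole of \<open>D\<close>
  with residue \<open>-m\<close>; at \<open>t = 0\<close> the explicit \<open>1 / (s - 1)\<close>
  adds 1.\<close>

lemma D_order:
  obtains m :: nat where "m = 0 \<longleftrightarrow> F (Complex 1 t) \<noteq> 0" "m = 1 \<Longrightarrow> deriv F (Complex 1 t) \<noteq> 0"
    "((\<lambda>x. x * Re (D (Complex (1 + x) t))) \<longlongrightarrow> (if t = 0 then 1 else 0) - real m) (at_right 0)"
proof -
  have "Re (Complex 1 t) > 0" by simp
  then obtain m :: nat where m: "m = 0 \<longleftrightarrow> F (Complex 1 t) \<noteq> 0" "m = 1 \<Longrightarrow> deriv F (Complex 1 t) \<noteq> 0"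
    "((\<lambda>x. of_real x * (deriv F (Complex 1 t + of_real x) / F (Complex 1 t + of_real x))) \<longlongrightarrow> of_nat m) (at_right 0)"
    by (rule F_order) (rule that)
  have shift: "Complex 1 t + of_real x = Complex (1 + x) t" for x by (simp add: complex_eq_iff)
  have pole: "((\<lambda>x. of_real x * (1 / (Complex (1 + x) t - 1))) \<longlongrightarrow> (if t = 0 then 1 else 0)) (at_right 0)"
  proof (cases "t = 0")
    case True
    have "\<forall>\<^sub>F x in at_right 0. 1 = of_real x * (1 / (Complex (1 + x) t - 1))"
      using eventually_at_right_less[of "0::real"]
    proof eventually_elim
      case (elim x)
      have "Complex (1 + x) t - 1 = of_real x" using True by (simp add: complex_eq_iff)
      then show ?case using elim by simp
    qed
    then show ?thesis using True by (simp add: Lim_transform_eventually[OF tendsto_const])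
  next
    case False
    have "((\<lambda>x. of_real x * (1 / (Complex 1 t + of_real x - 1))) \<longlongrightarrow> 0 * (1 / (Complex 1 t + 0 - 1))) (at_right 0)"
      using False by (intro tendsto_intros) (auto simp: complex_eq_iff intro!: tendsto_eq_intros)
    then show ?thesis using False by (simp add: shift)
  qed
  have "((\<lambda>x. Re (of_real x * (1 / (Complex (1 + x) t - 1))
        - of_real x * (deriv F (Complex (1 + x) t) / F (Complex (1 + x) t))))
      \<longlongrightarrow> Re ((if t = 0 then 1 else 0) - of_nat m)) (at_right 0)"
    using m(3) unfolding shift by (intro tendsto_Re tendsto_diff pole)
  moreover have "\<forall>\<^sub>F x in at_right 0. Re (of_real x * (1 / (Complex (1 + x) t - 1))
        - of_real x * (deriv F (Complex (1 + x) t) / F (Complex (1 + x) t))) = x * Re (D (Complex (1 + x) t))"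
    using eventually_at_right_less[of "0::real"]
  proof eventually_elim
    case (elim x)
    have "D (Complex (1 + x) t) = 1 / (Complex (1 + x) t - 1) - deriv F (Complex (1 + x) t) / F (Complex (1 + x) t)"
      using elim by (intro D_log_derivative F_nonzero_right) auto
    then have "of_real x * (1 / (Complex (1 + x) t - 1))
        - of_real x * (deriv F (Complex (1 + x) t) / F (Complex (1 + x) t)) = of_real x * D (Complex (1 + x) t)"
      by (simp only: right_diff_distrib)
    then show ?case by simp
  qed
  ultimately have "((\<lambda>x. x * Re (D (Complex (1 + x) t))) \<longlongrightarrow> Re ((if t = 0 then 1 else 0) - of_nat m)) (at_right 0)"
    by (rule Lim_transform_eventually)
  moreover have "Re ((if t = 0 then 1 else 0) - of_nat m) = (if t = 0 then 1 else 0) - real m" by simp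
  ultimately show ?thesis using m(1,2) that by simp
qed

text \<open>With orders \<open>m0\<close>, \<open>m1\<close>, \<open>m2\<close> at heights
  \<open>0\<close>, \<open>t\<close>, \<open>2 t\<close> the 3-4-1 inequality gives
  \<open>3 (1 - m0) - 4 m1 - m2 >= 0\<close>, hence \<open>m1 <= 3/4\<close>.\<close>

lemma F_nonzero_line:
  assumes "t \<noteq> 0"
  shows "F (Complex 1 t) \<noteq> 0"
proof -
  obtain m0 :: nat where m0: "((\<lambda>x. x * Re (D (Complex (1 + x) 0))) \<longlongrightarrow> 1 - real m0) (at_right 0)"
    by (rule D_order[of 0]) (rule that, simp)
  obtain m1 :: nat where m1: "m1 = 0 \<longleftrightarrow> F (Complex 1 t) \<noteq> 0"
    "((\<lambda>x. x * Re (D (Complex (1 + x) t))) \<longlongrightarrow> 0 - real m1) (at_right 0)"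
    by (rule D_order[of t]) (rule that, use assms in simp_all)
  obtain m2 :: nat where m2: "((\<lambda>x. x * Re (D (Complex (1 + x) (2 * t)))) \<longlongrightarrow> 0 - real m2) (at_right 0)"
    by (rule D_order[of "2 * t"]) (rule that, use assms in simp)
  have "((\<lambda>x. 3 * (x * Re (D (Complex (1 + x) 0))) + 4 * (x * Re (D (Complex (1 + x) t)))
      + x * Re (D (Complex (1 + x) (2 * t)))) \<longlongrightarrow> 3 * (1 - real m0) + 4 * (0 - real m1) + (0 - real m2)) (at_right 0)"
    by (intro tendsto_add tendsto_mult tendsto_const m0 m1(2) m2)
  moreover have "\<forall>\<^sub>F x in at_right 0. 0 \<le> 3 * (x * Re (D (Complex (1 + x) 0))) + 4 * (x * Re (D (Complex (1 + x) t)))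
      + x * Re (D (Complex (1 + x) (2 * t)))"
    using eventually_at_right_less[of "0::real"]
  proof eventually_elim
    case (elim x)
    have "Complex (1 + x) 0 = of_real (1 + x)" by (simp add: complex_eq_iff)
    then have "0 \<le> x * (3 * Re (D (Complex (1 + x) 0)) + 4 * Re (D (Complex (1 + x) t)) + Re (D (Complex (1 + x) (2 * t))))"
      using elim Re_dseries_3_4_1[OF abs_conv_right_acoef acoef_nonneg, of "1 + x" t]
      by (intro mult_nonneg_nonneg) auto
    then show ?case by (simp add: algebra_simps)
  qed
  ultimately have "0 \<le> 3 * (1 - real m0) + 4 * (0 - real m1) + (0 - real m2)"
    by (rule tendsto_lowerbound) simp
  moreover have "b < 1" if "0 \<le> 3 * (1 - a) + 4 * (0 - b) + (0 - c)" "0 \<le> a" "0 \<le> c" for a b c :: real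
    using that by simp
  ultimately have "real m1 < 1" using of_nat_0_le_iff by blast
  then have "m1 = 0" by simp
  with m1(1) show ?thesis by simp
qed

section \<open>Nonvanishing at the point 1\<close>

lemma L_1_sums:
  assumes "0 < j" "j < d - 1"
  shows "(\<lambda>n. chi j n / of_nat n) sums L j 1"
proof -
  have "chi j n * of_nat n powr (-1) = chi j n / of_nat n" for n
    by (cases "n = 0") (auto simp: powr_minus_divide)
  then show ?thesis
    using dseries_bounded_partial_sums(2)[OF chi_partial_sums[OF assms], of 1] by (simp add: L_def)
qed

text \<open>The index \<open>(d - 1) div 2\<close> belongs to the Legendre symbol, the only real
  nonprincipal character, so the Lambert series argument applies.\<close>

lemma L_1_quadratic: "L ((d - 1) div 2) 1 \<noteq> 0"
proof
  let ?j = "(d - 1) div 2"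
  let ?\<psi> = "\<lambda>n. Re (chi ?j n)"
  assume vanishes: "L ?j 1 = 0"
  have j: "0 < ?j" "?j < d - 1" using d_ge_3 by auto
  have eq: "chi ?j n = of_real (?\<psi> n)" for n
    using chi_quadratic[of n] by auto
  interpret real_character ?\<psi>
  proof
    show "?\<psi> (m * n) = ?\<psi> m * ?\<psi> n" for m n
      by (subst chi_mult, subst (1 2) eq) simp
    show "?\<psi> n \<in> {0, 1, -1}" for n using chi_quadratic[of n] by auto
  qed (auto simp: chi_1)
  have "(\<lambda>n. chi ?j n / of_nat n) sums 0" using L_1_sums[OF j] by (simp only: vanishes)
  from sums_Re[OF this] have "(\<lambda>n. ?\<psi> n / real n) sums 0" by simp
  then have "(\<lambda>n. ?\<psi> (Suc n) / real (Suc n)) sums 0"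
    using sums_Suc_iff[of "\<lambda>n. ?\<psi> n / real n" 0] by simp
  moreover have "\<bar>\<Sum>n<N. ?\<psi> (Suc n)\<bar> \<le> real d" for N
  proof -
    have "(\<Sum>n<N. ?\<psi> (Suc n)) = Re (\<Sum>n\<le>N. chi ?j n)"
      by (subst lessThan_Suc_atMost[symmetric], subst sum.lessThan_Suc_shift) simp
    then show ?thesis
      using order_trans[OF abs_Re_le_cmod chi_partial_sums[OF j]] by metis
  qed
  ultimately show False using L_1_nonzero by blast
qed

text \<open>Nonnegativity of \<open>D\<close> to the right of 1 allows \<open>F\<close> at most a
  simple zero there. A vanishing \<open>L j 1\<close> with \<open>j\<close> not quadratic comes with
  its conjugate and would make the zero double.\<close>

lemma F_1_nonzero: "F 1 \<noteq> 0"
proof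
  assume F1: "F 1 = 0"
  have one: "Complex 1 0 = 1" by (simp add: complex_eq_iff)
  obtain m :: nat where m: "m \<noteq> 0" "m = 1 \<Longrightarrow> deriv F 1 \<noteq> 0"
    "((\<lambda>x. x * Re (D (Complex (1 + x) 0))) \<longlongrightarrow> 1 - real m) (at_right 0)"
    by (rule D_order[of 0], unfold one) (rule that, use F1 in simp_all)
  have "\<forall>\<^sub>F x in at_right 0. 0 \<le> x * Re (D (Complex (1 + x) 0))"
    using eventually_at_right_less[of "0::real"]
  proof eventually_elim
    case (elim x)
    have "Complex (1 + x) 0 = of_real (1 + x)" by (simp add: complex_eq_iff)
    \<comment> \<open>At \<open>t = 0\<close> the 3-4-1 inequality says
      \<open>8 * Re D >= 0\<close>.\<close>
    then show ?case
      using elim Re_dseries_3_4_1[OF abs_conv_right_acoef acoef_nonneg, of "1 + x" 0]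
      by (intro mult_nonneg_nonneg) auto
  qed
  with m(3) have "0 \<le> 1 - real m" by (rule tendsto_lowerbound) simp
  with m(1) have "m = 1" by simp
  then have dF: "deriv F 1 \<noteq> 0" by (rule m(2))
  have "f0 1 = rho" by (simp add: f0_def reg_zeta_1)
  then have "f0 1 \<noteq> 0" using d_ge_3 by (simp add: rho_def)
  with F1 obtain j where j: "0 < j" "j < d - 1" "L j 1 = 0"
    by (auto simp: F_def Suc_le_eq)
  define j' where "j' = d - 1 - j"
  have j': "0 < j'" "j' < d - 1" using j by (auto simp: j'_def)
  have "(\<lambda>n. cnj (chi j n / of_nat n)) sums cnj (L j 1)"
    using L_1_sums[OF j(1,2)] by (simp only: sums_cnj)
  then have "(\<lambda>n. chi j' n / of_nat n) sums 0"
    using j by (simp add: cnj_chi j'_def)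
  with L_1_sums[OF j'] have "L j' 1 = 0" by (rule sums_unique2)
  show False
  proof (cases "j' = j")
    case True
    then have "j = (d - 1) div 2" by (auto simp: j'_def)
    with j(3) L_1_quadratic show False by simp
  next
    case False
    define R where "R s = f0 s * (\<Prod>i\<in>{1..<d - 1} - {j} - {j'}. L i s)" for s
    have "F s = L j s * (L j' s * R s)" for s
      unfolding F_def R_def using j j' False
      by (subst prod.remove[of _ j], simp, simp, subst prod.remove[of _ j']) auto
    then have F_eq: "F = (\<lambda>s. L j s * (L j' s * R s))" by auto
    have dom: "(1::complex) \<in> {s. Re s > 0}" "open {s. Re s > 0}" by (auto simp: open_halfspace_Re_gt)
    have "R holomorphic_on {s. Re s > 0}"
      unfolding R_def by (intro holomorphic_on_mult f0_holomorphic holomorphic_on_prod L_holomorphic) auto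
    then have "((\<lambda>s. L j s * (L j' s * R s)) has_field_derivative
        deriv (L j) 1 * (L j' 1 * R 1) + (deriv (L j') 1 * R 1 + deriv R 1 * L j' 1) * L j 1) (at 1)"
      by (intro DERIV_mult holomorphic_derivI[OF L_holomorphic _ dom(1)] holomorphic_derivI[OF _ _ dom(1)] j j' dom)
    then have "(F has_field_derivative 0) (at 1)"
      by (simp add: F_eq j(3) \<open>L j' 1 = 0\<close>)
    with dF show False by (simp add: DERIV_imp_deriv)
  qed
qed

text \<open>All that the Tauberian argument has to know about the \<open>L\<close>-functions. Here
  \<open>h\<close> is \<open>- F' / F\<close>, continuous up to the line because \<open>F\<close>
  has no zero on it.\<close>

theorem D_minus_pole_continuous:
  obtains h where "continuous_on {s. Re s \<ge> 1} h" "\<And>s. Re s > 1 \<Longrightarrow> D s = 1 / (s - 1) + h s"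
proof
  have nz: "F s \<noteq> 0" if "Re s \<ge> 1" for s
  proof (cases "Re s > 1")
    case False
    with that have s: "s = Complex 1 (Im s)" by (simp add: complex_eq_iff)
    show ?thesis
    proof (cases "Im s = 0")
      case True
      with s have "s = 1" by (simp add: complex_eq_iff)
      then show ?thesis using F_1_nonzero by simp
    next
      case False
      then show ?thesis using F_nonzero_line s by metis
    qed
  qed (rule F_nonzero_right)
  have "F holomorphic_on {s. Re s > 0}" "deriv F holomorphic_on {s. Re s > 0}"
    by (auto intro: F_holomorphic holomorphic_deriv open_halfspace_Re_gt)
  then have "continuous_on {s. Re s \<ge> 1} F" "continuous_on {s. Re s \<ge> 1} (deriv F)"
    by (auto elim!: continuous_on_subset[OF holomorphic_on_imp_continuous_on])
  then show "continuous_on {s. Re s \<ge> 1} (\<lambda>s. - (deriv F s / F s))"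
    using nz by (intro continuous_intros) auto
  show "D s = 1 / (s - 1) + - (deriv F s / F s)" if "Re s > 1" for s
    using D_log_derivative[OF that] nz[of s] that by simp
qed

end

subsection \<open>The Riemann-Lebesgue lemma\<close>

lemma tendsto_zero_if_le_inverse:
  fixes f :: "real \<Rightarrow> real"
  assumes "\<And>U. U \<ge> 1 \<Longrightarrow> \<bar>f U\<bar> \<le> C / U"
  shows "(f \<longlongrightarrow> 0) at_top"
proof (rule tendsto_rabs_zero_cancel, rule tendsto_sandwich)
  show "\<forall>\<^sub>F U in at_top. (0::real) \<le> \<bar>f U\<bar>" by simp
  show "\<forall>\<^sub>F U in at_top. \<bar>f U\<bar> \<le> C / U"
    using eventually_ge_at_top[of "1::real"] by eventually_elim (rule assms)
  show "((\<lambda>U::real. C / U) \<longlongrightarrow> 0) at_top" by real_asymp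
qed simp

text \<open>The phase \<open>c\<close> treats cosines and sines at once.\<close>

lemma Riemann_Lebesgue_C1:
  fixes p p' :: "real \<Rightarrow> real" and Y c :: real
  assumes "0 \<le> Y" and der: "\<And>x. (p has_real_derivative p' x) (at x)"
    and cont: "continuous_on {0..Y} p'"
  shows "((\<lambda>U. integral {0..Y} (\<lambda>y. p y * cos (U * y + c))) \<longlongrightarrow> 0) at_top"
proof (rule tendsto_zero_if_le_inverse)
  fix U :: real assume "U \<ge> 1"
  have contp: "continuous_on A p" for A
    using der by (meson DERIV_isCont continuous_at_imp_continuous_on)
  have total: "((\<lambda>y. p' y * (sin (U * y + c) / U) + p y * cos (U * y + c)) has_integral
      p Y * (sin (U * Y + c) / U) - p 0 * (sin (U * 0 + c) / U)) {0..Y}"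
  proof (rule fundamental_theorem_of_calculus[OF \<open>0 \<le> Y\<close>])
    fix y assume "y \<in> {0..Y}"
    have "((\<lambda>y. p y * (sin (U * y + c) / U)) has_real_derivative
        p' y * (sin (U * y + c) / U) + p y * cos (U * y + c)) (at y)"
      using \<open>U \<ge> 1\<close> by (auto intro!: derivative_eq_intros der simp: field_simps)
    then show "((\<lambda>y. p y * (sin (U * y + c) / U)) has_vector_derivative
        p' y * (sin (U * y + c) / U) + p y * cos (U * y + c)) (at y within {0..Y})"
      by (simp add: has_real_derivative_iff_has_vector_derivative has_vector_derivative_at_within)
  qed
  have part: "((\<lambda>y. p' y * (sin (U * y + c) / U)) has_integral
      integral {0..Y} (\<lambda>y. p' y * (sin (U * y + c) / U))) {0..Y}"
    using \<open>U \<ge> 1\<close> by (intro integrable_integral integrable_continuous_real continuous_intros cont) auto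
  have "((\<lambda>y. p y * cos (U * y + c)) has_integral
      p Y * (sin (U * Y + c) / U) - p 0 * (sin (U * 0 + c) / U)
      - integral {0..Y} (\<lambda>y. p' y * (sin (U * y + c) / U))) {0..Y}"
    using has_integral_diff[OF total part] by simp
  then have eq: "integral {0..Y} (\<lambda>y. p y * cos (U * y + c)) =
      p Y * (sin (U * Y + c) / U) - p 0 * (sin (U * 0 + c) / U)
      - integral {0..Y} (\<lambda>y. p' y * (sin (U * y + c) / U))"
    by (rule integral_unique)
  have sin_le: "\<bar>q * (sin z / U)\<bar> \<le> \<bar>q\<bar> / U" for q z
    using \<open>U \<ge> 1\<close> mult_left_mono[OF abs_sin_le_one[of z], of "\<bar>q\<bar>"] by (simp add: abs_mult field_simps)
  have "norm (integral {0..Y} (\<lambda>y. p' y * (sin (U * y + c) / U))) \<le> integral {0..Y} (\<lambda>y. \<bar>p' y\<bar> / U)"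
    using \<open>U \<ge> 1\<close> sin_le
    by (intro integral_norm_bound_integral integrable_continuous_real continuous_intros cont) auto
  then have "\<bar>integral {0..Y} (\<lambda>y. p' y * (sin (U * y + c) / U))\<bar> \<le> integral {0..Y} (\<lambda>y. \<bar>p' y\<bar>) / U"
    by simp
  then show "\<bar>integral {0..Y} (\<lambda>y. p y * cos (U * y + c))\<bar>
      \<le> (\<bar>p Y\<bar> + \<bar>p 0\<bar> + integral {0..Y} (\<lambda>y. \<bar>p' y\<bar>)) / U"
    unfolding eq using sin_le[of "p Y" "U * Y + c"] sin_le[of "p 0" "U * 0 + c"]
    by (simp only: add_divide_distrib)
qed

text \<open>Uniform approximation by polynomials reduces the claim to the differentiable
  case.\<close>

lemma Riemann_Lebesgue:
  fixes f :: "real \<Rightarrow> real" and Y c :: real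
  assumes Y: "0 \<le> Y" and cont: "continuous_on {0..Y} f"
  shows "((\<lambda>U. integral {0..Y} (\<lambda>y. f y * cos (U * y + c))) \<longlongrightarrow> 0) at_top"
proof (rule tendstoI)
  fix e :: real assume "e > 0"
  \<comment> \<open>\<open>Y + 1\<close> rather than \<open>Y\<close>, so that the quotient also
    serves \<open>Y = 0\<close>.\<close>
  define e' where "e' = e / (2 * (Y + 1))"
  have "e' > 0" using \<open>e > 0\<close> Y by (simp add: e'_def)
  obtain g where g: "real_polynomial_function g" "\<And>x. x \<in> {0..Y} \<Longrightarrow> \<bar>f x - g x\<bar> < e'"
    by (rule Stone_Weierstrass_real_polynomial_function[OF compact_Icc cont \<open>e' > 0\<close>], rule that)
  obtain g' where g': "real_polynomial_function g'" "\<And>x. (g has_real_derivative g' x) (at x)"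
    using has_real_derivative_polynomial_function[OF g(1)] by blast
  have contg: "continuous_on A g" "continuous_on A g'" for A
    using g(1) g'(1) by (auto simp: real_polynomial_function_eq intro: continuous_on_polymonial_function)
  have "((\<lambda>U. integral {0..Y} (\<lambda>y. g y * cos (U * y + c))) \<longlongrightarrow> 0) at_top"
    by (rule Riemann_Lebesgue_C1[OF Y g'(2) contg(2)])
  then have "\<forall>\<^sub>F U in at_top. dist (integral {0..Y} (\<lambda>y. g y * cos (U * y + c))) 0 < e / 2"
    using \<open>e > 0\<close> by (intro tendstoD) auto
  then show "\<forall>\<^sub>F U in at_top. dist (integral {0..Y} (\<lambda>y. f y * cos (U * y + c))) 0 < e"
  proof eventually_elim
    case (elim U)
    have "integral {0..Y} (\<lambda>y. f y * cos (U * y + c)) - integral {0..Y} (\<lambda>y. g y * cos (U * y + c))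
        = integral {0..Y} (\<lambda>y. (f y - g y) * cos (U * y + c))"
      by (subst integral_diff [symmetric])
         (auto intro!: integrable_continuous_real continuous_intros cont contg simp: algebra_simps)
    moreover have "norm (integral {0..Y} (\<lambda>y. (f y - g y) * cos (U * y + c))) \<le> integral {0..Y} (\<lambda>_. e')"
    proof (rule integral_norm_bound_integral)
      fix y assume "y \<in> {0..Y}"
      then have "\<bar>f y - g y\<bar> * \<bar>cos (U * y + c)\<bar> \<le> e' * 1"
        using g(2)[of y] \<open>e' > 0\<close> by (intro mult_mono) auto
      then show "norm ((f y - g y) * cos (U * y + c)) \<le> e'" by (simp add: abs_mult)
    qed (auto intro!: integrable_continuous_real continuous_intros cont contg)
    moreover have "integral {0..Y} (\<lambda>_. e') \<le> e / 2"
      using \<open>e > 0\<close> Y by (simp add: e'_def field_simps)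
    ultimately show ?case using elim by (simp add: dist_norm)
  qed
qed

lemma integral_sin_divide_tendsto:
  assumes "Y > 0"
  shows "((\<lambda>U. integral {0..Y} (\<lambda>y. sin (U * y) / y)) \<longlongrightarrow> pi / 2) at_top"
proof (rule Lim_transform_eventually)
  show "((\<lambda>U. Si (U * Y)) \<longlongrightarrow> pi / 2) at_top"
    by (rule filterlim_compose[OF Si_at_top])
       (use assms in \<open>auto intro!: filterlim_at_top_mult_tendsto_pos[OF tendsto_const] filterlim_ident\<close>)
  show "\<forall>\<^sub>F U in at_top. Si (U * Y) = integral {0..Y} (\<lambda>y. sin (U * y) / y)"
    using eventually_gt_at_top[of "0::real"]
  proof eventually_elim
    case (elim U)
    have "((\<lambda>y. sin (U * y) / y) has_integral Si (U * Y) - Si (U * 0)) {0..Y}"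
    \<comment> \<open>At \<open>y = 0\<close> the integrand is \<open>0 / 0 = 0\<close> whereas
      \<open>sinc 0 = 1\<close>, so the derivative is claimed in the interior only.\<close>
    proof (rule fundamental_theorem_of_calculus_interior)
      show "continuous_on {0..Y} (\<lambda>y. Si (U * y))"
        by (intro continuous_at_imp_continuous_on ballI isCont_o2[OF _ isCont_Si] continuous_intros)
      fix y assume y: "y \<in> {0<..<Y}"
      have "((\<lambda>y. Si (U * y)) has_real_derivative sinc (U * y) * U) (at y)"
        by (rule DERIV_chain'[of "\<lambda>y. U * y" U, OF _ DERIV_Si]) (auto intro!: derivative_eq_intros)
      then show "((\<lambda>y. Si (U * y)) has_vector_derivative sin (U * y) / y) (at y)"
        using y elim by (simp add: has_real_derivative_iff_has_vector_derivative)
    qed (use assms in auto)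
    then show ?case by (simp add: integral_unique Si_def flip: zero_ereal_def)
  qed
qed

subsection \<open>A band-limited minorant\<close>

text \<open>Euler's product for the sine, with all factors after the first bounded by 1.\<close>

lemma sin_pi_le:
  fixes x :: real assumes "0 \<le> x" "x \<le> 1"
  shows "sin (pi * x) \<le> pi * x * (1 - x\<^sup>2)"
proof (rule LIMSEQ_le_const2[OF sin_product_formula_real])
  have x2: "x\<^sup>2 \<le> 1" using assms by (simp add: power_le_one)
  have factor: "0 \<le> 1 - x\<^sup>2 / (of_nat k)\<^sup>2" "1 - x\<^sup>2 / (of_nat k)\<^sup>2 \<le> 1" if "k \<ge> 1" for k :: nat
  proof -
    have "(1::real) \<le> (of_nat k)\<^sup>2" using that by simp
    with x2 have "x\<^sup>2 \<le> (of_nat k)\<^sup>2" by linarith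
    then show "0 \<le> 1 - x\<^sup>2 / (of_nat k)\<^sup>2" using that by (simp add: divide_le_eq)
  qed simp
  have "pi * x * (\<Prod>k=1..n. 1 - x\<^sup>2 / (of_nat k)\<^sup>2) \<le> pi * x * (1 - x\<^sup>2)" if "n \<ge> 1" for n
  proof -
    have "(\<Prod>k=1..n. 1 - x\<^sup>2 / (of_nat k)\<^sup>2) = (1 - x\<^sup>2) * (\<Prod>k=Suc 1..n. 1 - x\<^sup>2 / (of_nat k)\<^sup>2)"
      using that by (subst prod.atLeast_Suc_atMost) auto
    also have "\<dots> \<le> (1 - x\<^sup>2) * 1"
      using x2 factor by (intro mult_left_mono prod_le_1) auto
    finally show ?thesis using assms by (intro mult_left_mono) auto
  qed
  then show "\<exists>N. \<forall>n\<ge>N. pi * x * (\<Prod>k=1..n. 1 - x\<^sup>2 / (of_nat k)\<^sup>2) \<le> pi * x * (1 - x\<^sup>2)" by blast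
qed

text \<open>\<open>selberg_kernel v = (7/5) (1 - cos (\<pi> v)) / (\<pi>\<^sup>2 v\<^sup>2 (4 - v\<^sup>2))\<close> is, up to scaling, Selberg's band-limited
  minorant of an interval: it is nonpositive for \<open>|v| \<ge> 2\<close>, although its integral over the line is
  \<open>7/20\<close>.\<close>

definition selberg_weight :: "real \<Rightarrow> real" where
  "selberg_weight y = 7 / 20 * ((1 - y / pi) / pi + sin (2 * y) / (2 * pi\<^sup>2))"

text \<open>The difference quotient of \<open>selberg_weight\<close> at 0; \<open>sinc\<close>
  supplies the continuous value at \<open>y = 0\<close>.\<close>

definition weight_slope :: "real \<Rightarrow> real" where
  "weight_slope y = 7 / 20 * ((sinc (2 * y) - 1) / pi\<^sup>2)"

definition selberg_kernel :: "real \<Rightarrow> real" where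
  "selberg_kernel v = integral {0..pi} (\<lambda>y. selberg_weight y * cos (y * v))"

lemma weight_eq: "selberg_weight y = 7 / (20 * pi) + y * weight_slope y"
  by (cases "y = 0") (simp_all add: selberg_weight_def weight_slope_def field_simps power2_eq_square)

lemma continuous_on_weight: "continuous_on A selberg_weight"
  unfolding selberg_weight_def by (intro continuous_intros) auto

lemma continuous_on_weight_slope: "continuous_on A weight_slope"
  unfolding weight_slope_def
  by (intro continuous_intros continuous_on_compose2[OF continuous_on_sinc[of UNIV "\<lambda>x. x"]]) auto

lemma continuous_kernel: "isCont selberg_kernel v"
proof -
  have "continuous_on UNIV (\<lambda>v. integral (cbox 0 pi) (\<lambda>y. selberg_weight y * cos (y * v)))"
    unfolding selberg_weight_def by (intro integral_continuous_on_param) (auto simp: case_prod_unfold intro!: continuous_intros)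
  then show ?thesis by (simp add: selberg_kernel_def[abs_def] continuous_on_eq_continuous_at)
qed

text \<open>The triangle \<open>1 - y / pi\<close> transforms into the Fejer kernel
  \<open>(1 - cos (pi v)) / v^2\<close>, and the sine term into the same numerator over
  \<open>4 - v^2\<close>. Adding them gives \<open>1 / v^2 + 1 / (4 - v^2)\<close>, which has the
  sign of \<open>4 - v^2\<close>.\<close>

lemma kernel_closed_form:
  assumes "v \<noteq> 0" "v\<^sup>2 \<noteq> 4"
  shows "selberg_kernel v = 7 / 5 * (1 - cos (pi * v)) / (pi\<^sup>2 * v\<^sup>2 * (4 - v\<^sup>2))"
proof -
  define P where "P y = 7 / 20 * (((1 - y / pi) * sin (y * v) / v - cos (y * v) / (pi * v\<^sup>2)) / pi
      + (- 2 * cos (2 * y) * cos (y * v) - v * sin (2 * y) * sin (y * v)) / (4 - v\<^sup>2) / (2 * pi\<^sup>2))" for y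
  have "((\<lambda>y. selberg_weight y * cos (y * v)) has_integral P pi - P 0) {0..pi}"
  proof (rule fundamental_theorem_of_calculus)
    fix y :: real
    have w: "4 - v\<^sup>2 \<noteq> 0" using assms by simp
    have first: "((\<lambda>y. (1 - y / pi) * sin (y * v) / v - cos (y * v) / (pi * v\<^sup>2)) has_real_derivative
        (1 - y / pi) * cos (y * v)) (at y)"
      using assms(1) by (auto intro!: derivative_eq_intros simp: field_simps power2_eq_square)
    have "((\<lambda>y. - 2 * cos (2 * y) * cos (y * v) - v * sin (2 * y) * sin (y * v)) has_real_derivative
        (4 - v\<^sup>2) * (sin (2 * y) * cos (y * v))) (at y)"
      by (auto intro!: derivative_eq_intros simp: algebra_simps power2_eq_square)
    from DERIV_cdivide[OF this, of "4 - v\<^sup>2"]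
    have second: "((\<lambda>y. (- 2 * cos (2 * y) * cos (y * v) - v * sin (2 * y) * sin (y * v)) / (4 - v\<^sup>2)) has_real_derivative
        sin (2 * y) * cos (y * v)) (at y)"
      using w by simp
    have "(P has_real_derivative 7 / 20 * ((1 - y / pi) * cos (y * v) / pi + sin (2 * y) * cos (y * v) / (2 * pi\<^sup>2))) (at y)"
      unfolding P_def by (intro DERIV_cmult DERIV_add DERIV_cdivide first second)
    also have "7 / 20 * ((1 - y / pi) * cos (y * v) / pi + sin (2 * y) * cos (y * v) / (2 * pi\<^sup>2)) = selberg_weight y * cos (y * v)"
      unfolding selberg_weight_def by (simp only: distrib_right times_divide_eq_left mult.assoc)
    finally have "(P has_real_derivative selberg_weight y * cos (y * v)) (at y)" .
    then show "(P has_vector_derivative selberg_weight y * cos (y * v)) (at y within {0..pi})"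
      by (simp add: has_real_derivative_iff_has_vector_derivative has_vector_derivative_at_within)
  qed simp
  then have "selberg_kernel v = P pi - P 0" by (simp add: selberg_kernel_def integral_unique)
  also have "\<dots> = 7 / 20 * (1 - cos (pi * v)) / pi\<^sup>2 * (1 / v\<^sup>2 + 1 / (4 - v\<^sup>2))"
    unfolding P_def by (simp add: power2_eq_square field_split_simps)
  also have "1 / v\<^sup>2 + 1 / (4 - v\<^sup>2) = 4 / (v\<^sup>2 * (4 - v\<^sup>2))"
    using assms by (simp add: field_simps)
  also have "7 / 20 * C / p * (4 / (a * b)) = 7 / 5 * C / (p * a * b)" for a b C p :: real
    by (simp add: divide_simps)
  finally show ?thesis .
qed

text \<open>For \<open>|v| < 2\<close> put \<open>x = |v| / 2\<close>. Then
  \<open>1 - cos (pi v)\<close> is \<open>2 sin(pi x)^2\<close>, and the bound for the sine brings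
  in \<open>(1 - x^2)^2\<close>, one factor of which cancels the denominator \<open>4 - v^2\<close>.
  For \<open>|v| > 2\<close> the closed form is nonpositive.\<close>

lemma kernel_le_aux:
  assumes "v \<noteq> 0" "v\<^sup>2 \<noteq> 4"
  shows "selberg_kernel v \<le> 7 / 160 * max 0 (4 - v\<^sup>2)"
proof (cases "v\<^sup>2 > 4")
  case True
  then have "7 / 5 * (1 - cos (pi * v)) / (pi\<^sup>2 * v\<^sup>2 * (4 - v\<^sup>2)) \<le> 0"
    by (intro divide_nonneg_nonpos mult_nonneg_nonpos) auto
  with True show ?thesis by (simp add: kernel_closed_form[OF assms])
next
  case False
  define x where "x = \<bar>v\<bar> / 2"
  have x: "v\<^sup>2 = 4 * x\<^sup>2" "0 < x" using assms by (auto simp: x_def power_divide)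
  have "x\<^sup>2 < 1" using False assms x(1) by simp
  then have "x < 1" using x(2) by (simp add: power_less_one_iff)
  have "cos (pi * v) = cos (2 * (pi * x))"
    by (simp add: x_def abs_if)
  also have "\<dots> = 1 - 2 * (sin (pi * x))\<^sup>2" by (simp add: cos_double sin_squared_eq)
  finally have cos_eq: "1 - cos (pi * v) = 2 * (sin (pi * x))\<^sup>2" by simp
  have "0 \<le> sin (pi * x)" using x \<open>x < 1\<close> by (intro sin_ge_zero) auto
  then have "(sin (pi * x))\<^sup>2 \<le> (pi * x * (1 - x\<^sup>2))\<^sup>2"
    using sin_pi_le[of x] x \<open>x < 1\<close> by (intro power_mono) auto
  then have "7 / 5 * (2 * (sin (pi * x))\<^sup>2) / (pi\<^sup>2 * (4 * x\<^sup>2) * (4 - 4 * x\<^sup>2))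
      \<le> 7 / 5 * (2 * (pi * x * (1 - x\<^sup>2))\<^sup>2) / (pi\<^sup>2 * (4 * x\<^sup>2) * (4 - 4 * x\<^sup>2))"
    using \<open>x\<^sup>2 < 1\<close> by (intro divide_right_mono) auto
  also have "\<dots> = 7 / 160 * (4 - 4 * x\<^sup>2)"
  proof -
    have "7 / 5 * (2 * (p * x * q)\<^sup>2) / (p\<^sup>2 * (4 * x\<^sup>2) * (4 * q)) = 7 / 160 * (4 * q)"
      if "p \<noteq> 0" "q \<noteq> 0" for p q :: real
      using that x(2) by (simp add: field_simps power2_eq_square)
    from this[of pi "1 - x\<^sup>2"] \<open>x\<^sup>2 < 1\<close> show ?thesis by (simp add: right_diff_distrib)
  qed
  finally show ?thesis unfolding kernel_closed_form[OF assms] cos_eq x(1) using \<open>x\<^sup>2 < 1\<close> by (simp add: max_def)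
qed

text \<open>The removable singularities \<open>0\<close>, \<open>2\<close>, \<open>-2\<close> of the
  closed form are filled in by continuity.\<close>

lemma kernel_le: "selberg_kernel v \<le> 7 / 160 * max 0 (4 - v\<^sup>2)"
proof (rule tendsto_le[of "at v"])
  show "(selberg_kernel \<longlongrightarrow> selberg_kernel v) (at v)" using continuous_kernel by (simp add: isCont_def)
  show "((\<lambda>v. 7 / 160 * max 0 (4 - v\<^sup>2)) \<longlongrightarrow> 7 / 160 * max 0 (4 - v\<^sup>2)) (at v)"
    by (intro tendsto_intros)
  show "\<forall>\<^sub>F w in at v. selberg_kernel w \<le> 7 / 160 * max 0 (4 - w\<^sup>2)"
    using eventually_neq_at_within[of 0 v] eventually_neq_at_within[of 2 v] eventually_neq_at_within[of "-2" v]
  proof eventually_elim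
    case (elim w)
    have "w\<^sup>2 \<noteq> 4"
    proof
      assume "w\<^sup>2 = 4"
      then have "(w - 2) * (w + 2) = 0" by (simp add: algebra_simps power2_eq_square)
      with elim show False by auto
    qed
    then show ?case using elim kernel_le_aux by simp
  qed
qed simp

section \<open>Comparison with a difference of exponentials\<close>

text \<open>This inequality limits the height of the minorant. The Tauberian constant is twice the
  factor \<open>7/40\<close>, so the factor has to exceed 1/6; \<open>7/40\<close> does, and still
  leaves room for crude numerical bounds.\<close>

lemma quadratic_le_exp_diff:
  fixes z :: real assumes "0 \<le> z"
  shows "7 / 40 * (z * (2 - z)) \<le> exp (-z) - exp (-2 * z)"
proof -
  define w where "w = exp (-z)"
  have w: "0 < w" "w \<le> 1" using assms by (auto simp: w_def)
  have eq: "exp (-z) - exp (-2 * z) = w * (1 - w)"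
    by (simp add: w_def algebra_simps flip: exp_add)
  \<comment> \<open>The convex function \<open>exp (-z)\<close> lies above its tangent at
    \<open>c\<close>; used with \<open>c = 1\<close> and \<open>c = 2\<close>.\<close>
  have tangent: "exp (-c) * (1 + c - z) \<le> w" for c
    using exp_ge_add_one_self[of "c - z"] by (simp add: w_def exp_diff exp_minus field_simps)
  have e1: "3676 / 10000 \<le> exp (-1 :: real)" "exp (-1 :: real) \<le> 2 / 5"
    using e_less_272 exp_lower_Taylor_quadratic[of 1] by (auto simp: exp_minus field_simps)
  have "exp (-2 :: real) = (exp (-1))\<^sup>2" by (simp add: power2_eq_square flip: exp_add)
  also have "\<dots> \<ge> (3676 / 10000)\<^sup>2" using e1 by (intro power_mono) auto
  finally have e2: "1351 / 10000 \<le> exp (-2 :: real)" by (simp add: power2_eq_square)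
  have e54: "exp (- (5 / 4) :: real) \<le> 3 / 10"
  proof -
    have "(13 / 8) \<le> exp (1 / 2 :: real)" using exp_lower_Taylor_quadratic[of "1 / 2"] by (simp add: power2_eq_square)
    moreover have "41 / 32 \<le> exp (1 / 4 :: real)" using exp_lower_Taylor_quadratic[of "1 / 4"] by (simp add: power2_eq_square)
    ultimately have "(13 / 8) * (13 / 8) * (41 / 32) \<le> exp (1 / 2) * exp (1 / 2) * exp (1 / 4 :: real)"
      by (intro mult_mono) auto
    also have "\<dots> = exp (5 / 4)" by (simp flip: exp_add)
    finally show ?thesis by (simp add: exp_minus field_simps)
  qed
  consider "z \<le> 1" | "1 \<le> z" "z \<le> 5 / 4" | "5 / 4 \<le> z" "z \<le> 2" | "2 \<le> z" by linarith
  then have "7 / 40 * (z * (2 - z)) \<le> w * (1 - w)"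
  proof cases
    case 1
    \<comment> \<open>Since the product of \<open>1 - z + z^2 / 2\<close> and
      \<open>1 + z + z^2 / 2\<close> is \<open>1 + z^4 / 4\<close>, the Taylor bound for
      \<open>exp z\<close> yields \<open>w <= 1 - z + z^2 / 2\<close>, so
      \<open>1 - w >= z (2 - z) / 2\<close>; the factor \<open>w\<close> is at least
      \<open>exp (-1) > 7/20\<close>.\<close>
    have "w * (1 + z + z\<^sup>2 / 2) \<le> w * exp z"
      using exp_lower_Taylor_quadratic[OF assms] w by (intro mult_left_mono) auto
    then have le1: "w * (1 + z + z\<^sup>2 / 2) \<le> 1" by (simp add: w_def exp_minus)
    have "(1 - z + z\<^sup>2 / 2) * (1 + z + z\<^sup>2 / 2) = 1 + z ^ 4 / 4"
      by (simp add: algebra_simps power2_eq_square power4_eq_xxxx)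
    moreover have "1 \<le> 1 + z ^ 4 / 4" by simp
    ultimately have "w * (1 + z + z\<^sup>2 / 2) \<le> (1 - z + z\<^sup>2 / 2) * (1 + z + z\<^sup>2 / 2)"
      using le1 by linarith
    then have "w \<le> 1 - z + z\<^sup>2 / 2"
      by (rule mult_right_le_imp_le) (use assms in \<open>simp add: add_pos_nonneg\<close>)
    then have a: "z * (2 - z) / 2 \<le> 1 - w" by (simp add: algebra_simps diff_divide_distrib power2_eq_square)
    have "exp (-1) \<le> w" using 1 by (simp add: w_def)
    then have b: "7 / 20 \<le> w" using e1 by linarith
    have "7 / 20 * (z * (2 - z) / 2) \<le> w * (1 - w)"
      using a b 1 assms by (intro mult_mono) auto
    then show ?thesis by simp
  next
    case 2
    have "3676 / 10000 * (2 - z) \<le> exp (-1) * (2 - z)" using e1 2 by (intro mult_right_mono) auto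
    also have "\<dots> \<le> w" using tangent[of 1] by simp
    finally have a: "3676 / 10000 * (2 - z) \<le> w" .
    have "w \<le> exp (-1)" using 2 by (simp add: w_def)
    then have b: "3 / 5 \<le> 1 - w" using e1 by linarith
    have "3676 / 10000 * (2 - z) * (3 / 5) \<le> w * (1 - w)"
      using a b 2 w by (intro mult_mono) auto
    moreover have "7 / 40 * (z * (2 - z)) \<le> 3676 / 10000 * (2 - z) * (3 / 5)"
      using mult_right_mono[of "7 / 40 * z" "3676 / 10000 * (3 / 5)" "2 - z"] 2 by (simp add: algebra_simps)
    ultimately show ?thesis by linarith
  next
    case 3
    have "1351 / 10000 * (3 - z) \<le> exp (-2) * (3 - z)" using e2 3 by (intro mult_right_mono) auto
    also have "\<dots> \<le> w" using tangent[of 2] by simp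
    finally have a: "1351 / 10000 * (3 - z) \<le> w" .
    have "w \<le> exp (- (5 / 4))" using 3 by (simp add: w_def)
    then have b: "7 / 10 \<le> 1 - w" using e54 by linarith
    have "1351 / 10000 * (3 - z) * (7 / 10) \<le> w * (1 - w)"
      using a b 3 w by (intro mult_mono) auto
    \<comment> \<open>The two sides below differ by a quadratic with leading coefficient
      \<open>7/40\<close>, whose vertex is close to \<open>127/100\<close>.\<close>
    moreover have "0 \<le> 7 / 40 * (z - 127 / 100)\<^sup>2" by simp
    then have "7 / 40 * (z * (2 - z)) \<le> 1351 / 10000 * (3 - z) * (7 / 10)"
      using 3 by (simp add: power2_eq_square algebra_simps add_divide_distrib diff_divide_distrib)
    ultimately show ?thesis by linarith
  next
    case 4
    then have "7 / 40 * (z * (2 - z)) \<le> 0" by (simp add: mult_nonneg_nonpos)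
    also have "0 \<le> w * (1 - w)" using w by simp
    finally show ?thesis .
  qed
  with eq show ?thesis by simp
qed

text \<open>With \<open>v = ln n - U\<close> and \<open>X = exp (U + 2)\<close> the right-hand side
  is \<open>sqrt (n / X) - n / X\<close>. The shift by 2 places the right end of the positive part
  of the minorant at \<open>n = X\<close>.\<close>

lemma kernel_le_exp_diff:
  assumes "v \<le> 2"
  shows "selberg_kernel v \<le> exp ((v - 2) / 2) - exp (v - 2)"
proof -
  define z where "z = (2 - v) / 2"
  have z: "0 \<le> z" using assms by (simp add: z_def)
  have "(v - 2) / 2 = - z" "v - 2 = -2 * z" by (simp_all add: z_def field_simps)
  then have exps: "exp ((v - 2) / 2) = exp (- z)" "exp (v - 2) = exp (-2 * z)" by simp_all
  have v: "v = 2 - 2 * z" by (simp add: z_def field_simps)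
  have "7 / 160 * max 0 (4 - v\<^sup>2) = max 0 (7 / 40 * (z * (2 - z)))"
    unfolding v by (simp add: max_def algebra_simps power2_eq_square)
  also have "\<dots> \<le> exp (-z) - exp (-2 * z)"
    using quadratic_le_exp_diff[OF z] z by simp
  finally show ?thesis using kernel_le[of v] unfolding exps by linarith
qed

lemma kernel_nonpos: "v \<ge> 2 \<Longrightarrow> selberg_kernel v \<le> 0"
  using kernel_le[of v] power_mono[of 2 v 2] by simp

subsection \<open>A Tauberian lower bound\<close>

lemma abs_one_minus_cos_le: "\<bar>1 - cos x\<bar> \<le> \<bar>x\<bar>" for x :: real
proof -
  have "1 - cos x = 2 * (sin (x / 2))\<^sup>2" using cos_double[of "x / 2"] by (simp add: sin_squared_eq)
  also have "\<dots> \<le> 2 * (\<bar>x / 2\<bar> * 1)"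
  proof -
    have "(sin (x / 2))\<^sup>2 = \<bar>sin (x / 2)\<bar> * \<bar>sin (x / 2)\<bar>" by (simp add: power2_eq_square)
    also have "\<dots> \<le> \<bar>x / 2\<bar> * 1" by (intro mult_mono abs_sin_x_le_abs_x) auto
    finally show ?thesis by simp
  qed
  finally show ?thesis by simp
qed

lemma integral_Poisson:
  assumes "\<epsilon> > 0" "Y \<ge> 0"
  shows "((\<lambda>y. \<epsilon> / (\<epsilon>\<^sup>2 + y\<^sup>2)) has_integral arctan (Y / \<epsilon>)) {0..Y}"
proof -
  have "((\<lambda>y. \<epsilon> / (\<epsilon>\<^sup>2 + y\<^sup>2)) has_integral arctan (Y / \<epsilon>) - arctan (0 / \<epsilon>)) {0..Y}"
  proof (rule fundamental_theorem_of_calculus[OF assms(2)])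
    fix y
    have "\<epsilon>\<^sup>2 + y\<^sup>2 > 0" using assms by (simp add: add_pos_nonneg)
    have "((\<lambda>y. arctan (y / \<epsilon>)) has_real_derivative inverse (1 + (y / \<epsilon>)\<^sup>2) * (1 / \<epsilon>)) (at y)"
      using assms by (auto intro!: derivative_eq_intros)
    also have "inverse (1 + (y / \<epsilon>)\<^sup>2) * (1 / \<epsilon>) = \<epsilon> / (\<epsilon>\<^sup>2 + y\<^sup>2)"
      using assms \<open>\<epsilon>\<^sup>2 + y\<^sup>2 > 0\<close> by (simp add: field_simps power2_eq_square)
    finally show "((\<lambda>y. arctan (y / \<epsilon>)) has_vector_derivative \<epsilon> / (\<epsilon>\<^sup>2 + y\<^sup>2)) (at y within {0..Y})"
      by (simp add: has_real_derivative_iff_has_vector_derivative has_vector_derivative_at_within)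
  qed
  then show ?thesis by simp
qed

lemma continuous_on_Icc_boundE:
  fixes f :: "real \<Rightarrow> real"
  assumes "continuous_on {a..b} f"
  obtains B where "\<And>y. y \<in> {a..b} \<Longrightarrow> \<bar>f y\<bar> \<le> B" "0 \<le> B"
proof -
  have "bounded (f ` {a..b})"
    by (rule compact_imp_bounded[OF compact_continuous_image[OF assms compact_Icc]])
  then obtain B where "0 < B" "\<forall>x\<in>f ` {a..b}. norm x \<le> B" unfolding bounded_pos by blast
  then show ?thesis by (intro that[of B]) auto
qed

text \<open>The contribution of the pole \<open>1 / (s - 1)\<close> to the smoothed sum, as the abscissa tends to \<open>1\<close>.\<close>

lemma pole_integral_tendsto:
  fixes e :: "nat \<Rightarrow> real"
  assumes e: "\<And>m. e m > 0" "e \<longlonglongrightarrow> 0" and U: "U \<ge> 0"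
  defines "pole \<equiv> \<lambda>\<epsilon> y. selberg_weight y * ((\<epsilon> * cos (y * U) + y * sin (y * U)) / (\<epsilon>\<^sup>2 + y\<^sup>2))"
  shows "(\<lambda>y. selberg_weight y * sin (y * U) / y) integrable_on {0..pi}"
    and "\<And>\<epsilon>. \<epsilon> > 0 \<Longrightarrow> pole \<epsilon> integrable_on {0..pi}"
    and "(\<lambda>m. integral {0..pi} (pole (e m))) \<longlonglongrightarrow> 7 / 40 + integral {0..pi} (\<lambda>y. selberg_weight y * sin (y * U) / y)"
proof -
  define W0 where "W0 = 7 / (20 * pi)"
  \<comment> \<open>As \<open>\<epsilon>\<close> tends to 0 the Poisson kernel concentrates at
    \<open>y = 0\<close> and has no integrable majorant. It is removed with the value
    \<open>W0\<close> of the weight at 0 and integrated exactly, with limit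
    \<open>W0 * pi / 2 = 7/40\<close>; the rest \<open>R\<close> is bounded uniformly.\<close>
  define R where "R \<epsilon> y = pole \<epsilon> y - W0 * (\<epsilon> / (\<epsilon>\<^sup>2 + y\<^sup>2))" for \<epsilon> y
  have W_eq: "selberg_weight y = W0 + y * weight_slope y" for y
    by (simp add: weight_eq W0_def)
  have pos: "\<epsilon>\<^sup>2 + y\<^sup>2 > 0" if "\<epsilon> > 0" for \<epsilon> y :: real
    using that by (simp add: add_pos_nonneg)
  show pole_int: "pole \<epsilon> integrable_on {0..pi}" if "\<epsilon> > 0" for \<epsilon>
    unfolding pole_def using pos[OF that]
    by (intro integrable_continuous_real continuous_intros continuous_on_weight) (auto simp: less_imp_neq[symmetric])
  have R_int: "R \<epsilon> integrable_on {0..pi}" if "\<epsilon> > 0" for \<epsilon>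
  proof -
    have "(R \<epsilon> has_integral integral {0..pi} (pole \<epsilon>) - W0 * arctan (pi / \<epsilon>)) {0..pi}"
      unfolding R_def using that
      by (intro has_integral_diff integrable_integral pole_int has_integral_mult_right integral_Poisson) auto
    then show ?thesis by blast
  qed
  obtain B where B: "\<And>y. y \<in> {0..pi} \<Longrightarrow> \<bar>selberg_weight y\<bar> \<le> B" and B0: "0 \<le> B"
    by (rule continuous_on_Icc_boundE[OF continuous_on_weight]) (rule that)
  obtain B' where B': "\<And>y. y \<in> {0..pi} \<Longrightarrow> \<bar>weight_slope y\<bar> \<le> B'" and B0': "0 \<le> B'"
    by (rule continuous_on_Icc_boundE[OF continuous_on_weight_slope]) (rule that)
  note BB = B0 B0'
  have R_eq: "R \<epsilon> y = (\<epsilon> * (selberg_weight y * cos (y * U) - W0) + y * (selberg_weight y * sin (y * U))) / (\<epsilon>\<^sup>2 + y\<^sup>2)" for \<epsilon> y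
    unfolding R_def pole_def by (simp add: algebra_simps add_divide_distrib diff_divide_distrib)
  \<comment> \<open>Both \<open>selberg_weight y * cos (y * U) - W0\<close> and
    \<open>selberg_weight y * sin (y * U)\<close> vanish to first order at 0. The numerator is
    therefore of size \<open>\<epsilon> * y + y^2\<close>, comparable with the denominator.\<close>
  have R_le: "\<bar>R \<epsilon> y\<bar> \<le> (\<bar>W0\<bar> * U + B') + B * U" if \<epsilon>: "\<epsilon> > 0" and y: "y \<in> {0..pi}" for \<epsilon> y
  proof -
    have "\<bar>selberg_weight y * cos (y * U) - W0\<bar> = \<bar>y * (weight_slope y * cos (y * U)) - W0 * (1 - cos (y * U))\<bar>"
      unfolding W_eq by (simp add: algebra_simps)
    also have "\<dots> \<le> \<bar>y\<bar> * (\<bar>weight_slope y\<bar> * \<bar>cos (y * U)\<bar>) + \<bar>W0\<bar> * \<bar>1 - cos (y * U)\<bar>"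
      unfolding abs_mult[symmetric] by (rule abs_triangle_ineq4)
    also have "\<dots> \<le> y * (B' * 1) + \<bar>W0\<bar> * \<bar>y * U\<bar>"
      using y B'[OF y] BB by (intro add_mono mult_mono mult_left_mono abs_one_minus_cos_le) auto
    also have "\<dots> = y * (\<bar>W0\<bar> * U + B')" using y U by (simp add: abs_mult algebra_simps)
    finally have a: "\<bar>selberg_weight y * cos (y * U) - W0\<bar> \<le> y * (\<bar>W0\<bar> * U + B')" .
    have "\<bar>selberg_weight y * sin (y * U)\<bar> \<le> B * \<bar>y * U\<bar>"
      unfolding abs_mult[of "selberg_weight y"] using B[OF y] BB by (intro mult_mono abs_sin_x_le_abs_x) auto
    then have b: "\<bar>selberg_weight y * sin (y * U)\<bar> \<le> y * (B * U)" using y U by (simp add: abs_mult algebra_simps)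
    have "\<bar>\<epsilon> * (selberg_weight y * cos (y * U) - W0) + y * (selberg_weight y * sin (y * U))\<bar>
        \<le> \<epsilon> * (y * (\<bar>W0\<bar> * U + B')) + y * (y * (B * U))"
      using a b \<epsilon> y by (intro order_trans[OF abs_triangle_ineq] add_mono) (auto simp: abs_mult intro!: mult_left_mono)
    also have "\<dots> = (\<epsilon> * y) * (\<bar>W0\<bar> * U + B') + y\<^sup>2 * (B * U)" by (simp add: power2_eq_square)
    also have "\<dots> \<le> (\<epsilon>\<^sup>2 + y\<^sup>2) * (\<bar>W0\<bar> * U + B') + (\<epsilon>\<^sup>2 + y\<^sup>2) * (B * U)"
    proof (intro add_mono mult_right_mono)
      have "0 \<le> (\<epsilon> - y)\<^sup>2" by simp
      then have "2 * (\<epsilon> * y) \<le> \<epsilon>\<^sup>2 + y\<^sup>2" by (simp add: power2_diff)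
      moreover have "0 \<le> \<epsilon> * y" using \<epsilon> y by simp
      ultimately show "\<epsilon> * y \<le> \<epsilon>\<^sup>2 + y\<^sup>2" by linarith
    qed (use BB U in auto)
    finally show ?thesis unfolding R_eq abs_divide using pos[OF \<epsilon>, of y]
      by (simp add: divide_le_eq algebra_simps)
  qed
  have R_lim: "(\<lambda>m. R (e m) y) \<longlonglongrightarrow> selberg_weight y * sin (y * U) / y" if "y \<in> {0..pi}" for y
  proof (cases "y = 0")
    case True
    have "R \<epsilon> 0 = 0" for \<epsilon> by (simp add: R_eq weight_eq W0_def)
    then show ?thesis using True by simp
  next
    case False
    have "(\<lambda>m. R (e m) y) \<longlonglongrightarrow> (0 * (selberg_weight y * cos (y * U) - W0) + y * (selberg_weight y * sin (y * U))) / (0\<^sup>2 + y\<^sup>2)"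
      unfolding R_eq using False by (intro tendsto_intros e) auto
    then show ?thesis using False by (simp add: power2_eq_square)
  qed
  note dom = dominated_convergence[where f = "\<lambda>m. R (e m)" and S = "{0..pi}" and h = "\<lambda>_. (\<bar>W0\<bar> * U + B') + B * U"
      and g = "\<lambda>y. selberg_weight y * sin (y * U) / y", OF R_int[OF e(1)] _ _ R_lim]
  show "(\<lambda>y. selberg_weight y * sin (y * U) / y) integrable_on {0..pi}"
    using R_le[OF e(1)] by (intro dom(1)) auto
  have lim1: "(\<lambda>m. integral {0..pi} (R (e m))) \<longlonglongrightarrow> integral {0..pi} (\<lambda>y. selberg_weight y * sin (y * U) / y)"
    using R_le[OF e(1)] by (intro dom(2)) auto
  have "filterlim (\<lambda>m. pi / e m) at_top sequentially"
    unfolding divide_inverse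
    by (intro filterlim_tendsto_pos_mult_at_top[OF tendsto_const pi_gt_zero] filterlim_inverse_at_top)
       (use e in auto)
  then have "(\<lambda>m. arctan (pi / e m)) \<longlonglongrightarrow> pi / 2"
    by (rule filterlim_compose[OF tendsto_arctan_at_top])
  then have lim2: "(\<lambda>m. W0 * arctan (pi / e m)) \<longlonglongrightarrow> W0 * (pi / 2)" by (intro tendsto_intros)
  have "integral {0..pi} (pole (e m)) = W0 * arctan (pi / e m) + integral {0..pi} (R (e m))" for m
  proof -
    have "((\<lambda>y. W0 * (e m / ((e m)\<^sup>2 + y\<^sup>2)) + R (e m) y) has_integral
        W0 * arctan (pi / e m) + integral {0..pi} (R (e m))) {0..pi}"
      using e(1) by (intro has_integral_add has_integral_mult_right integral_Poisson integrable_integral R_int) auto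
    then show ?thesis by (simp add: R_def integral_unique)
  qed
  with tendsto_add[OF lim2 lim1]
  show "(\<lambda>m. integral {0..pi} (pole (e m))) \<longlonglongrightarrow> 7 / 40 + integral {0..pi} (\<lambda>y. selberg_weight y * sin (y * U) / y)"
    by (simp add: W0_def)
qed

text \<open>Splitting the weight into its value at 0 and \<open>y\<close> times the slope leaves the
  sine integral, of limit \<open>pi / 2\<close>, and an oscillating integral that tends to 0; the
  phase \<open>- pi / 2\<close> turns its sine into a cosine.\<close>

lemma pole_limit_tendsto:
  "((\<lambda>U. integral {0..pi} (\<lambda>y. selberg_weight y * sin (y * U) / y)) \<longlongrightarrow> 7 / 40) at_top"
proof (rule Lim_transform_eventually)
  have "((\<lambda>U. 7 / (20 * pi) * integral {0..pi} (\<lambda>y. sin (U * y) / y)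
      + integral {0..pi} (\<lambda>y. weight_slope y * cos (U * y + - pi / 2))) \<longlongrightarrow> 7 / (20 * pi) * (pi / 2) + 0) at_top"
    by (intro tendsto_add tendsto_mult tendsto_const integral_sin_divide_tendsto Riemann_Lebesgue continuous_on_weight_slope) auto
  then show "((\<lambda>U. 7 / (20 * pi) * integral {0..pi} (\<lambda>y. sin (U * y) / y)
      + integral {0..pi} (\<lambda>y. weight_slope y * cos (U * y + - pi / 2))) \<longlongrightarrow> 7 / 40) at_top" by simp
  show "\<forall>\<^sub>F U in at_top. 7 / (20 * pi) * integral {0..pi} (\<lambda>y. sin (U * y) / y)
      + integral {0..pi} (\<lambda>y. weight_slope y * cos (U * y + - pi / 2)) = integral {0..pi} (\<lambda>y. selberg_weight y * sin (y * U) / y)"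
    using eventually_ge_at_top[of "0::real"]
  proof eventually_elim
    case (elim U)
    \<comment> \<open>Integrability of the limit integrand is a by-product of dominated convergence,
      for which some null sequence has to be named.\<close>
    have null: "(\<lambda>m. 1 / real (Suc m)) \<longlonglongrightarrow> 0" by real_asymp
    have shift: "cos (x + - pi / 2) = sin x" for x :: real by (simp add: cos_diff)
    have eq: "7 / (20 * pi) * (sin (U * y) / y) = selberg_weight y * sin (y * U) / y - weight_slope y * cos (U * y + - pi / 2)" for y
      unfolding shift by (cases "y = 0") (simp_all add: weight_eq field_simps weight_slope_def)
    have "integral {0..pi} (\<lambda>y. 7 / (20 * pi) * (sin (U * y) / y)) =
      integral {0..pi} (\<lambda>y. selberg_weight y * sin (y * U) / y) - integral {0..pi} (\<lambda>y. weight_slope y * cos (U * y + - pi / 2))"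
      unfolding eq
      by (intro integral_diff pole_integral_tendsto(1)[OF _ null elim] integrable_continuous_real
            continuous_intros continuous_on_weight_slope) auto
    then show ?case by (simp only: integral_mult_right)
  qed
qed

section \<open>Smoothed sums as integrals along the line\<close>

text \<open>The kernel is a cosine transform over \<open>{0..pi}\<close>. Moving the sum over
  \<open>n\<close> inside the integral turns it into the Dirichlet series on a segment of abscissa
  \<open>1 + \<epsilon>\<close>, where absolute convergence makes the series uniform in
  \<open>y\<close>.\<close>

lemma smoothed_sum_eq_integral:
  fixes a :: "nat \<Rightarrow> real"
  assumes conv: "abs_conv_right (\<lambda>n. of_real (a n))" and \<epsilon>: "\<epsilon> > 0"
  shows "(\<lambda>n. a n * real n powr (-1 - \<epsilon>) * selberg_kernel (ln (real n) - U)) sums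
     integral {0..pi} (\<lambda>y. selberg_weight y * Re (cis (y * U) * dseries (\<lambda>n. of_real (a n)) (Complex (1 + \<epsilon>) y)))"
proof -
  define f where "f n y = selberg_weight y * (a n * real n powr (-1 - \<epsilon>) * cos (y * (ln (real n) - U)))" for n y
  define g where "g y = selberg_weight y * Re (cis (y * U) * dseries (\<lambda>n. of_real (a n)) (Complex (1 + \<epsilon>) y))" for y
  have contf: "continuous_on {0..pi} (f n)" for n
    unfolding f_def by (intro continuous_intros continuous_on_weight)
  obtain B where B: "\<And>y. y \<in> {0..pi} \<Longrightarrow> \<bar>selberg_weight y\<bar> \<le> B" and B0: "0 \<le> B"
    by (rule continuous_on_Icc_boundE[OF continuous_on_weight]) (rule that)
  have f_sums: "(\<lambda>n. f n y) sums g y" for y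
  proof -
    have "Re (cis (y * U) * (of_real (a n) * of_nat n powr (- Complex (1 + \<epsilon>) y)))
        = a n * real n powr (-1 - \<epsilon>) * cos (y * (ln (real n) - U))" for n
    proof (cases "n = 0")
      case False
      then have "of_nat n powr (- Complex (1 + \<epsilon>) y) = exp (- Complex (1 + \<epsilon>) y * of_real (ln (real n)))"
        by (simp add: powr_def Ln_of_nat)
      also have "\<dots> = of_real (real n powr (-1 - \<epsilon>)) * cis (- (y * ln (real n)))"
        using False by (simp add: exp_eq_polar powr_def complex_eq_iff algebra_simps)
      finally have "cis (y * U) * (of_real (a n) * of_nat n powr (- Complex (1 + \<epsilon>) y))
          = of_real (a n * real n powr (-1 - \<epsilon>)) * (cis (y * U) * cis (- (y * ln (real n))))"
        by simp
      also have "cis (y * U) * cis (- (y * ln (real n))) = cis (- (y * (ln (real n) - U)))"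
        by (simp add: cis_mult algebra_simps)
      finally have eq: "cis (y * U) * (of_real (a n) * of_nat n powr (- Complex (1 + \<epsilon>) y))
          = of_real (a n * real n powr (-1 - \<epsilon>)) * cis (- (y * (ln (real n) - U)))" .
      show ?thesis unfolding eq by simp
    qed simp
    then have eq: "f n y = selberg_weight y * Re (cis (y * U) * (of_real (a n) * of_nat n powr (- Complex (1 + \<epsilon>) y)))" for n
      by (simp add: f_def)
    show ?thesis unfolding eq g_def using \<epsilon>
      by (intro sums_mult sums_Re dseries_sums conv) auto
  qed
  have "uniform_limit {0..pi} (\<lambda>N y. \<Sum>n<N. f n y) g sequentially"
  proof -
    have "uniform_limit {0..pi} (\<lambda>N y. \<Sum>n<N. f n y) (\<lambda>y. \<Sum>n. f n y) sequentially"
    proof (rule Weierstrass_m_test)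
      show "norm (f n y) \<le> B * (\<bar>a n\<bar> * real n powr (- (1 + \<epsilon>)))" if "y \<in> {0..pi}" for n y
      proof -
        have le: "\<bar>a n * real n powr (-1 - \<epsilon>)\<bar> * \<bar>cos (y * (ln (real n) - U))\<bar> \<le> (\<bar>a n\<bar> * real n powr (-1 - \<epsilon>)) * 1"
          by (intro mult_mono) (auto simp: abs_mult)
        have "\<bar>selberg_weight y\<bar> * (\<bar>a n * real n powr (-1 - \<epsilon>)\<bar> * \<bar>cos (y * (ln (real n) - U))\<bar>)
            \<le> B * ((\<bar>a n\<bar> * real n powr (-1 - \<epsilon>)) * 1)"
          by (rule mult_mono[OF B[OF that] le B0]) simp
        then show ?thesis by (simp add: f_def abs_mult)
      qed
      have "summable (\<lambda>n. norm (complex_of_real (a n)) * real n powr (- (1 + \<epsilon>)))"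
        using conv \<epsilon> unfolding abs_conv_right_def by (metis less_add_same_cancel1)
      then show "summable (\<lambda>n. B * (\<bar>a n\<bar> * real n powr (- (1 + \<epsilon>))))"
        by (intro summable_mult) simp
    qed
    moreover have "(\<Sum>n. f n y) = g y" for y using f_sums[of y] by (simp add: sums_iff)
    ultimately show ?thesis by simp
  qed
  then obtain I J where IJ: "\<And>N. ((\<lambda>y. \<Sum>n<N. f n y) has_integral I N) {0..pi}" "(g has_integral J) {0..pi}"
    "(I \<longlongrightarrow> J) sequentially"
    by (rule uniform_limit_integral) (auto intro!: continuous_on_sum contf)
  have "((\<lambda>y. \<Sum>n<N. f n y) has_integral (\<Sum>n<N. a n * real n powr (-1 - \<epsilon>) * selberg_kernel (ln (real n) - U))) {0..pi}" for N
  proof (intro has_integral_sum)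
    fix n
    have "((\<lambda>y. a n * real n powr (-1 - \<epsilon>) * (selberg_weight y * cos (y * (ln (real n) - U)))) has_integral
        a n * real n powr (-1 - \<epsilon>) * selberg_kernel (ln (real n) - U)) {0..pi}"
      unfolding selberg_kernel_def
      by (intro has_integral_mult_right integrable_integral integrable_continuous_real continuous_intros continuous_on_weight)
    then show "(f n has_integral a n * real n powr (-1 - \<epsilon>) * selberg_kernel (ln (real n) - U)) {0..pi}"
      by (simp add: f_def[abs_def] mult_ac)
  qed auto
  then have "I = (\<lambda>N. \<Sum>n<N. a n * real n powr (-1 - \<epsilon>) * selberg_kernel (ln (real n) - U))"
    using IJ(1) has_integral_unique by blast
  with IJ(3) have "(\<lambda>n. a n * real n powr (-1 - \<epsilon>) * selberg_kernel (ln (real n) - U)) sums J"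
    by (simp add: sums_def)
  moreover have "J = integral {0..pi} g" using IJ(2) by (simp add: integral_unique)
  ultimately show ?thesis by (simp add: g_def[abs_def])
qed

lemma continuous_on_Complex_right: "continuous_on A (\<lambda>y. Complex x y)"
  unfolding Complex_eq by (intro continuous_intros)

text \<open>Dominated convergence: \<open>h\<close> is bounded on the compact rectangle
  \<open>1 <= Re s <= 2\<close>, \<open>0 <= Im s <= pi\<close>. Compactness is the benefit of a
  bounded band.\<close>

lemma regular_integral_tendsto:
  fixes e :: "nat \<Rightarrow> real" and h :: "complex \<Rightarrow> complex" and U :: real
  assumes e: "\<And>m. 0 < e m" "\<And>m. e m \<le> 1" "e \<longlonglongrightarrow> 0"
    and h: "continuous_on {s. Re s \<ge> 1} h"
  defines "q \<equiv> \<lambda>\<epsilon> y. selberg_weight y * Re (cis (y * U) * h (Complex (1 + \<epsilon>) y))"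
  shows "\<And>\<epsilon>. \<epsilon> \<ge> 0 \<Longrightarrow> q \<epsilon> integrable_on {0..pi}"
    and "(\<lambda>m. integral {0..pi} (q (e m))) \<longlonglongrightarrow> integral {0..pi} (q 0)"
proof -
  have cont_h: "continuous_on {0..pi} (\<lambda>y. h (Complex (1 + \<epsilon>) y))" if "\<epsilon> \<ge> 0" for \<epsilon>
    by (rule continuous_on_compose2[OF h continuous_on_Complex_right]) (use that in auto)
  show int: "q \<epsilon> integrable_on {0..pi}" if "\<epsilon> \<ge> 0" for \<epsilon>
    unfolding q_def
    by (intro integrable_continuous_real continuous_intros continuous_on_weight cont_h that)
  obtain B where B: "\<And>y. y \<in> {0..pi} \<Longrightarrow> \<bar>selberg_weight y\<bar> \<le> B" and B0: "0 \<le> B"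
    by (rule continuous_on_Icc_boundE[OF continuous_on_weight]) (rule that)
  have "compact (h ` cbox (Complex 1 0) (Complex 2 pi))"
    by (rule compact_continuous_image[OF continuous_on_subset[OF h]]) (auto simp: in_cbox_complex_iff)
  then obtain H where H: "H > 0" "\<forall>z\<in>h ` cbox (Complex 1 0) (Complex 2 pi). norm z \<le> H"
    using compact_imp_bounded bounded_pos by metis
  show "(\<lambda>m. integral {0..pi} (q (e m))) \<longlonglongrightarrow> integral {0..pi} (q 0)"
  proof (rule dominated_convergence(2))
    show "q (e m) integrable_on {0..pi}" for m using e(1) by (intro int less_imp_le)
    show "(\<lambda>_. B * H) integrable_on {0..pi}" by (rule integrable_const_ivl)
    fix y assume y: "y \<in> {0..pi}"
    show "norm (q (e m) y) \<le> B * H" for m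
    proof -
      have "\<bar>Re (cis (y * U) * h (Complex (1 + e m) y))\<bar> \<le> norm (cis (y * U) * h (Complex (1 + e m) y))"
        by (rule abs_Re_le_cmod)
      also have "\<dots> = norm (h (Complex (1 + e m) y))" by (simp add: norm_mult)
      also have "\<dots> \<le> H"
        using H(2) e(1)[of m] e(2)[of m] y by (auto simp: in_cbox_complex_iff)
      finally have "\<bar>Re (cis (y * U) * h (Complex (1 + e m) y))\<bar> \<le> H" .
      from mult_mono[OF B[OF y] this B0] show ?thesis by (simp add: q_def abs_mult)
    qed
    have "(\<lambda>m. Complex (1 + e m) y) \<longlonglongrightarrow> Complex (1 + 0) y"
      by (intro tendsto_Complex tendsto_intros e)
    then have "(\<lambda>m. h (Complex (1 + e m) y)) \<longlonglongrightarrow> h (Complex 1 y)"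
      using e(1) by (intro continuous_on_tendsto_compose[OF h]) (auto simp: less_imp_le)
    then show "(\<lambda>m. q (e m) y) \<longlonglongrightarrow> q 0 y"
      unfolding q_def by (intro tendsto_intros) simp
  qed
qed

text \<open>Real and imaginary part of \<open>h\<close> on the segment \<open>Complex 1 y\<close>
  are treated separately, with phases 0 and \<open>pi / 2\<close>.\<close>

lemma regular_limit_tendsto:
  fixes h :: "complex \<Rightarrow> complex"
  assumes h: "continuous_on {s. Re s \<ge> 1} h"
  shows "((\<lambda>U. integral {0..pi} (\<lambda>y. selberg_weight y * Re (cis (y * U) * h (Complex (1 + 0) y)))) \<longlongrightarrow> 0) at_top"
proof -
  have cont_h: "continuous_on {0..pi} (\<lambda>y. h (Complex 1 y))"
    by (rule continuous_on_compose2[OF h continuous_on_Complex_right]) auto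
  have cont: "continuous_on {0..pi} (\<lambda>y. selberg_weight y * Re (h (Complex 1 y)))"
    "continuous_on {0..pi} (\<lambda>y. selberg_weight y * Im (h (Complex 1 y)))"
    by (intro continuous_intros continuous_on_weight cont_h)+
  have shift: "cos (x + pi / 2) = - sin x" for x :: real by (simp add: cos_add)
  have "((\<lambda>U. integral {0..pi} (\<lambda>y. selberg_weight y * Re (h (Complex 1 y)) * cos (U * y + 0))
      + integral {0..pi} (\<lambda>y. selberg_weight y * Im (h (Complex 1 y)) * cos (U * y + pi / 2))) \<longlongrightarrow> 0 + 0) at_top"
    by (intro tendsto_add Riemann_Lebesgue cont) auto
  moreover have "integral {0..pi} (\<lambda>y. selberg_weight y * Re (h (Complex 1 y)) * cos (U * y + 0))
      + integral {0..pi} (\<lambda>y. selberg_weight y * Im (h (Complex 1 y)) * cos (U * y + pi / 2))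
      = integral {0..pi} (\<lambda>y. selberg_weight y * Re (cis (y * U) * h (Complex (1 + 0) y)))" for U
    unfolding shift
    by (subst integral_add[symmetric])
       (auto intro!: integrable_continuous_real continuous_intros cont_h continuous_on_weight simp: algebra_simps)
  ultimately show ?thesis by simp
qed

text \<open>Comparing the kernel with a weight cut off at \<open>exp (U + 2)\<close> leaves a finite
  sum, in which \<open>\<epsilon>\<close> can tend to 0 term by term; no convergence of the series
  at abscissa 1 is involved.\<close>

lemma smoothed_lower_bound:
  fixes a :: "nat \<Rightarrow> real" and h :: "complex \<Rightarrow> complex"
  assumes conv: "abs_conv_right (\<lambda>n. of_real (a n))" and nonneg: "\<And>n. 0 \<le> a n"
    and h: "continuous_on {s. Re s \<ge> 1} h"
    and eq: "\<And>s. Re s > 1 \<Longrightarrow> dseries (\<lambda>n. of_real (a n)) s = 1 / (s - 1) + h s"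
    and U: "U \<ge> 0"
  shows "7 / 40 + integral {0..pi} (\<lambda>y. selberg_weight y * sin (y * U) / y)
      + integral {0..pi} (\<lambda>y. selberg_weight y * Re (cis (y * U) * h (Complex (1 + 0) y)))
    \<le> (\<Sum>n\<in>{1..nat \<lfloor>exp (U + 2)\<rfloor>}. a n / real n * (exp ((ln (real n) - U - 2) / 2) - exp (ln (real n) - U - 2)))"
proof -
  define e where "e m = 1 / real (Suc m)" for m
  have e: "\<And>m. 0 < e m" "\<And>m. e m \<le> 1" "e \<longlonglongrightarrow> 0"
    unfolding e_def by (auto, real_asymp)
  define G where "G n = exp ((ln (real n) - U - 2) / 2) - exp (ln (real n) - U - 2)" for n
  define A where "A = {1..nat \<lfloor>exp (U + 2)\<rfloor>}"
  define pole where "pole \<epsilon> y = selberg_weight y * ((\<epsilon> * cos (y * U) + y * sin (y * U)) / (\<epsilon>\<^sup>2 + y\<^sup>2))" for \<epsilon> y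
  define q where "q \<epsilon> y = selberg_weight y * Re (cis (y * U) * h (Complex (1 + \<epsilon>) y))" for \<epsilon> y
  have le: "integral {0..pi} (pole \<epsilon>) + integral {0..pi} (q \<epsilon>) \<le> (\<Sum>n\<in>A. a n * real n powr (-1 - \<epsilon>) * G n)"
    if \<epsilon>: "\<epsilon> > 0" for \<epsilon>
  proof -
    have "selberg_weight y * Re (cis (y * U) * dseries (\<lambda>n. of_real (a n)) (Complex (1 + \<epsilon>) y)) = pole \<epsilon> y + q \<epsilon> y" for y
    proof -
      have "Complex (1 + \<epsilon>) y - 1 = Complex \<epsilon> y" by (simp add: complex_eq_iff)
      then have "dseries (\<lambda>n. of_real (a n)) (Complex (1 + \<epsilon>) y) = 1 / Complex \<epsilon> y + h (Complex (1 + \<epsilon>) y)"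
        using eq[of "Complex (1 + \<epsilon>) y"] \<epsilon> by simp
      then have "Re (cis (y * U) * dseries (\<lambda>n. of_real (a n)) (Complex (1 + \<epsilon>) y))
          = Re (cis (y * U) / Complex \<epsilon> y) + Re (cis (y * U) * h (Complex (1 + \<epsilon>) y))"
        by (simp only: distrib_left plus_complex.sel times_divide_eq_right mult_1_right)
      also have "Re (cis (y * U) / Complex \<epsilon> y) = (\<epsilon> * cos (y * U) + y * sin (y * U)) / (\<epsilon>\<^sup>2 + y\<^sup>2)"
        by (simp add: Re_divide mult.commute)
      finally show ?thesis by (simp only: pole_def q_def distrib_left)
    qed
    with smoothed_sum_eq_integral[OF conv \<epsilon>, of U]
    have "(\<lambda>n. a n * real n powr (-1 - \<epsilon>) * selberg_kernel (ln (real n) - U)) sums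
        integral {0..pi} (\<lambda>y. pole \<epsilon> y + q \<epsilon> y)" by (simp only:)
    also have "integral {0..pi} (\<lambda>y. pole \<epsilon> y + q \<epsilon> y) = integral {0..pi} (pole \<epsilon>) + integral {0..pi} (q \<epsilon>)"
      unfolding pole_def q_def
      by (intro integral_add pole_integral_tendsto(2)[OF e(1,3) U \<epsilon>] regular_integral_tendsto(1)[OF e h])
         (use \<epsilon> in auto)
    finally have kernel_sums: "(\<lambda>n. a n * real n powr (-1 - \<epsilon>) * selberg_kernel (ln (real n) - U)) sums
        (integral {0..pi} (pole \<epsilon>) + integral {0..pi} (q \<epsilon>))" .
    have "(\<lambda>n. if n \<in> A then a n * real n powr (-1 - \<epsilon>) * G n else 0) sums (\<Sum>n\<in>A. a n * real n powr (-1 - \<epsilon>) * G n)"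
      by (rule sums_If_finite_set) (simp add: A_def)
    \<comment> \<open>Nonnegative coefficients preserve the comparison: below the cutoff the kernel
      is at most \<open>G n\<close>, above it the kernel is nonpositive.\<close>
    moreover have termwise: "a n * real n powr (-1 - \<epsilon>) * selberg_kernel (ln (real n) - U)
        \<le> (if n \<in> A then a n * real n powr (-1 - \<epsilon>) * G n else 0)" for n
    proof -
      consider "n = 0" | "n \<in> A" | "n > 0" "n \<notin> A" by auto
      then show ?thesis
      proof cases
        case 2
        then have "real n \<le> exp (U + 2)" "n > 0"
          unfolding A_def by (auto simp: le_nat_iff le_floor_iff)
        then have "ln (real n) \<le> U + 2" by (metis ln_exp ln_le_cancel_iff exp_gt_zero of_nat_0_less_iff)
        then have "selberg_kernel (ln (real n) - U) \<le> G n"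
          using kernel_le_exp_diff[of "ln (real n) - U"] by (simp add: G_def)
        then show ?thesis using 2 nonneg by (simp add: mult_left_mono)
      next
        case 3
        then have "exp (U + 2) < real n"
          unfolding A_def by (auto simp: le_nat_iff le_floor_iff not_le)
        then have "U + 2 \<le> ln (real n)"
          using 3 by (metis less_imp_le ln_exp ln_le_cancel_iff exp_gt_zero of_nat_0_less_iff)
        then show ?thesis using 3 nonneg kernel_nonpos[of "ln (real n) - U"]
          by (simp add: mult_nonneg_nonpos)
      qed simp
    qed
    ultimately show ?thesis by (intro sums_le[OF termwise kernel_sums])
  qed
  have lhs: "(\<lambda>m. integral {0..pi} (pole (e m)) + integral {0..pi} (q (e m))) \<longlonglongrightarrow>
      7 / 40 + integral {0..pi} (\<lambda>y. selberg_weight y * sin (y * U) / y) + integral {0..pi} (q 0)"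
    unfolding pole_def q_def
    by (intro tendsto_add pole_integral_tendsto(3)[OF e(1,3) U] regular_integral_tendsto(2)[OF e h])
  have rhs: "(\<lambda>m. \<Sum>n\<in>A. a n * real n powr (-1 - e m) * G n) \<longlonglongrightarrow> (\<Sum>n\<in>A. a n * real n powr (-1 - 0) * G n)"
    by (intro tendsto_intros e) (auto simp: A_def)
  have "7 / 40 + integral {0..pi} (\<lambda>y. selberg_weight y * sin (y * U) / y) + integral {0..pi} (q 0)
      \<le> (\<Sum>n\<in>A. a n * real n powr (-1 - 0) * G n)"
    by (rule LIMSEQ_le[OF lhs rhs]) (use le e(1) in auto)
  also have "\<dots> = (\<Sum>n\<in>A. a n / real n * G n)"
    by (intro sum.cong refl) (auto simp: A_def powr_minus_divide)
  finally show ?thesis unfolding A_def G_def q_def .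
qed

text \<open>The value \<open>7/20\<close> is that of the band-limited minorant; the true asymptotic constant would be \<open>1\<close>.\<close>

theorem Tauberian_lower_bound:
  fixes a :: "nat \<Rightarrow> real" and h :: "complex \<Rightarrow> complex"
  assumes conv: "abs_conv_right (\<lambda>n. of_real (a n))" and nonneg: "\<And>n. 0 \<le> a n"
    and h: "continuous_on {s. Re s \<ge> 1} h"
    and eq: "\<And>s. Re s > 1 \<Longrightarrow> dseries (\<lambda>n. of_real (a n)) s = 1 / (s - 1) + h s"
    and c: "c < 7 / 20"
  shows "\<forall>\<^sub>F X in at_top. c * sqrt X \<le> (\<Sum>n\<in>{1..nat \<lfloor>X\<rfloor>}. a n * (1 / sqrt (real n) - 1 / sqrt X))"
proof -
  define \<Phi> where "\<Phi> U = 7 / 40 + integral {0..pi} (\<lambda>y. selberg_weight y * sin (y * U) / y)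
      + integral {0..pi} (\<lambda>y. selberg_weight y * Re (cis (y * U) * h (Complex (1 + 0) y)))" for U
  \<comment> \<open>One \<open>7/40\<close> is the mass of the Poisson kernel, the other the limit
    of the sine integral; each is the weight at 0 times \<open>pi / 2\<close>.\<close>
  have "(\<Phi> \<longlongrightarrow> 7 / 40 + 7 / 40 + 0) at_top"
    unfolding \<Phi>_def[abs_def] by (intro tendsto_add tendsto_const pole_limit_tendsto regular_limit_tendsto h)
  then have "\<forall>\<^sub>F U in at_top. c < \<Phi> U" using c by (intro order_tendstoD) auto
  moreover have "filterlim (\<lambda>X::real. ln X - 2) at_top at_top" by real_asymp
  ultimately have "\<forall>\<^sub>F X in at_top. c < \<Phi> (ln X - 2)" by (rule eventually_compose_filterlim)
  then show ?thesis
    using eventually_ge_at_top[of "exp 2"]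
  proof eventually_elim
    case (elim X)
    have X: "X > 0" using elim(2) exp_gt_zero[of "2::real"] by linarith
    then have "2 \<le> ln X" using elim(2) by (metis ln_exp ln_le_cancel_iff exp_gt_zero)
    then have "c \<le> (\<Sum>n\<in>{1..nat \<lfloor>exp (ln X - 2 + 2)\<rfloor>}. a n / real n *
        (exp ((ln (real n) - (ln X - 2) - 2) / 2) - exp (ln (real n) - (ln X - 2) - 2)))"
      using smoothed_lower_bound[OF conv nonneg h eq, of "ln X - 2"] elim(1) by (simp add: \<Phi>_def)
    also have "\<dots> = (\<Sum>n\<in>{1..nat \<lfloor>X\<rfloor>}. a n * (1 / sqrt (real n) - 1 / sqrt X)) / sqrt X"
      unfolding sum_divide_distrib
    proof (rule sum.cong)
      show "{1..nat \<lfloor>exp (ln X - 2 + 2)\<rfloor>} = {1..nat \<lfloor>X\<rfloor>}" using X by simp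
      fix n assume "n \<in> {1..nat \<lfloor>X\<rfloor>}"
      then have n: "real n > 0" by simp
      have "exp ((ln (real n) - (ln X - 2) - 2) / 2) = sqrt (real n) / sqrt X"
        using n X by (simp add: exp_diff diff_divide_distrib flip: ln_sqrt)
      moreover have "exp (ln (real n) - (ln X - 2) - 2) = real n / X"
        using n X by (simp add: exp_diff)
      moreover have "a n / x\<^sup>2 * (x / y - x\<^sup>2 / y\<^sup>2) = a n * (1 / x - 1 / y) / y"
        if "x > 0" "y > 0" for x y :: real
        using that by (simp add: field_simps power2_eq_square)
      from this[of "sqrt (real n)" "sqrt X"]
      have "a n / real n * (sqrt (real n) / sqrt X - real n / X) = a n * (1 / sqrt (real n) - 1 / sqrt X) / sqrt X"
        using n X by simp
      ultimately show "a n / real n * (exp ((ln (real n) - (ln X - 2) - 2) / 2) - exp (ln (real n) - (ln X - 2) - 2))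
          = a n * (1 / sqrt (real n) - 1 / sqrt X) / sqrt X" by simp
    qed
    finally show ?case using X by (simp add: pos_le_divide_eq)
  qed
qed

subsection \<open>Sums over power residues\<close>

definition cosp :: "nat \<Rightarrow> int \<Rightarrow> real" where
  "cosp p n = cos (2 * pi * real_of_int n / real p)"

text \<open>The term \<open>u = 0\<close> is included. For odd \<open>k\<close>, replacing
  \<open>u\<close> by \<open>-u\<close> shows that the corresponding complex exponential sum is
  real, so cosines lose nothing.\<close>

definition power_cos_sum :: "nat \<Rightarrow> nat \<Rightarrow> nat \<Rightarrow> real" where
  "power_cos_sum k p a = (\<Sum>u<p. cosp p (int a * int u ^ k))"

lemma cosp_cong:
  assumes "p > 0" "[m = n] (mod int p)"
  shows "cosp p m = cosp p n"
proof -
  obtain j where "m = n + int p * j" using cong_sym[OF assms(2)] unfolding cong_iff_lin by blast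
  then have "2 * pi * real_of_int m / real p = 2 * pi * real_of_int n / real p + of_int j * (2 * pi)"
    using assms(1) by (simp add: field_simps)
  then show ?thesis by (simp add: cosp_def cos_add cos_int_2pin sin_int_2pin mult.commute[of "of_int j"])
qed

lemma cosp_zero: "p > 0 \<Longrightarrow> int p dvd n \<Longrightarrow> cosp p n = 1"
  using cosp_cong[of p n 0] by (simp add: cong_0_iff cosp_def)

lemma sum_cosp:
  assumes "p > 0"
  shows "(\<Sum>a<p. cosp p (int a * n)) = (if int p dvd n then real p else 0)"
proof (cases "int p dvd n")
  case True
  then have "cosp p (int a * n) = 1" for a using assms by (simp add: cosp_zero)
  then show ?thesis using True by simp
next
  case False
  define z where "z = cis (2 * pi * real_of_int n / real p)"
  have zpow: "z ^ a = cis (2 * pi * real_of_int (int a * n) / real p)" for a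
    unfolding z_def Complex.DeMoivre by (simp add: mult_ac)
  have "2 * pi * real_of_int (int p * n) / real p = 2 * pi * real_of_int n" using assms by simp
  then have zp: "z ^ p = 1"
    by (simp only: zpow complex_eq_iff cis.sel cos_int_2pin sin_int_2pin one_complex.sel simp_thms)
  have "z \<noteq> 1"
  proof
    assume "z = 1"
    then have "cos (2 * pi * real_of_int n / real p) = 1" by (simp add: z_def complex_eq_iff)
    then obtain j :: int where "2 * pi * real_of_int n / real p = of_int j * 2 * pi"
      by (auto simp: cos_one_2pi_int)
    then have "real_of_int n = real_of_int (j * int p)" using assms by (simp add: field_simps)
    then have "n = j * int p" by (simp only: of_int_eq_iff)
    with False show False by simp
  qed
  then have "(\<Sum>a<p. z ^ a) = 0" using zp by (simp add: geometric_sum)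
  then have "Re (\<Sum>a<p. z ^ a) = 0" by simp
  then show ?thesis using False by (simp add: zpow cosp_def)
qed

lemma cosp_mult: "cosp p m * cosp p n = (cosp p (m - n) + cosp p (m + n)) / 2"
  by (simp add: cosp_def cos_times_cos diff_divide_distrib add_divide_distrib algebra_simps)

lemma sum_power_cos_sum:
  assumes "prime p" "k > 0"
  shows "(\<Sum>a<p. power_cos_sum k p a) = real p"
proof -
  have p: "p > 0" using assms by (simp add: prime_gt_0_nat)
  have "(\<Sum>a<p. power_cos_sum k p a) = (\<Sum>u<p. \<Sum>a<p. cosp p (int a * int u ^ k))"
    unfolding power_cos_sum_def by (rule sum.swap)
  also have "\<dots> = (\<Sum>u<p. if u = 0 then real p else 0)"
  proof (intro sum.cong refl)
    fix u assume u: "u \<in> {..<p}"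
    have "int p dvd int u ^ k \<longleftrightarrow> p dvd u ^ k" by (simp flip: of_nat_power)
    also have "\<dots> \<longleftrightarrow> p dvd u" using assms by (simp add: prime_dvd_power_iff)
    also have "\<dots> \<longleftrightarrow> u = 0" using u by (auto dest: dvd_imp_le)
    finally show "(\<Sum>a<p. cosp p (int a * int u ^ k)) = (if u = 0 then real p else 0)"
      by (simp add: sum_cosp p)
  qed
  also have "\<dots> = real p" using p by simp
  finally show ?thesis .
qed

text \<open>Product-to-sum splits the square into the frequencies \<open>u^k - v^k\<close> and
  \<open>u^k + v^k\<close>; summing over \<open>a\<close> counts where these vanish modulo
  \<open>p\<close>.\<close>

lemma sum_power_cos_sum_squared:
  assumes p: "p > 0"
  shows "(\<Sum>a<p. (power_cos_sum k p a)\<^sup>2) = real p / 2 *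
    (real (card {(u, v). u < p \<and> v < p \<and> int p dvd int u ^ k - int v ^ k})
     + real (card {(u, v). u < p \<and> v < p \<and> int p dvd int u ^ k + int v ^ k}))"
proof -
  have count: "(\<Sum>u<p. \<Sum>v<p. \<Sum>a<p. cosp p (int a * f u v)) = real p * real (card {(u, v). u < p \<and> v < p \<and> int p dvd f u v})"
    for f :: "nat \<Rightarrow> nat \<Rightarrow> int"
  proof -
    have "(\<Sum>u<p. \<Sum>v<p. \<Sum>a<p. cosp p (int a * f u v)) = (\<Sum>(u, v)\<in>{..<p} \<times> {..<p}. if int p dvd f u v then real p else 0)"
      by (simp add: sum_cosp p sum.cartesian_product)
    also have "\<dots> = (\<Sum>(u, v)\<in>{(u, v). u < p \<and> v < p \<and> int p dvd f u v}. real p)"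
      by (rule sum.mono_neutral_cong_right) (auto split: if_splits)
    finally show ?thesis by (simp add: case_prod_unfold mult.commute)
  qed
  have "(\<Sum>a<p. (power_cos_sum k p a)\<^sup>2) = (\<Sum>a<p. \<Sum>u<p. \<Sum>v<p.
      (cosp p (int a * (int u ^ k - int v ^ k)) + cosp p (int a * (int u ^ k + int v ^ k))) / 2)"
    by (simp only: power_cos_sum_def power2_eq_square sum_product cosp_mult right_diff_distrib distrib_left)
  also have "\<dots> = (\<Sum>u<p. \<Sum>v<p. \<Sum>a<p.
      (cosp p (int a * (int u ^ k - int v ^ k)) + cosp p (int a * (int u ^ k + int v ^ k))) / 2)"
    by (rule trans[OF sum.swap], rule sum.cong[OF refl], rule sum.swap)
  also have "\<dots> = ((\<Sum>u<p. \<Sum>v<p. \<Sum>a<p. cosp p (int a * (int u ^ k - int v ^ k)))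
      + (\<Sum>u<p. \<Sum>v<p. \<Sum>a<p. cosp p (int a * (int u ^ k + int v ^ k)))) / 2"
    by (simp add: sum.distrib sum_divide_distrib add_divide_distrib)
  finally show ?thesis unfolding count by (simp add: ring_distribs add_divide_distrib)
qed

text \<open>Each \<open>u\<close> with \<open>1 <= u < p\<close> has the \<open>N\<close> partners
  \<open>v = u * w t\<close>, and \<open>(0, 0)\<close> is one more pair. Both signs
  \<open>s = 1\<close> and \<open>s = -1\<close> are used, one for each frequency in the second
  moment.\<close>

lemma card_power_pairs_ge:
  fixes w :: "nat \<Rightarrow> int" and s :: int
  assumes p: "prime p" and w: "\<And>t. t < N \<Longrightarrow> [w t ^ k = s] (mod int p)"
    and inj: "\<And>t t'. t < N \<Longrightarrow> t' < N \<Longrightarrow> [w t = w t'] (mod int p) \<Longrightarrow> t = t'"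
    and "k > 0" and coprime: "\<And>t. t < N \<Longrightarrow> coprime (w t) (int p)"
  shows "1 + (p - 1) * N \<le> card {(u, v). u < p \<and> v < p \<and> int p dvd s * int u ^ k - int v ^ k}" (is "_ \<le> card ?E")
proof -
  let ?f = "\<lambda>(u, t). (u, nat (int u * w t mod int p))"
  have p0: "p > 0" using p by (simp add: prime_gt_0_nat)
  have fin: "finite ?E" by (rule finite_subset[of _ "{..<p} \<times> {..<p}"]) auto
  have "inj_on ?f ({1..<p} \<times> {..<N})"
  proof (rule inj_onI, clarsimp)
    fix u t t' assume *: "Suc 0 \<le> u" "u < p" "t < N" "t' < N"
      "nat (int u * w t mod int p) = nat (int u * w t' mod int p)"
    then have "[int u * w t = int u * w t'] (mod int p)" using p0 by (simp add: unique_euclidean_semiring_class.cong_def eq_nat_nat_iff)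
    moreover have "coprime (int u) (int p)"
      using p * by (metis Suc_le_eq coprime_commute coprime_int_iff nat_dvd_not_less prime_imp_coprime)
    ultimately have "[w t = w t'] (mod int p)" by (simp add: cong_mult_lcancel)
    then show "t = t'" using inj * by blast
  qed
  then have "card (?f ` ({1..<p} \<times> {..<N})) = (p - 1) * N" by (simp add: card_image)
  moreover have "?f ` ({1..<p} \<times> {..<N}) \<subseteq> ?E"
  proof clarsimp
    fix u t assume *: "Suc 0 \<le> u" "u < p" "t < N"
    have "[(int u * w t mod int p) ^ k = (int u * w t) ^ k] (mod int p)" by (intro cong_pow) simp
    also have "(int u * w t) ^ k = int u ^ k * w t ^ k" by (simp add: power_mult_distrib)
    also have "[int u ^ k * w t ^ k = int u ^ k * s] (mod int p)" by (intro cong_mult cong_refl w *)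
    finally have "int p dvd int u ^ k * s - (int u * w t mod int p) ^ k"
      by (metis cong_iff_dvd_diff cong_sym)
    then show "nat (int u * w t mod int p) < p \<and> int p dvd s * int u ^ k - (int u * w t mod int p) ^ k"
      using p0 by (simp add: nat_less_iff mult.commute)
  qed
  moreover have "(0, 0) \<in> ?E" using p0 \<open>k > 0\<close> by (simp add: zero_power)
  moreover have "(0, 0) \<notin> ?f ` ({1..<p} \<times> {..<N})" by auto
  ultimately have "1 + (p - 1) * N = card (insert (0, 0) (?f ` ({1..<p} \<times> {..<N})))"
    by (subst card_insert_disjoint) auto
  also have "\<dots> \<le> card ?E"
    using \<open>?f ` _ \<subseteq> ?E\<close> \<open>(0, 0) \<in> ?E\<close> by (intro card_mono fin) blast
  finally show ?thesis .
qed

lemma power_cos_sum_cong: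
  assumes "p > 0" "[a = b] (mod p)"
  shows "power_cos_sum k p a = power_cos_sum k p b"
  unfolding power_cos_sum_def
  using assms by (intro sum.cong refl cosp_cong cong_mult) (auto simp: cong_int_iff)

text \<open>Multiplication by \<open>v\<close> permutes the residues. It is used twice: to reduce
  the sums to one value per coset of the \<open>k\<close>-th powers, and to make the average on the
  frequency \<open>\<beta> * j ^ k\<close> the same for all \<open>j\<close> prime to
  \<open>p\<close>.\<close>

lemma power_cos_sum_mult_power:
  assumes p: "prime p" and v: "\<not> p dvd v"
  shows "power_cos_sum k p (a * v ^ k) = power_cos_sum k p a"
proof -
  have p0: "p > 0" using p by (simp add: prime_gt_0_nat)
  have cop: "coprime v p" using p v by (simp add: prime_imp_coprime coprime_commute)
  have inj: "inj_on (\<lambda>u. u * v mod p) {..<p}"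
  proof (rule inj_onI)
    fix u u' assume "u \<in> {..<p}" "u' \<in> {..<p}" "u * v mod p = u' * v mod p"
    then have "[u = u'] (mod p)" using cong_mult_rcancel_nat[OF cop] by (simp add: unique_euclidean_semiring_class.cong_def)
    then show "u = u'" using \<open>u \<in> _\<close> \<open>u' \<in> _\<close> by (simp add: unique_euclidean_semiring_class.cong_def)
  qed
  have "(\<lambda>u. u * v mod p) ` {..<p} = {..<p}"
    by (rule endo_inj_surj[OF _ _ inj]) (use p0 in auto)
  with inj have bij: "bij_betw (\<lambda>u. u * v mod p) {..<p} {..<p}" by (rule bij_betw_imageI)
  have "power_cos_sum k p a = (\<Sum>u<p. cosp p (int a * int (u * v mod p) ^ k))"
    unfolding power_cos_sum_def by (rule sum.reindex_bij_betw[OF bij, symmetric])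
  also have "\<dots> = power_cos_sum k p (a * v ^ k)"
    unfolding power_cos_sum_def
  proof (intro sum.cong refl cosp_cong p0)
    fix u
    have "[int (u * v mod p) ^ k = (int u * int v) ^ k] (mod int p)"
      by (intro cong_pow) (simp add: zmod_int)
    then have "[int a * int (u * v mod p) ^ k = int a * (int u * int v) ^ k] (mod int p)"
      by (intro cong_mult cong_refl)
    then show "[int a * int (u * v mod p) ^ k = int (a * v ^ k) * int u ^ k] (mod int p)"
      by (simp add: power_mult_distrib mult_ac)
  qed
  finally show ?thesis ..
qed

section \<open>Moments over the cosets of the k-th powers\<close>

lemma sum_periodic:
  fixes f :: "nat \<Rightarrow> real"
  assumes "\<And>i. f (i + N) = f i"
  shows "(\<Sum>i<m * N. f i) = real m * (\<Sum>i<N. f i)"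
proof -
  have shift: "f (i + m * N) = f i" for i m
  proof (induction m)
    case (Suc m)
    have "i + Suc m * N = (i + m * N) + N" by simp
    then show ?case using assms[of "i + m * N"] Suc by (simp only:)
  qed simp
  have "(\<Sum>i<m * N + n. f i) = (\<Sum>i<m * N. f i) + (\<Sum>i<n. f i)" for n m
    by (induction n) (simp_all add: shift add.commute)
  then have split: "(\<Sum>i<m * N + N. f i) = (\<Sum>i<m * N. f i) + (\<Sum>i<N. f i)" for m by blast
  show ?thesis
  proof (induction m)
    case (Suc m)
    have "Suc m * N = m * N + N" by simp
    then show ?case using split[of m] Suc by (simp add: algebra_simps)
  qed simp
qed

text \<open>If all \<open>N\<close> values exceeded \<open>-s\<close>, they would be below \<open>(N - 1) s\<close>, and the sum of
  \<open>((N - 1) s - c\<^sub>i) (c\<^sub>i + s)\<close> would be positive.\<close>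

lemma exists_le_of_second_moment:
  fixes c :: "nat \<Rightarrow> real"
  assumes zero: "(\<Sum>i<N. c i) = 0" and sq: "s\<^sup>2 * real N * (real N - 1) \<le> (\<Sum>i<N. (c i)\<^sup>2)"
    and "N > 1"
  shows "\<exists>i<N. c i \<le> -s"
proof (rule ccontr)
  assume "\<not> ?thesis"
  then have gt: "c i + s > 0" if "i < N" for i using that by force
  have upper: "(real N - 1) * s - c i > 0" if i: "i < N" for i
  proof -
    have "(\<Sum>j<N. c j + s) = real N * s" by (simp add: sum.distrib zero)
    moreover have "(\<Sum>j<N. c j + s) = (c i + s) + (\<Sum>j\<in>{..<N} - {i}. c j + s)"
      using i by (subst sum.remove[of _ i]) auto
    moreover have "(\<Sum>j\<in>{..<N} - {i}. c j + s) > 0"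
    proof (rule sum_pos)
      have "card ({..<N} - {i}) = N - 1" using i by simp
      then show "{..<N} - {i} \<noteq> {}" using \<open>N > 1\<close> by (metis card.empty less_numeral_extra(3) zero_less_diff)
    qed (use gt in auto)
    ultimately show ?thesis by (simp add: algebra_simps)
  qed
  have "0 < (\<Sum>i<N. ((real N - 1) * s - c i) * (c i + s))"
    using gt upper \<open>N > 1\<close> by (intro sum_pos) auto
  also have "\<dots> = (\<Sum>i<N. s\<^sup>2 * (real N - 1) + ((real N - 2) * s) * c i - (c i)\<^sup>2)"
    by (intro sum.cong refl) (simp add: algebra_simps power2_eq_square)
  also have "\<dots> = real N * (s\<^sup>2 * (real N - 1)) - (\<Sum>i<N. (c i)\<^sup>2)"
    by (simp add: sum.distrib sum_subtractf zero flip: sum_distrib_left)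
  finally show False using sq by (simp add: algebra_simps)
qed

text \<open>On the \<open>N = gcd k (p - 1)\<close> cosets of the \<open>k\<close>-th powers the
  values have sum 0 and sum of squares at least \<open>p * N * (N - 1)\<close>, which forces one of
  them down to \<open>- sqrt p\<close>. For \<open>N = 1\<close> all of them would be 0, whence the
  condition on the gcd.\<close>

theorem exists_small_power_cos_sum:
  fixes p k :: nat
  assumes p: "prime p" and k: "odd k" and gcd: "gcd k (p - 1) > 1"
  shows "\<exists>a. power_cos_sum k p a \<le> - sqrt (real p)"
proof -
  have p1: "p > 1" using p by (rule prime_gt_1_nat)
  have k0: "k > 0" using k by (rule odd_pos)
  define N where "N = gcd k (p - 1)"
  define e where "e = (p - 1) div N"
  have N: "N > 1" "N dvd k" "p - 1 = e * N" using gcd by (auto simp: N_def e_def)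
  obtain g where "residue_primroot p g" using prime_primitive_root_exists[of p] p p1 by blast
  then have ord: "ord p g = p - 1" "coprime p g" using p by (auto simp: residue_primroot_def totient_prime)
  have g_not: "\<not> p dvd g" using ord(2) p1 by (metis coprime_absorb_left nat_neq_iff nat_dvd_1_iff_1)
  have g_iff: "[g ^ i = g ^ j] (mod p) \<longleftrightarrow> [i = j] (mod (p - 1))" for i j
    using order_divides_expdiff[OF ord(2)] ord(1) by simp
  define c where "c i = power_cos_sum k p (g ^ i)" for i
  have periodic: "c (i + N) = c i" for i
  proof -
    \<comment> \<open>Bezout gives \<open>k * x = N\<close> modulo \<open>p - 1\<close>, so
      \<open>g ^ N\<close> is a \<open>k\<close>-th power modulo \<open>p\<close>.\<close>
    obtain x y where "k * x = (p - 1) * y + N"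
      using bezout_nat[of k "p - 1"] k0 unfolding N_def by blast
    then have "i + k * x = i + N + (p - 1) * y" by simp
    then have "[i + N = i + k * x] (mod (p - 1))"
      unfolding unique_euclidean_semiring_class.cong_def by (simp only: mod_mult_self2)
    then have "[g ^ (i + N) = g ^ (i + k * x)] (mod p)" by (simp only: g_iff)
    also have "g ^ (i + k * x) = g ^ i * (g ^ x) ^ k"
      by (simp add: power_add mult.commute flip: power_mult)
    finally have "c (i + N) = power_cos_sum k p (g ^ i * (g ^ x) ^ k)"
      unfolding c_def using p1 by (intro power_cos_sum_cong) simp_all
    also have "\<not> p dvd g ^ x" using prime_dvd_power[OF p] g_not by blast
    then have "power_cos_sum k p (g ^ i * (g ^ x) ^ k) = c i"
      unfolding c_def by (rule power_cos_sum_mult_power[OF p])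
    finally show ?thesis .
  qed
  have reindex: "(\<Sum>a\<in>{1..<p}. f (power_cos_sum k p a)) = real e * (\<Sum>i<N. f (c i))" for f :: "real \<Rightarrow> real"
  proof -
    have "totatives p = {1..<p}" using p by (auto simp: totatives_prime)
    then have "(\<Sum>a\<in>{1..<p}. f (power_cos_sum k p a)) = (\<Sum>i<p - 1. f (power_cos_sum k p (g ^ i mod p)))"
      using sum.reindex_bij_betw[OF residue_primroot_is_generator[OF p1 \<open>residue_primroot p g\<close>],
          of "\<lambda>a. f (power_cos_sum k p a)"] p by (simp add: totient_prime)
    also have "\<dots> = (\<Sum>i<p - 1. f (c i))"
      unfolding c_def using p1 by (intro sum.cong refl arg_cong[where f = f] power_cos_sum_cong) auto
    finally show ?thesis by (simp only: N(3) sum_periodic[of "\<lambda>i. f (c i)" N e] periodic)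
  qed
  have split: "(\<Sum>a<p. f a) = f 0 + (\<Sum>a\<in>{1..<p}. f a)" for f :: "nat \<Rightarrow> real"
    using p1 by (simp add: lessThan_atLeast0 sum.atLeast_Suc_lessThan)
  have C0: "power_cos_sum k p 0 = real p" by (simp add: power_cos_sum_def cosp_def)
  have e0: "e > 0" using N(3) p1 by (cases e) auto
  have "real p + real e * (\<Sum>i<N. c i) = real p"
    using sum_power_cos_sum[OF p k0] reindex[of "\<lambda>x. x"] by (simp add: split C0)
  then have zero: "(\<Sum>i<N. c i) = 0" using e0 by simp
  \<comment> \<open>The powers of \<open>g ^ e\<close> are the \<open>N\<close> solutions of
    \<open>w ^ k = 1\<close> modulo \<open>p\<close>.\<close>
  define w where "w t = int (g ^ (t * e))" for t
  have w_inj: "t = t'" if "t < N" "t' < N" "[w t = w t'] (mod int p)" for t t'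
  proof -
    have "[g ^ (t * e) = g ^ (t' * e)] (mod p)" using that(3) by (simp only: w_def cong_int_iff)
    then have "[t * e = t' * e] (mod (N * e))" using g_iff N(3) by (simp add: mult.commute)
    moreover have "t * e < N * e" "t' * e < N * e" using that e0 by auto
    ultimately have "t * e = t' * e" by (simp only: unique_euclidean_semiring_class.cong_def mod_less)
    then show ?thesis using e0 by simp
  qed
  have w_power: "[w t ^ k = 1] (mod int p)" for t
  proof -
    obtain k' where "k = N * k'" using N(2) by blast
    then have "t * e * k = (p - 1) * (k' * t)" unfolding N(3) by simp
    then have "[t * e * k = 0] (mod (p - 1))" by (simp only: cong_0_iff dvd_triv_left)
    then have "[g ^ (t * e * k) = g ^ 0] (mod p)" by (simp only: g_iff)
    then have "[int (g ^ (t * e * k)) = int 1] (mod int p)" by (simp only: cong_int_iff power_0)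
    then show ?thesis by (simp add: w_def power_mult)
  qed
  have w_coprime: "coprime (w t) (int p)" for t
    using ord(2) by (simp add: w_def coprime_commute coprime_power_left_iff)
  have card1: "1 + (p - 1) * N \<le> card {(u, v). u < p \<and> v < p \<and> int p dvd int u ^ k - int v ^ k}"
    using card_power_pairs_ge[OF p, of N w k 1] w_power w_inj w_coprime k0 by simp
  \<comment> \<open>Since \<open>k\<close> is odd, the \<open>- w t\<close> solve
    \<open>w ^ k = -1\<close>, and the pairs with \<open>u^k + v^k = 0\<close> obey the same lower
    bound.\<close>
  have "1 + (p - 1) * N \<le> card {(u, v). u < p \<and> v < p \<and> int p dvd (-1) * int u ^ k - int v ^ k}"
  proof (rule card_power_pairs_ge[OF p, of N "\<lambda>t. - w t"])
    show "[(- w t) ^ k = -1] (mod int p)" for t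
      using w_power[of t] k by (simp add: cong_minus_minus_iff)
    show "t = t'" if "t < N" "t' < N" "[- w t = - w t'] (mod int p)" for t t'
      using w_inj that by (simp add: cong_minus_minus_iff)
  qed (use w_coprime k0 in auto)
  also have "{(u, v). u < p \<and> v < p \<and> int p dvd (-1) * int u ^ k - int v ^ k}
      = {(u, v). u < p \<and> v < p \<and> int p dvd int u ^ k + int v ^ k}"
  proof -
    have "(-1) * x - y = - (x + y)" for x y :: int by simp
    then show ?thesis by (simp only: dvd_minus_iff)
  qed
  finally have card2: "1 + (p - 1) * N \<le> card {(u, v). u < p \<and> v < p \<and> int p dvd int u ^ k + int v ^ k}" .
  define A where "A = real (1 + (p - 1) * N)"
  have "real p * A = real p / 2 * (A + A)" by simp
  also have "\<dots> \<le> (\<Sum>a<p. (power_cos_sum k p a)\<^sup>2)"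
    unfolding sum_power_cos_sum_squared[OF less_trans[OF zero_less_one p1]] A_def
    by (intro mult_left_mono add_mono of_nat_mono card1 card2) simp
  also have "\<dots> = (real p)\<^sup>2 + real e * (\<Sum>i<N. (c i)\<^sup>2)"
    using reindex[of "\<lambda>x. x\<^sup>2"] by (simp add: split C0)
  finally have "real p * A \<le> (real p)\<^sup>2 + real e * (\<Sum>i<N. (c i)\<^sup>2)" .
  moreover have "A = 1 + real e * real N * real N"
    unfolding A_def by (simp only: N(3) of_nat_add of_nat_mult of_nat_1)
  moreover have rp: "real p = real e * real N + 1"
    using p1 by (simp only: N(3)[symmetric] of_nat_mult[symmetric])
  \<comment> \<open>Removing the term \<open>a = 0\<close>, which is \<open>p^2\<close>, and
    substituting \<open>p = e * N + 1\<close> leaves exactly \<open>e\<close> times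
    \<open>p * N * (N - 1)\<close>.\<close>
  have "real p * (1 + real e * real N * real N) - (real p)\<^sup>2 = real e * (real p * real N * (real N - 1))"
    unfolding rp by (simp add: algebra_simps power2_eq_square)
  ultimately have "real e * (real p * real N * (real N - 1)) \<le> real e * (\<Sum>i<N. (c i)\<^sup>2)" by simp
  then have "real p * real N * (real N - 1) \<le> (\<Sum>i<N. (c i)\<^sup>2)"
    using e0 by (simp only: mult_le_cancel_left_pos of_nat_0_less_iff)
  then have "(sqrt (real p))\<^sup>2 * real N * (real N - 1) \<le> (\<Sum>i<N. (c i)\<^sup>2)" by simp
  from exists_le_of_second_moment[OF zero this N(1)] obtain i where i: "c i \<le> - sqrt (real p)" by blast
  then show ?thesis unfolding c_def by blast
qed

subsection \<open>Trigonometric polynomials on power residues\<close>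

lemma sum_inverse_le_ln: "n > 0 \<Longrightarrow> (\<Sum>m=1..n. 1 / real m) \<le> 1 + ln (real n)"
proof (induction n rule: nat_induct_non_zero)
  case (Suc n)
  have "ln (real n / real (Suc n)) \<le> real n / real (Suc n) - 1"
    using Suc by (intro ln_le_minus_one) auto
  also have "\<dots> = - (1 / real (Suc n))" by (simp add: field_simps)
  finally have "1 / real (Suc n) \<le> ln (real (Suc n)) - ln (real n)"
    using Suc by (simp add: ln_div del: of_nat_Suc)
  with Suc show ?case by simp
qed simp

text \<open>For \<open>n = m ^ r\<close> with \<open>r >= 2\<close> the term is at most
  \<open>(ln X) / m\<close>, and at most \<open>2 ln X\<close> exponents occur; a harmonic sum over
  all \<open>m <= X\<close> then suffices.\<close>

lemma sum_mangoldt_nonprime_le: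
  assumes "X \<ge> 2"
  shows "(\<Sum>n | 1 \<le> n \<and> real n \<le> X \<and> \<not> prime n. mangoldt n / sqrt (real n)) \<le> 2 * (ln X)\<^sup>2 * (1 + ln X)"
proof -
  define M where "M = nat \<lfloor>X\<rfloor>"
  \<comment> \<open>From \<open>2 ^ r <= X\<close> and \<open>ln 2 >= 1/2\<close> follows
    \<open>r <= 2 ln X\<close>.\<close>
  define R where "R = nat \<lfloor>2 * ln X\<rfloor>"
  define A where "A = {n. 1 \<le> n \<and> real n \<le> X \<and> \<not> prime n \<and> primepow n}"
  have lnX: "ln X > 0" using assms by simp
  have M: "M > 0" "real M \<le> X" using assms by (auto simp: M_def le_nat_iff le_floor_iff)
  have fin: "finite {n. 1 \<le> n \<and> real n \<le> X \<and> \<not> prime n}"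
    by (rule finite_subset[of _ "{..M}"]) (auto simp: M_def le_nat_iff le_floor_iff)
  have sub: "A \<subseteq> (\<lambda>(m, r). m ^ r) ` ({1..M} \<times> {1..R} \<inter> {(m, r). r \<ge> 2 \<and> m ^ r \<in> A})"
  proof
    fix n assume n: "n \<in> A"
    then obtain m r where mr: "prime m" "r > 0" "n = m ^ r" by (auto simp: A_def primepow_def)
    have "r \<noteq> 1" using mr n by (auto simp: A_def)
    with mr have "r \<ge> 2" by simp
    have "m \<ge> 2" using mr(1) by (rule prime_ge_2_nat)
    have nX: "real n \<le> X" using n by (simp add: A_def)
    have "m \<le> n" using mr \<open>m \<ge> 2\<close> by (simp add: self_le_power)
    then have "m \<le> M" using nX unfolding M_def by (simp add: le_nat_iff le_floor_iff)
    have "real r * (1 / 2) \<le> real r * ln (real m)"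
    proof (intro mult_left_mono)
      have "1 / 2 \<le> ln (2 :: real)" using ln_le_minus_one[of "1 / 2 :: real"] by (simp add: ln_div)
      also have "\<dots> \<le> ln (real m)" using \<open>m \<ge> 2\<close> by simp
      finally show "1 / 2 \<le> ln (real m)" .
    qed simp
    also have "\<dots> = ln (real n)" using \<open>m \<ge> 2\<close> by (simp add: mr(3) ln_realpow)
    also have "\<dots> \<le> ln X" using nX n by (simp add: A_def)
    finally have "r \<le> R" unfolding R_def by (simp add: le_nat_iff le_floor_iff)
    with \<open>r \<ge> 2\<close> \<open>m \<ge> 2\<close> \<open>m \<le> M\<close> mr(3) n
    show "n \<in> (\<lambda>(m, r). m ^ r) ` ({1..M} \<times> {1..R} \<inter> {(m, r). r \<ge> 2 \<and> m ^ r \<in> A})"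
      by (intro image_eqI[of _ _ "(m, r)"]) auto
  qed
  have "(\<Sum>n | 1 \<le> n \<and> real n \<le> X \<and> \<not> prime n. mangoldt n / sqrt (real n)) = (\<Sum>n\<in>A. mangoldt n / sqrt (real n))"
    by (rule sum.mono_neutral_right[OF fin]) (auto simp: A_def mangoldt_def)
  also have "\<dots> \<le> (\<Sum>n\<in>(\<lambda>(m, r). m ^ r) ` ({1..M} \<times> {1..R} \<inter> {(m, r). r \<ge> 2 \<and> m ^ r \<in> A}). mangoldt n / sqrt (real n))"
    by (intro sum_mono2 sub) (auto simp: mangoldt_nonneg)
  also have "\<dots> \<le> (\<Sum>(m, r)\<in>{1..M} \<times> {1..R} \<inter> {(m, r). r \<ge> 2 \<and> m ^ r \<in> A}. mangoldt (m ^ r) / sqrt (real (m ^ r)))"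
    by (rule order_trans[OF sum_image_le]) (auto simp: mangoldt_nonneg case_prod_unfold)
  also have "\<dots> \<le> (\<Sum>(m, r)\<in>{1..M} \<times> {1..R} \<inter> {(m, r). r \<ge> 2 \<and> m ^ r \<in> A}. ln X * (1 / real m))"
  proof (rule sum_mono, clarify)
    fix m r assume *: "m \<in> {1..M}" "r \<in> {1..R}" "r \<ge> 2" "m ^ r \<in> A"
    have "mangoldt (m ^ r) \<le> ln (real (m ^ r))" using * by (intro mangoldt_le) auto
    also have "real (m ^ r) \<le> X" "0 < m ^ r" using * by (auto simp: A_def)
    then have "ln (real (m ^ r)) \<le> ln X" by (intro ln_mono) (simp_all only: of_nat_0_less_iff)
    finally have 1: "mangoldt (m ^ r) \<le> ln X" .
    have "m ^ 2 \<le> m ^ r" using * by (intro power_increasing) auto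
    then have "real m ^ 2 \<le> real (m ^ r)" by (simp flip: of_nat_power)
    then have "real m \<le> sqrt (real (m ^ r))" by (rule real_le_rsqrt)
    then have 2: "1 / sqrt (real (m ^ r)) \<le> 1 / real m" using * by (intro divide_left_mono) auto
    have "mangoldt (m ^ r) * (1 / sqrt (real (m ^ r))) \<le> ln X * (1 / real m)"
      using 1 2 lnX by (intro mult_mono) (auto simp: mangoldt_nonneg)
    then show "mangoldt (m ^ r) / sqrt (real (m ^ r)) \<le> ln X * (1 / real m)" by simp
  qed
  also have "\<dots> \<le> (\<Sum>(m, r)\<in>{1..M} \<times> {1..R}. ln X * (1 / real m))"
    using lnX by (intro sum_mono2) auto
  also have "\<dots> = real R * ln X * (\<Sum>m=1..M. 1 / real m)"
    by (simp add: sum.cartesian_product[symmetric] sum_distrib_left mult_ac)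
  also have "\<dots> \<le> (2 * ln X) * ln X * (1 + ln X)"
  proof (intro mult_mono)
    show "real R \<le> 2 * ln X" using lnX by (simp add: R_def)
    have "(\<Sum>m=1..M. 1 / real m) \<le> 1 + ln (real M)" using M by (intro sum_inverse_le_ln)
    also have "\<dots> \<le> 1 + ln X" using M by simp
    finally show "(\<Sum>m=1..M. 1 / real m) \<le> 1 + ln X" .
  qed (use lnX in \<open>auto intro: sum_nonneg\<close>)
  finally show ?thesis by (simp add: power2_eq_square)
qed

section \<open>Primes congruent to 1 modulo d\<close>

definition primes_1_mod :: "nat \<Rightarrow> real \<Rightarrow> nat set" where
  "primes_1_mod d X = {p. prime p \<and> [p = 1] (mod d) \<and> real p \<le> X}"

lemma finite_primes_1_mod: "finite (primes_1_mod d X)"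
  by (rule finite_subset[of _ "{..nat \<lfloor>X\<rfloor>}"]) (auto simp: primes_1_mod_def le_nat_iff le_floor_iff)

theorem weighted_primes_lower_bound:
  assumes d: "prime d" "odd d" and c: "c < 7 / 20"
  shows "\<forall>\<^sub>F X in at_top. c * sqrt X \<le> real (d - 1) * (\<Sum>p\<in>primes_1_mod d X. ln (real p) * (1 / sqrt (real p) - 1 / sqrt X))"
proof -
  obtain g where "residue_primroot d g"
    using prime_primitive_root_exists[of d] d(1) prime_gt_1_nat[OF d(1)] by blast
  then interpret prime_modulus d g using d by unfold_locales
  obtain h where h: "continuous_on {s. Re s \<ge> 1} h" "\<And>s. Re s > 1 \<Longrightarrow> D s = 1 / (s - 1) + h s"
    by (rule D_minus_pole_continuous) (rule that)
  \<comment> \<open>The gap between \<open>c\<close> and \<open>c'\<close> absorbs the proper prime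
    powers, whose contribution is of smaller order than \<open>sqrt X\<close>.\<close>
  obtain c' where c': "c < c'" "c' < 7 / 20" using c dense by blast
  have "\<forall>\<^sub>F X in at_top. c' * sqrt X \<le> (\<Sum>n\<in>{1..nat \<lfloor>X\<rfloor>}. acoef n * (1 / sqrt (real n) - 1 / sqrt X))"
    by (rule Tauberian_lower_bound[OF abs_conv_right_acoef acoef_nonneg h c'(2)])
  moreover have "\<forall>\<^sub>F X in at_top. real (d - 1) * (2 * (ln X)\<^sup>2 * (1 + ln X)) \<le> (c' - c) * sqrt X"
  proof -
    have "(\<lambda>X::real. real (d - 1) * (2 * (ln X)\<^sup>2 * (1 + ln X))) \<in> o(\<lambda>X. sqrt X)" by real_asymp
    from landau_o.smallD[OF this, of "c' - c"] c' have
      "\<forall>\<^sub>F X in at_top. norm (real (d - 1) * (2 * (ln X)\<^sup>2 * (1 + ln X))) \<le> (c' - c) * norm (sqrt X)" by simp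
    then show ?thesis using eventually_ge_at_top[of 0] by eventually_elim auto
  qed
  ultimately show ?thesis
    using eventually_ge_at_top[of 2]
  proof eventually_elim
    case (elim X)
    define f where "f n = 1 / sqrt (real n) - 1 / sqrt X" for n
    have f: "0 \<le> f n" "f n \<le> 1 / sqrt (real n)" if "1 \<le> n" "real n \<le> X" for n
      using that elim(3) by (auto simp: f_def intro!: divide_left_mono)
    have dom: "{1..nat \<lfloor>X\<rfloor>} = {n. 1 \<le> n \<and> real n \<le> X \<and> prime n} \<union> {n. 1 \<le> n \<and> real n \<le> X \<and> \<not> prime n}"
      using elim(3) by (auto simp: le_nat_iff le_floor_iff)
    have fin: "finite {n. 1 \<le> n \<and> real n \<le> X \<and> prime n}" "finite {n. 1 \<le> n \<and> real n \<le> X \<and> \<not> prime n}"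
      by (rule finite_subset[of _ "{..nat \<lfloor>X\<rfloor>}"], auto simp: le_nat_iff le_floor_iff)+
    have "(\<Sum>n\<in>{1..nat \<lfloor>X\<rfloor>}. acoef n * f n) = (\<Sum>n | 1 \<le> n \<and> real n \<le> X \<and> prime n. acoef n * f n)
        + (\<Sum>n | 1 \<le> n \<and> real n \<le> X \<and> \<not> prime n. acoef n * f n)"
      unfolding dom by (rule sum.union_disjoint[OF fin]) auto
    also have "(\<Sum>n | 1 \<le> n \<and> real n \<le> X \<and> \<not> prime n. acoef n * f n)
        \<le> (\<Sum>n | 1 \<le> n \<and> real n \<le> X \<and> \<not> prime n. real (d - 1) * (mangoldt n / sqrt (real n)))"
    proof (intro sum_mono)
      fix n assume n: "n \<in> {n. 1 \<le> n \<and> real n \<le> X \<and> \<not> prime n}"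
      have "acoef n \<le> real (d - 1) * mangoldt n" by (simp add: acoef_def mangoldt_nonneg)
      then have "acoef n * f n \<le> (real (d - 1) * mangoldt n) * (1 / sqrt (real n))"
        using f[of n] n acoef_nonneg by (intro mult_mono) (auto simp: mangoldt_nonneg)
      then show "acoef n * f n \<le> real (d - 1) * (mangoldt n / sqrt (real n))" by simp
    qed
    also have "\<dots> \<le> real (d - 1) * (2 * (ln X)\<^sup>2 * (1 + ln X))"
      unfolding sum_distrib_left[symmetric] by (intro mult_left_mono sum_mangoldt_nonprime_le elim) simp
    also have "(\<Sum>n | 1 \<le> n \<and> real n \<le> X \<and> prime n. acoef n * f n)
        = (\<Sum>p\<in>primes_1_mod d X. real (d - 1) * (ln (real p) * f p))"
      by (rule sum.mono_neutral_cong_right[OF fin(1)])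
         (auto simp: primes_1_mod_def acoef_def prime_ge_Suc_0_nat split: if_splits)
    finally show ?case
      using elim(1,2) by (simp add: f_def sum_distrib_left algebra_simps)
  qed
qed

text \<open>The sum of \<open>mangoldt\<close> over all divisors of \<open>j\<close> is
  \<open>ln j\<close>, and the primes are only some of these divisors.\<close>

lemma sum_ln_prime_divisors_le:
  assumes "j > 0"
  shows "(\<Sum>p\<in>{p \<in> primes_1_mod d X. p dvd j}. ln (real p)) \<le> ln (real j)"
proof -
  have "(\<Sum>p\<in>{p \<in> primes_1_mod d X. p dvd j}. ln (real p)) = (\<Sum>p\<in>{p \<in> primes_1_mod d X. p dvd j}. mangoldt p)"
    by (intro sum.cong) (auto simp: primes_1_mod_def)
  also have "\<dots> \<le> (\<Sum>p | p dvd j. mangoldt p)"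
    using assms by (intro sum_mono2 finite_divisors_nat) (auto simp: mangoldt_nonneg)
  also have "\<dots> = ln (real j)" using mangoldt_sum[of j, where 'a = real] assms by simp
  finally show ?thesis .
qed

section \<open>Test measures on power residues\<close>

text \<open>Testing \<open>T \<ge> 0\<close> against a probability measure on the points \<open>a u\<^sup>k / (\<beta> p)\<close>, \<open>1 \<le> u < p\<close>. On
  the frequency \<open>\<beta> j\<^sup>k\<close> the measure attached to \<open>p\<close> gives \<open>-c\<^sub>p\<close> if \<open>p\<close> does not divide \<open>j\<close>, and \<open>1\<close>
  otherwise. Weighting it by \<open>ln p / (1 + c\<^sub>p)\<close> makes the loss from the prime divisors of \<open>j\<close> at most
  \<open>ln j\<close>.\<close>

lemma constant_term_lower_bound:
  assumes k: "odd k" and d: "prime d" "d dvd k" and \<beta>: "\<beta> > 0" and X: "X > 0" and L0: "L > 0"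
    and L: "\<And>j. 1 \<le> j \<Longrightarrow> \<beta> * j ^ k \<le> n \<Longrightarrow> ln (real j) \<le> L"
    and sum: "L \<le> (\<Sum>p\<in>primes_1_mod d X. ln (real p) * (1 / sqrt (real p) - 1 / sqrt X))"
    and b: "0 \<le> b0" "\<And>m. m \<in> power_multiples \<beta> k \<Longrightarrow> m \<le> n \<Longrightarrow> 0 \<le> b m"
      "\<And>x. 0 \<le> cos_poly (power_multiples \<beta> k) n b0 b x" "cos_poly (power_multiples \<beta> k) n b0 b 0 = 1"
  shows "1 / (sqrt X + 1) \<le> b0"
proof -
  define P where "P = primes_1_mod d X"
  define E where "E = {m. m \<in> power_multiples \<beta> k \<and> m \<le> n}"
  have finP: "finite P" unfolding P_def by (rule finite_primes_1_mod)
  have P: "prime p" "p > 1" "gcd k (p - 1) > 1" if "p \<in> P" for p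
  proof -
    show p: "prime p" using that by (simp add: P_def primes_1_mod_def)
    then show p1: "p > 1" by (rule prime_gt_1_nat)
    have "[p = 1] (mod d)" using that by (simp add: P_def primes_1_mod_def)
    then have "d dvd p - 1" using cong_altdef_nat[of 1 p d] p1 by (simp add: cong_sym_eq)
    then have "d dvd gcd k (p - 1)" using d by simp
    moreover have "gcd k (p - 1) > 0" using p1 by simp
    ultimately have "d \<le> gcd k (p - 1)" by (rule dvd_imp_le)
    then show "gcd k (p - 1) > 1" using prime_gt_1_nat[OF d(1)] by simp
  qed
  have "\<forall>p\<in>P. \<exists>a. power_cos_sum k p a \<le> - sqrt (real p)"
    using exists_small_power_cos_sum P k by blast
  then obtain a where a: "\<And>p. p \<in> P \<Longrightarrow> power_cos_sum k p (a p) \<le> - sqrt (real p)" by metis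
  \<comment> \<open>Minus the average of the cosines over \<open>1 <= u < p\<close>: leaving out
    \<open>u = 0\<close> accounts for both the 1 and the \<open>p - 1\<close>.\<close>
  define c where "c p = (1 - power_cos_sum k p (a p)) / real (p - 1)" for p
  define w where "w p = ln (real p) / (1 + c p)" for p
  have c_ge: "1 / (sqrt (real p) - 1) \<le> c p" and sq: "sqrt (real p) > 1" if p: "p \<in> P" for p
  proof -
    show sq: "sqrt (real p) > 1" using P[OF p] by simp
    have eq: "real (p - 1) = (sqrt (real p) - 1) * (sqrt (real p) + 1)"
      using P[OF p] by (simp add: algebra_simps)
    have "1 / (s - 1) = (s + 1) / ((s - 1) * (s + 1))" if "s > 1" for s :: real
      using that by simp
    from this[OF sq] have "1 / (sqrt (real p) - 1) = (sqrt (real p) + 1) / real (p - 1)" by (simp only: eq)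
    also have "\<dots> \<le> c p" unfolding c_def using a[OF p] by (intro divide_right_mono) auto
    finally show "1 / (sqrt (real p) - 1) \<le> c p" .
  qed
  have c_pos: "c p > 0" if "p \<in> P" for p
    using c_ge[OF that] sq[OF that] by (smt (verit) zero_less_divide_1_iff)
  have lnp: "ln (real p) > 0" if "p \<in> P" for p using P[OF that] by simp
  have w: "0 \<le> w p" "w p \<le> ln (real p)" "ln (real p) / sqrt (real p) \<le> w p * c p" "w p * (1 + c p) = ln (real p)"
    if p: "p \<in> P" for p
  proof -
    show "0 \<le> w p" "w p \<le> ln (real p)" "w p * (1 + c p) = ln (real p)"
      using c_pos[OF p] lnp[OF p] by (auto simp: w_def field_simps)
    \<comment> \<open>The function \<open>t / (1 + t)\<close> increases and takes the value
      \<open>1 / s\<close> at \<open>t = 1 / (s - 1)\<close>; with \<open>s = sqrt p\<close> this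
      gives the gain \<open>ln p / sqrt p\<close>.\<close>
    have "1 / s \<le> x / (1 + x)" if "1 / (s - 1) \<le> x" "s > 1" "x > 0" for s x :: real
      using that by (simp add: field_simps)
    from mult_left_mono[OF this[OF c_ge[OF p] sq[OF p] c_pos[OF p]], of "ln (real p)"] lnp[OF p]
    show "ln (real p) / sqrt (real p) \<le> w p * c p" by (simp add: w_def)
  qed
  \<comment> \<open>The \<open>\<beta>\<close> in the denominator cancels against the frequency
    \<open>\<beta> * j ^ k\<close>.\<close>
  define x where "x p u = real (a p * u ^ k) / (real \<beta> * real p)" for p u
  have average: "(\<Sum>u\<in>{1..<p}. cos (2 * pi * real (\<beta> * j ^ k) * x p u)) / real (p - 1)
      = (if p dvd j then 1 else - c p)" if p: "p \<in> P" for p j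
  proof -
    have "cos (2 * pi * real (\<beta> * j ^ k) * x p u) = cosp p (int (a p * j ^ k) * int u ^ k)" for u
      using \<beta> by (simp add: x_def cosp_def field_simps)
    moreover have "power_cos_sum k p q = 1 + (\<Sum>u\<in>{1..<p}. cosp p (int q * int u ^ k))" for q
    proof -
      have "{..<p} = insert 0 {1..<p}" using P[OF p] by auto
      then show ?thesis using k by (simp add: power_cos_sum_def cosp_def zero_power odd_pos)
    qed
    ultimately have eq: "(\<Sum>u\<in>{1..<p}. cos (2 * pi * real (\<beta> * j ^ k) * x p u)) = power_cos_sum k p (a p * j ^ k) - 1"
      by simp
    show ?thesis
    proof (cases "p dvd j")
      case True
      then have "p dvd a p * j ^ k" using k by (simp add: dvd_power_le[of p j 1 k, simplified] odd_pos Suc_leI)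
      then have "power_cos_sum k p (a p * j ^ k) = power_cos_sum k p 0"
        using P[OF p] by (intro power_cos_sum_cong) (auto simp: cong_0_iff)
      also have "\<dots> = real p" by (simp add: power_cos_sum_def cosp_def)
      finally show ?thesis using True P[OF p] unfolding eq by (simp add: of_nat_diff)
    next
      case False
      then show ?thesis
        unfolding eq power_cos_sum_mult_power[OF P(1)[OF p] False] by (simp add: c_def minus_divide_left)
    qed
  qed
  \<comment> \<open>If \<open>p\<close> divides \<open>j\<close>, the average is 1 and contributes
    \<open>w p = ln p - w p * c p\<close>. Written so, every \<open>p\<close> contributes
    \<open>- w p * c p\<close>, and the prime divisors of \<open>j\<close> add an excess of at most
    \<open>ln j <= L\<close> in total.\<close>
  have frequency: "(\<Sum>p\<in>P. w p * ((\<Sum>u\<in>{1..<p}. cos (2 * pi * real m * x p u)) / real (p - 1)))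
      \<le> L - (\<Sum>p\<in>P. ln (real p) / sqrt (real p))" if m: "m \<in> E" for m
  proof -
    obtain j where j: "1 \<le> j" "m = \<beta> * j ^ k" using m by (auto simp: E_def power_multiples_def)
    have "(\<Sum>p\<in>P. w p * ((\<Sum>u\<in>{1..<p}. cos (2 * pi * real m * x p u)) / real (p - 1)))
        = (\<Sum>p\<in>P. (if p dvd j then ln (real p) else 0) - w p * c p)"
    proof (intro sum.cong refl)
      fix p assume p: "p \<in> P"
      show "w p * ((\<Sum>u\<in>{1..<p}. cos (2 * pi * real m * x p u)) / real (p - 1))
          = (if p dvd j then ln (real p) else 0) - w p * c p"
        unfolding j(2) average[OF p] using w(4)[OF p] by (simp add: distrib_left)
    qed
    also have "\<dots> = (\<Sum>p\<in>{p \<in> P. p dvd j}. ln (real p)) - (\<Sum>p\<in>P. w p * c p)"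
      by (simp add: sum_subtractf sum.inter_filter[OF finP])
    finally have eq: "(\<Sum>p\<in>P. w p * ((\<Sum>u\<in>{1..<p}. cos (2 * pi * real m * x p u)) / real (p - 1)))
        = (\<Sum>p\<in>{p \<in> P. p dvd j}. ln (real p)) - (\<Sum>p\<in>P. w p * c p)" .
    have "(\<Sum>p\<in>{p \<in> P. p dvd j}. ln (real p)) \<le> ln (real j)"
      unfolding P_def using j by (intro sum_ln_prime_divisors_le) auto
    also have "ln (real j) \<le> L" using j m by (intro L) (auto simp: E_def)
    finally have "(\<Sum>p\<in>{p \<in> P. p dvd j}. ln (real p)) \<le> L" .
    moreover have "(\<Sum>p\<in>P. ln (real p) / sqrt (real p)) \<le> (\<Sum>p\<in>P. w p * c p)"
      using w by (intro sum_mono) auto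
    ultimately show ?thesis unfolding eq by linarith
  qed
  define \<theta> where "\<theta> = (\<Sum>p\<in>P. ln (real p))"
  \<comment> \<open>Hence every admissible frequency receives at most
    \<open>- \<theta> / sqrt X\<close>, while the constant term is multiplied by a total mass of at
    most \<open>\<theta>\<close>.\<close>
  have sum': "\<theta> / sqrt X \<le> (\<Sum>p\<in>P. ln (real p) / sqrt (real p)) - L"
    using sum by (simp add: \<theta>_def P_def right_diff_distrib sum_subtractf sum_divide_distrib)
  have "P \<noteq> {}" using sum L0 by (auto simp: P_def)
  then have \<theta>: "\<theta> > 0" unfolding \<theta>_def using finP lnp by (intro sum_pos) auto
  have "finite E" unfolding E_def by simp
  have b_sum: "(\<Sum>m\<in>E. b m) = 1 - b0" using b(4) by (simp add: cos_poly_def E_def)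
  have bE: "0 \<le> b m" if "m \<in> E" for m using that b(2) by (simp add: E_def)
  have "0 \<le> (\<Sum>p\<in>P. w p * ((\<Sum>u\<in>{1..<p}. cos_poly (power_multiples \<beta> k) n b0 b (x p u)) / real (p - 1)))"
    using w(1) b(3) by (intro sum_nonneg mult_nonneg_nonneg divide_nonneg_nonneg) auto
  also have "\<dots> = (\<Sum>p\<in>P. w p * b0 + (\<Sum>m\<in>E. b m * (w p * ((\<Sum>u\<in>{1..<p}. cos (2 * pi * real m * x p u)) / real (p - 1)))))"
  proof (intro sum.cong refl)
    fix p assume p: "p \<in> P"
    have "(\<Sum>u\<in>{1..<p}. cos_poly (power_multiples \<beta> k) n b0 b (x p u))
        = real (p - 1) * b0 + (\<Sum>m\<in>E. b m * (\<Sum>u\<in>{1..<p}. cos (2 * pi * real m * x p u)))"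
      unfolding cos_poly_def E_def[symmetric] sum.distrib sum_distrib_left by (subst sum.swap) simp
    then show "w p * ((\<Sum>u\<in>{1..<p}. cos_poly (power_multiples \<beta> k) n b0 b (x p u)) / real (p - 1))
        = w p * b0 + (\<Sum>m\<in>E. b m * (w p * ((\<Sum>u\<in>{1..<p}. cos (2 * pi * real m * x p u)) / real (p - 1))))"
      using P[OF p] by (simp add: add_divide_distrib distrib_left sum_divide_distrib sum_distrib_left mult_ac)
  qed
  also have "\<dots> = (\<Sum>p\<in>P. w p) * b0
      + (\<Sum>m\<in>E. b m * (\<Sum>p\<in>P. w p * ((\<Sum>u\<in>{1..<p}. cos (2 * pi * real m * x p u)) / real (p - 1))))"
    unfolding sum.distrib sum_distrib_right sum_distrib_left[of "b _"] by (subst sum.swap) simp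
  also have "\<dots> \<le> \<theta> * b0 + (\<Sum>m\<in>E. b m * (- (\<theta> / sqrt X)))"
  proof (intro add_mono mult_right_mono sum_mono mult_left_mono)
    show "(\<Sum>p\<in>P. w p) \<le> \<theta>" unfolding \<theta>_def using w by (intro sum_mono) auto
    show "(\<Sum>p\<in>P. w p * ((\<Sum>u\<in>{1..<p}. cos (2 * pi * real m * x p u)) / real (p - 1))) \<le> - (\<theta> / sqrt X)"
      if "m \<in> E" for m
      using frequency[OF that] sum' by linarith
  qed (use b(1) bE in auto)
  also have "\<dots> = \<theta> * (b0 - (1 - b0) / sqrt X)"
    unfolding sum_distrib_right[symmetric] b_sum by (simp add: algebra_simps)
  finally have "0 \<le> b0 - (1 - b0) / sqrt X" using \<theta> by (simp add: zero_le_mult_iff)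
  then have "1 \<le> b0 * (sqrt X + 1)" using X by (simp add: field_simps)
  moreover have "sqrt X + 1 > 0" using X by (simp add: add_pos_pos)
  ultimately show ?thesis by (simp add: pos_divide_le_eq)
qed

section \<open>Choice of X and conclusion\<close>

theorem theorem2:
  fixes k \<beta> :: nat
  assumes "3 \<le> k" and "odd k" and "0 < \<beta>"
  shows "\<exists>\<epsilon> :: nat \<Rightarrow> real. \<epsilon> \<in> o(\<lambda>_. 1) \<and>
    (\<forall>\<^sub>F n in sequentially.
       gamma_plus (power_multiples \<beta> k) n
         \<ge> (1 / real (totient k) + \<epsilon> n) * inverse (ln (real n)))"
proof (intro exI conjI)
  \<comment> \<open>The error term can be identically 0: for \<open>k >= 3\<close> the constant
    \<open>17/50 > 1/3\<close> leaves a factor \<open>51/50\<close> to spare.\<close>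
  show "(\<lambda>_. 0) \<in> o(\<lambda>_. 1 :: real)" by simp
  obtain d where d: "prime d" "d dvd k" using prime_factor_nat[of k] assms(1) by auto
  have "odd d" using d(2) assms(2) by (meson dvd_trans)
  have d3: "d \<ge> 3" using prime_ge_2_nat[OF d(1)] \<open>odd d\<close> by (cases "d = 2") auto
  have "d - 1 \<le> totient k"
  proof -
    have "totient d dvd totient k" using d(2) by (rule totient_dvd)
    then show ?thesis using d(1) assms(1) by (auto simp: totient_prime dest!: dvd_imp_le)
  qed
  then have tot: "real (d - 1) \<le> real (totient k)" by simp
  \<comment> \<open>Chosen so that \<open>sqrt X = K * ln n\<close> makes
    \<open>17/50 * sqrt X\<close> equal to \<open>(d - 1) * (ln n) / k\<close>, exactly what the
    prime divisors of \<open>j\<close> may cost. The constant \<open>17/50\<close> lies between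
    \<open>1/3\<close> and \<open>7/20\<close>.\<close>
  define K where "K = real (d - 1) / (real k * (17 / 50))"
  have K: "K > 0" using d3 assms(1) by (simp add: K_def)
  have X_lim: "filterlim (\<lambda>n. (K * ln (real n))\<^sup>2) at_top sequentially"
  proof (rule filterlim_pow_at_top)
    have "filterlim (\<lambda>n. ln (real n)) at_top sequentially" by real_asymp
    then show "filterlim (\<lambda>n. K * ln (real n)) at_top sequentially"
      by (rule filterlim_tendsto_pos_mult_at_top[OF tendsto_const K])
  qed simp
  have "\<forall>\<^sub>F n in sequentially. 17 / 50 * sqrt ((K * ln (real n))\<^sup>2) \<le> real (d - 1) *
      (\<Sum>p\<in>primes_1_mod d ((K * ln (real n))\<^sup>2). ln (real p) * (1 / sqrt (real p) - 1 / sqrt ((K * ln (real n))\<^sup>2)))"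
    by (rule eventually_compose_filterlim[OF weighted_primes_lower_bound[OF d(1) \<open>odd d\<close>] X_lim]) simp
  \<comment> \<open>As \<open>d - 1 >= 2\<close>, this gives \<open>(d - 1) * ln n >= 52\<close>;
    one part in 51 of it then pays for the \<open>+ 1\<close> in \<open>sqrt X + 1\<close>.\<close>
  moreover have "\<forall>\<^sub>F n in sequentially. 26 \<le> ln (real n)" by real_asymp
  ultimately show "\<forall>\<^sub>F n in sequentially. (1 / real (totient k) + 0) * inverse (ln (real n)) \<le> gamma_plus (power_multiples \<beta> k) n"
    using eventually_gt_at_top[of 0]
  proof eventually_elim
    case (elim n)
    define X where "X = (K * ln (real n))\<^sup>2"
    have sqrtX: "sqrt X = K * ln (real n)" using K elim(2) by (simp add: X_def)
    have X: "X > 0" using K elim(2) by (simp add: X_def)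
    define L where "L = ln (real n) / real k"
    have L: "ln (real j) \<le> L" if "1 \<le> j" "\<beta> * j ^ k \<le> n" for j
    proof -
      have "1 * j ^ k \<le> \<beta> * j ^ k" using assms(3) by (intro mult_right_mono) auto
      with that(2) have "j ^ k \<le> n" by linarith
      then have "real j ^ k \<le> real n" by (simp flip: of_nat_power)
      then have "ln (real j ^ k) \<le> ln (real n)" using that elim(3) by simp
      then show ?thesis using that assms(1) by (simp add: L_def ln_realpow field_simps)
    qed
    have "17 / 50 * (K * ln (real n)) = real (d - 1) * L"
      using assms(1) by (simp add: K_def L_def field_simps)
    then have sum: "L \<le> (\<Sum>p\<in>primes_1_mod d X. ln (real p) * (1 / sqrt (real p) - 1 / sqrt X))"
      using elim(1) d3 unfolding X_def[symmetric] sqrtX by simp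
    have bound: "(1 / real (totient k) + 0) * inverse (ln (real n)) \<le> 1 / (sqrt X + 1)"
    proof -
      have "2 * 26 \<le> real (d - 1) * ln (real n)"
        using d3 elim(2) by (intro mult_mono) auto
      then have big: "51 \<le> real (d - 1) * ln (real n)" by linarith
      \<comment> \<open>Here \<open>k >= 3\<close> enters, through
        \<open>3 * 17/50 = 51/50 > 1\<close>.\<close>
      have "K \<le> real (d - 1) / (3 * (17 / 50))"
        unfolding K_def using assms(1) by (intro divide_left_mono mult_right_mono) auto
      then have "K * ln (real n) \<le> real (d - 1) / (51 / 50) * ln (real n)"
        using elim(2) by (intro mult_right_mono) auto
      also have "\<dots> = real (d - 1) * ln (real n) - real (d - 1) * ln (real n) / 51" by simp
      also have "\<dots> \<le> real (d - 1) * ln (real n) - 1" using big by linarith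
      finally have "sqrt X + 1 \<le> real (d - 1) * ln (real n)" by (simp add: sqrtX)
      also have "\<dots> \<le> real (totient k) * ln (real n)" using tot elim(2) by (intro mult_right_mono) auto
      finally have "1 / (real (totient k) * ln (real n)) \<le> 1 / (sqrt X + 1)"
        using X assms(1) elim(2) by (intro divide_left_mono mult_pos_pos) (auto simp: add_pos_pos intro: less_le_trans)
      then show ?thesis by (simp add: divide_inverse)
    qed
    show ?case unfolding gamma_plus_def
    proof (rule cInf_greatest)
      have "cos_poly (power_multiples \<beta> k) n 1 (\<lambda>_. 0) x = 1" for x by (simp add: cos_poly_def)
      then show "{b0. \<exists>b. 0 \<le> b0 \<and> (\<forall>m. m \<in> power_multiples \<beta> k \<and> m \<le> n \<longrightarrow> 0 \<le> b m) \<and>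
          (\<forall>x. 0 \<le> cos_poly (power_multiples \<beta> k) n b0 b x) \<and> cos_poly (power_multiples \<beta> k) n b0 b 0 = 1} \<noteq> {}"
        by (auto intro!: exI[of _ "1::real"] exI[of _ "\<lambda>_. 0::real"])
      fix b0 assume "b0 \<in> {b0. \<exists>b. 0 \<le> b0 \<and> (\<forall>m. m \<in> power_multiples \<beta> k \<and> m \<le> n \<longrightarrow> 0 \<le> b m) \<and>
          (\<forall>x. 0 \<le> cos_poly (power_multiples \<beta> k) n b0 b x) \<and> cos_poly (power_multiples \<beta> k) n b0 b 0 = 1}"
      then obtain b where b: "0 \<le> b0" "\<And>m. m \<in> power_multiples \<beta> k \<Longrightarrow> m \<le> n \<Longrightarrow> 0 \<le> b m"
          "\<And>x. 0 \<le> cos_poly (power_multiples \<beta> k) n b0 b x" "cos_poly (power_multiples \<beta> k) n b0 b 0 = 1"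
        by blast
      have "1 / (sqrt X + 1) \<le> b0"
      proof (rule constant_term_lower_bound[OF assms(2) d assms(3) X _ L sum b])
        show "0 < L" using elim(2) assms(1) by (simp add: L_def)
      qed
      with bound show "(1 / real (totient k) + 0) * inverse (ln (real n)) \<le> b0" by linarith
    qed
  qed
qed

end
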